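(* Let $F,A\in\mathbb{R}^{m\times n}$, $H\in\mathbb{R}^{p\times n}$, let $Q_0,Q\in\mathbb{R}^{m\times m}$ and $R\in\mathbb{R}^{p\times p}$ be symmetric positive definite, let $\ell\in\mathbb{R}^m$, and assume $(F,A,H)$ is $\ell$-detectable. Let $\mathscr{S}_g=(A_g,B_g,C_g,D_g)$ be a stabilizable LTI system associated with the dual DAE $\frac{d(F^\top q)}{dt}=A^\top q-H^\top u$, with state dimension $l$ and associated state map $\mathcal{M}_g$. Let $S=\begin{bmatrix}Q^{-1}&0\\0&R^{-1}\end{bmatrix}$ and let $P$ be the unique symmetric positive definite solution, with corresponding $K$, of $$0=PA_g+A_g^\top P-K^\top(D_g^\top SD_g)K+C_g^\top SC_g,$$ $$K=(D_g^\top SD_g)^{-1}(B_g^\top P+D_g^\top SC_g)\ \text{ if }D_g\neq0,\qquad K=0\in\mathbb{R}^{1\times l}\ \text{ if }D_g=0.$$ Let $\hat C_u,\hat D_u$ be the matrices formed by the last $p$ rows of $C_g,D_g$, and let $\check U(t,s)=u^*(t-s)$, $t\ge s\ge0$, be the infinite horizon minimax observer, where $u^*(t)=(\hat C_u-\hat D_uK)v^*(t)$, $\dot v^*(t)=(A_g-B_gK)v^*(t)$, $v^*(0)=\mathcal{M}_g(F^\top\ell)$. For any $(x,f,y,\eta)\in\mathscr{EE}([0,+\infty))$, the estimation error $e(t):=\ell^\top Fx(t)-\mathscr{O}_{\check U}(y)(t)$ satisfies $$e(t)=\ell^\top F\mathcal{M}_g^\top\widetilde r(t),$$ where $$\frac{d\widetilde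 r}{dt}=(A_g-B_gK)^\top\widetilde r(t)+(C_g-D_gK)^\top\begin{bmatrix}f(t)\\-\eta(t)\end{bmatrix},\qquad\widetilde r(0)=(C_g-D_gK)^\top\begin{bmatrix}Fx(0)\\0\end{bmatrix}.$$ In particular, if $f=0$, $\eta=0$, then $\lim_{t\to\infty}e(t)=0$. If $f,\eta$ are bounded, i.e. $\sup_{t>0}\{f^\top(t)f(t),\eta^\top(t)\eta(t)\}<+\infty$, then the estimation error is bounded, i.e. $\sup_{t>0}e^\top(t)e(t)<+\infty$. If $f\in L^2([0,+\infty),\mathbb{R}^m)$ and $\eta\in L^2([0,+\infty),\mathbb{R}^p)$, then $e\in L^2([0,+\infty),\mathbb{R})$.
   Context: Notation. $M^+$ is the Moore-Penrose pseudoinverse of a matrix $M$. $L^2_{loc}(I)$ denotes functions on an interval $I$ that are square integrable on every compact subinterval; $AC(I)$ denotes absolutely continuous functions (on every compact subinterval if $I=[0,+\infty)$). When $Fx$ (resp. $F^\top q$) is absolutely continuous, $Fx(t)$ (resp. $F^\top q(t)$) denotes the value at $t$ of the absolutely continuous function. An LTI system $\dot x=Ax+Bu$, $y=Cx+Du$ is identified with $(A,B,C,D)$. DAE. For $I=[0,t_1]$, $0<t_1\in\mathbb{R}$, or $I=[0,+\infty)$, a solution on $I$ of the DAE $\frac{d(Fx)}{dt}=Ax+f$, $y=Hx+\eta$ is a tuple $(x,f,y,\eta)\in L^2_{loc}(I,\mathbb{R}^n)\times L^2_{loc}(I,\mathbb{R}^m)\times L^2_{loc}(I,\mathbb{R}^p)\times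 L^2_{loc}(I,\mathbb{R}^p)$ such that $Fx$ is absolutely continuous, $Fx(t)=Fx(0)+\int_0^t(Ax(s)+f(s))ds$ for all $t\in I$, and $y(t)=Hx(t)+\eta(t)$ a.e. on $I$. It is admissible if $(Fx(0))^\top Q_0Fx(0)+\int_0^{\tau}(f^\top Qf+\eta^\top R\eta)dt\le1$ for all $\tau\in I$. The set of admissible solutions on $I$ is $\mathscr{EE}(I)$. Observers. For $U\in L^2([0,t],\mathbb{R}^p)$, $\sigma(U,\ell,t):=\sup_{(x,f,y,\eta)\in\mathscr{EE}([0,t])}\big(\ell^\top Fx(t)-\int_0^ty^\top(s)U(s)ds\big)^2$. $\mathscr{F}$ is the set of all maps $U:\{(\tau,s)\mid\tau>0,\ s\in[0,\tau]\}\to\mathbb{R}^p$ such that for every $\tau>0$ the function $U(\tau,\cdot)$ belongs to $L^2([0,\tau],\mathbb{R}^p)$. For $U\in\mathscr{F}$ and $y\in L^2_{loc}([0,+\infty),\mathbb{R}^p)$, $\mathscr{O}_U(y)(t):=\int_0^ty^\top(s)U(t,s)ds$, and $\sigma(U,\ell):=\limsup_{t\to\infty}\sigma(U(t,\cdot),\ell,t)$. $\check U\in\mathscr{F}$ is an infinite horizon minimax observer if $\sigma(\check U,\ell)=\inf_{U\in\mathscr{F}}\sigma(U,\ell)<+\infty$. (It is known that, under $\ell$-detectability, the algebraic Riccati equation $0=PA_g+A_g^\top P-K^\top(D_g^\top SD_g)K+C_g^\top SC_g$, with $S=\begin{bmatrix}Q^{-1}&0\\0&R^{-1}\end{bmatrix}$,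 $K=(D_g^\top SD_g)^{-1}(B_g^\top P+D_g^\top SC_g)$ if $D_g\neq0$ and $K=0\in\mathbb{R}^{1\times l}$ if $D_g=0$, has a unique symmetric positive definite solution $P$, that $A_g-B_gK$ is Hurwitz, i.e. all its eigenvalues have negative real part, and that $\check U(t,s)=u^*(t-s)$, $t\ge s\ge0$, with $u^*(t)=(\hat C_u-\hat D_uK)v^*(t)$, $\dot v^*(t)=(A_g-B_gK)v^*(t)$, $v^*(0)=\mathcal{M}_g(F^\top\ell)$, where $\hat C_u,\hat D_u$ are formed by the last $p$ rows of $C_g,D_g$, is an infinite horizon minimax observer.) Dual DAE. For $I=[0,\tau]$, $0<\tau\in\mathbb{R}$, or $I=[0,+\infty)$, a solution on $I$ of the dual DAE $\frac{d(F^\top q)}{dt}=A^\top q-H^\top u$ is a pair $(q,u)\in L^2_{loc}(I,\mathbb{R}^m)\times L^2_{loc}(I,\mathbb{R}^p)$ such that $F^\top q$ is absolutely continuous and $F^\top q(t)=F^\top q(0)+\int_0^t(A^\top q(s)-H^\top u(s))ds$ for all $t\in I$. The set of these is $\mathcal{B}_I(F^\top,A^\top,H^\top)$, and $\mathscr{D}_\ell(I)$ is the subset of those with $F^\top q(0)=F^\top\ell$. $(F,A,H)$ is $\ell$-detectable if there exists $(q,u)\in\mathscr{D}_\ell([0,+\infty))$ with $\lim_{t\to\infty}F^\top q(t)=0$. Associated LTI system. Let $A_a\in\mathbb{R}^{\hat n\times\hat n}$, $B_a\in\mathbb{R}^{\hat n\times k}$, $C_a\in\mathbb{R}^{(m+p)\times\hat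 n}$, $D_a\in\mathbb{R}^{(m+p)\times k}$ for some $\hat n,k>0$. $\mathscr{S}=(A_a,B_a,C_a,D_a)$ is associated with the dual DAE if: (1) either $k=1$ and $D_a=0$, $B_a=0$, or $D_a$ has full column rank; (2) with $C_s,D_s$ the first $m$ rows of $C_a,D_a$, $F^\top D_s=0$ and $\mathrm{rank}\,F^\top C_s=\hat n$; (3) for every interval $I=[0,\tau]$, $0<\tau\in\mathbb{R}$, or $I=[0,+\infty)$: $(q,u)\in\mathcal{B}_I(F^\top,A^\top,H^\top)$ if and only if there exists $(p,g)\in AC(I,\mathbb{R}^{\hat n})\times L^2_{loc}(I,\mathbb{R}^k)$ such that $\dot p=A_ap+B_ag$ a.e. and $\begin{bmatrix} q \\ u \end{bmatrix}=C_ap+D_ag$ a.e. The matrix $\mathcal{M}:=(F^\top C_s)^+$ is the state map of $\mathscr{S}$. Stabilizable associated LTI system. Let $\mathscr{S}=(A_a,B_a,C_a,D_a)$ be associated with the dual DAE and let $\mathcal{V}_g\subseteq\mathbb{R}^{\hat n}$ be its stabilizability subspace (the set of initial states that can be steered asymptotically to $0$ by some input), $l=\dim\mathcal{V}_g$. $\mathcal{V}_g$ is $A_a$-invariant and contains $\mathrm{im}\,B_a$, so there is an invertible $T$ with $T(\mathcal{V}_g)=\mathrm{im}\begin{bmatrix}I_l&0\\0&0\end{bmatrix}$ and $$TA_aT^{-1}=\begin{bmatrix}A_g&\star\\0&\star\end{bmatrix},\quad TB_a=\begin{bmatrix}B_g\\0\end{bmatrix},\quad C_aT^{-1}=\begin{bmatrix}C_g&\star\end{bmatrix},$$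 $A_g\in\mathbb{R}^{l\times l}$, $B_g\in\mathbb{R}^{l\times k}$, $C_g\in\mathbb{R}^{(m+p)\times l}$. Then $\mathscr{S}_g=(A_g,B_g,C_g,D_g)$ with $D_g=D_a$ is called a stabilizable LTI system associated with the dual DAE, and $\mathcal{M}_g=\begin{bmatrix}I_l&0\end{bmatrix}T\mathcal{M}$ is the associated state map. *)

theory Defs
  imports
    "HOL-Analysis.Analysis"
    "Jordan_Normal_Form.DL_Rank"
    "Jordan_Normal_Form.Gauss_Jordan_Elimination"
begin

no_notation inner (infix \<open>\<bullet>\<close> 70)
no_notation vec_nth (infixl \<open>$\<close> 90)
hide_const (open) Finite_Cartesian_Product.vec

section \<open>Matrices\<close>

text \<open>
  Matrices are those of \<open>Jordan_Normal_Form\<close>, whose dimensions are natural numbers: the state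
  dimensions below are quantified over, and that of a stabilizable associated system may be zero.
\<close>

definition mat_inv :: "real mat \<Rightarrow> real mat" where
  "mat_inv M = the (mat_inverse M)"

definition pos_def_mat :: "nat \<Rightarrow> real mat \<Rightarrow> bool" where
  "pos_def_mat n M \<longleftrightarrow> M \<in> carrier_mat n n \<and> transpose_mat M = M \<and>
     (\<forall>v \<in> carrier_vec n. v \<noteq> 0\<^sub>v n \<longrightarrow> v \<bullet> (M *\<^sub>v v) > 0)"

text \<open>Moore-Penrose pseudoinverse, by the four Penrose equations.\<close>

definition pseudoinverse :: "real mat \<Rightarrow> real mat" where
  "pseudoinverse M = (THE X. X \<in> carrier_mat (dim_col M) (dim_row M) \<and>
     M * X * M = M \<and> X * M * X = X \<and>
     transpose_mat (M * X) = M * X \<and> transpose_mat (X * M) = X * M)"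

definition top_rows :: "nat \<Rightarrow> real mat \<Rightarrow> real mat" where
  "top_rows k M = mat k (dim_col M) (\<lambda>(i, j). M $$ (i, j))"

definition bottom_rows :: "nat \<Rightarrow> real mat \<Rightarrow> real mat" where
  "bottom_rows k M = mat k (dim_col M) (\<lambda>(i, j). M $$ (dim_row M - k + i, j))"


section \<open>Function spaces\<close>

text \<open>
  Elements of \<open>L\<^sup>2\<close> are represented by functions; only their values on the interval \<open>I\<close> matter.
  Lebesgue (not Borel) measurability is used, so that all notions are invariant under changes on
  null sets.
\<close>

definition time_interval :: "real set \<Rightarrow> bool" where
  "time_interval I \<longleftrightarrow> (\<exists>\<tau>>0. I = {0..\<tau>}) \<or> I = {0..}"

definition square_integrable :: "real set \<Rightarrow> (real \<Rightarrow> real) \<Rightarrow> bool" where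
  "square_integrable I g \<longleftrightarrow>
     set_borel_measurable lebesgue I g \<and> set_integrable lebesgue I (\<lambda>t. (g t)\<^sup>2)"

definition L2 :: "real set \<Rightarrow> nat \<Rightarrow> (real \<Rightarrow> real vec) set" where
  "L2 I n = {g. (\<forall>t\<in>I. g t \<in> carrier_vec n) \<and> (\<forall>i<n. square_integrable I (\<lambda>t. g t $ i))}"

definition L2_loc :: "real set \<Rightarrow> nat \<Rightarrow> (real \<Rightarrow> real vec) set" where
  "L2_loc I n = {g. (\<forall>t\<in>I. g t \<in> carrier_vec n) \<and>
     (\<forall>a b. {a..b} \<subseteq> I \<longrightarrow> g \<in> L2 {a..b} n)}"

definition abs_continuous_on :: "real set \<Rightarrow> (real \<Rightarrow> real) \<Rightarrow> bool" where
  "abs_continuous_on J g \<longleftrightarrow> (\<forall>\<epsilon>>0. \<exists>\<delta>>0. \<forall>\<D> S. \<D> division_of S \<and> S \<subseteq> J \<and>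
     (\<Sum>K\<in>\<D>. measure lborel K) < \<delta> \<longrightarrow> (\<Sum>K\<in>\<D>. \<bar>g (Sup K) - g (Inf K)\<bar>) < \<epsilon>)"

definition AC :: "real set \<Rightarrow> nat \<Rightarrow> (real \<Rightarrow> real vec) set" where
  "AC I n = {g. (\<forall>t\<in>I. g t \<in> carrier_vec n) \<and>
     (\<forall>a b. {a..b} \<subseteq> I \<longrightarrow> (\<forall>i<n. abs_continuous_on {a..b} (\<lambda>t. g t $ i)))}"

text \<open>
  For \<open>x \<in> L\<^sup>2\<close> only an a.e. equivalence class is meaningful, so ``\<open>F x\<close> is absolutely continuous''
  means that it has an absolutely continuous version, and \<open>F x(t)\<close> is the value of that version.
  It is unique on \<open>I\<close> for every \<open>I\<close> with \<open>time_interval I\<close>.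
\<close>

definition is_ac_version :: "real set \<Rightarrow> nat \<Rightarrow> (real \<Rightarrow> real vec) \<Rightarrow> (real \<Rightarrow> real vec) \<Rightarrow> bool" where
  "is_ac_version I n g z \<longleftrightarrow> z \<in> AC I n \<and> (AE t in lebesgue. t \<in> I \<longrightarrow> z t = g t)"

definition ac_version :: "real set \<Rightarrow> nat \<Rightarrow> (real \<Rightarrow> real vec) \<Rightarrow> real \<Rightarrow> real vec" where
  "ac_version I n g = (SOME z. is_ac_version I n g z)"

text \<open>\<open>ac_mult I M x t\<close> is \<open>M x(t)\<close> in this sense.\<close>

definition ac_mult :: "real set \<Rightarrow> real mat \<Rightarrow> (real \<Rightarrow> real vec) \<Rightarrow> real \<Rightarrow> real vec" where
  "ac_mult I M x = ac_version I (dim_row M) (\<lambda>t. M *\<^sub>v x t)"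

definition vec_integral :: "nat \<Rightarrow> real \<Rightarrow> (real \<Rightarrow> real vec) \<Rightarrow> real vec" where
  "vec_integral n t g = vec n (\<lambda>i. LINT s:{0..t}|lebesgue. g s $ i)"


section \<open>The DAE and its admissible solutions\<close>

definition dae_solution ::
  "real set \<Rightarrow> real mat \<Rightarrow> real mat \<Rightarrow> real mat \<Rightarrow>
   (real \<Rightarrow> real vec) \<Rightarrow> (real \<Rightarrow> real vec) \<Rightarrow> (real \<Rightarrow> real vec) \<Rightarrow> (real \<Rightarrow> real vec) \<Rightarrow> bool" where
  "dae_solution I F A H x f y \<eta> \<longleftrightarrow>
     x \<in> L2_loc I (dim_col F) \<and> f \<in> L2_loc I (dim_row F) \<and>
     y \<in> L2_loc I (dim_row H) \<and> \<eta> \<in> L2_loc I (dim_row H) \<and>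
     (\<exists>z. is_ac_version I (dim_row F) (\<lambda>t. F *\<^sub>v x t) z) \<and>
     (\<forall>t\<in>I. ac_mult I F x t =
        ac_mult I F x 0 + vec_integral (dim_row F) t (\<lambda>s. A *\<^sub>v x s + f s)) \<and>
     (AE t in lebesgue. t \<in> I \<longrightarrow> y t = H *\<^sub>v x t + \<eta> t)"

definition admissible_solutions ::
  "real mat \<Rightarrow> real mat \<Rightarrow> real mat \<Rightarrow> real mat \<Rightarrow> real mat \<Rightarrow> real mat \<Rightarrow> real set \<Rightarrow>
   ((real \<Rightarrow> real vec) \<times> (real \<Rightarrow> real vec) \<times> (real \<Rightarrow> real vec) \<times> (real \<Rightarrow> real vec)) set" where
  "admissible_solutions F A H Q0 Q R I = {(x, f, y, \<eta>). dae_solution I F A H x f y \<eta> \<and>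
     (\<forall>\<tau>\<in>I. ac_mult I F x 0 \<bullet> (Q0 *\<^sub>v ac_mult I F x 0) +
        (LINT t:{0..\<tau>}|lebesgue. f t \<bullet> (Q *\<^sub>v f t) + \<eta> t \<bullet> (R *\<^sub>v \<eta> t)) \<le> 1)}"


section \<open>Observers\<close>

definition sigma_at ::
  "real mat \<Rightarrow> real mat \<Rightarrow> real mat \<Rightarrow> real mat \<Rightarrow> real mat \<Rightarrow> real mat \<Rightarrow> real vec \<Rightarrow>
   real \<Rightarrow> (real \<Rightarrow> real vec) \<Rightarrow> ereal" where
  "sigma_at F A H Q0 Q R ell t U =
     (SUP (x, f, y, \<eta>) \<in> admissible_solutions F A H Q0 Q R {0..t}.
        ereal ((ell \<bullet> ac_mult {0..t} F x t - (LINT s:{0..t}|lebesgue. y s \<bullet> U s))\<^sup>2))"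

definition observer_maps :: "nat \<Rightarrow> (real \<Rightarrow> real \<Rightarrow> real vec) set" where
  "observer_maps p = {U. \<forall>\<tau>>0. U \<tau> \<in> L2 {0..\<tau>} p}"

definition observer_output ::
  "(real \<Rightarrow> real \<Rightarrow> real vec) \<Rightarrow> (real \<Rightarrow> real vec) \<Rightarrow> real \<Rightarrow> real" where
  "observer_output U y t = (LINT s:{0..t}|lebesgue. y s \<bullet> U t s)"

definition sigma_inf ::
  "real mat \<Rightarrow> real mat \<Rightarrow> real mat \<Rightarrow> real mat \<Rightarrow> real mat \<Rightarrow> real mat \<Rightarrow> real vec \<Rightarrow>
   (real \<Rightarrow> real \<Rightarrow> real vec) \<Rightarrow> ereal" where
  "sigma_inf F A H Q0 Q R ell U = Limsup at_top (\<lambda>t. sigma_at F A H Q0 Q R ell t (U t))"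

definition minimax_observer ::
  "real mat \<Rightarrow> real mat \<Rightarrow> real mat \<Rightarrow> real mat \<Rightarrow> real mat \<Rightarrow> real mat \<Rightarrow> real vec \<Rightarrow>
   (real \<Rightarrow> real \<Rightarrow> real vec) \<Rightarrow> bool" where
  "minimax_observer F A H Q0 Q R ell U \<longleftrightarrow>
     U \<in> observer_maps (dim_row H) \<and>
     sigma_inf F A H Q0 Q R ell U =
       (INF V \<in> observer_maps (dim_row H). sigma_inf F A H Q0 Q R ell V) \<and>
     sigma_inf F A H Q0 Q R ell U < \<infinity>"

definition estimation_error ::
  "real mat \<Rightarrow> real vec \<Rightarrow> (real \<Rightarrow> real \<Rightarrow> real vec) \<Rightarrow> (real \<Rightarrow> real vec) \<Rightarrow> (real \<Rightarrow> real vec) \<Rightarrow>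
   real \<Rightarrow> real" where
  "estimation_error F ell U x y t = ell \<bullet> ac_mult {0..} F x t - observer_output U y t"


section \<open>The dual DAE and detectability\<close>

definition dual_solution ::
  "real set \<Rightarrow> real mat \<Rightarrow> real mat \<Rightarrow> real mat \<Rightarrow> (real \<Rightarrow> real vec) \<Rightarrow> (real \<Rightarrow> real vec) \<Rightarrow> bool" where
  "dual_solution I F A H q u \<longleftrightarrow>
     q \<in> L2_loc I (dim_row F) \<and> u \<in> L2_loc I (dim_row H) \<and>
     (\<exists>z. is_ac_version I (dim_col F) (\<lambda>t. transpose_mat F *\<^sub>v q t) z) \<and>
     (\<forall>t\<in>I. ac_mult I (transpose_mat F) q t = ac_mult I (transpose_mat F) q 0 +
        vec_integral (dim_col F) t (\<lambda>s. transpose_mat A *\<^sub>v q s - transpose_mat H *\<^sub>v u s))"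

definition detectable :: "real mat \<Rightarrow> real mat \<Rightarrow> real mat \<Rightarrow> real vec \<Rightarrow> bool" where
  "detectable F A H ell \<longleftrightarrow> (\<exists>q u. dual_solution {0..} F A H q u \<and>
     ac_mult {0..} (transpose_mat F) q 0 = transpose_mat F *\<^sub>v ell \<and>
     (\<forall>i<dim_col F. ((\<lambda>t. ac_mult {0..} (transpose_mat F) q t $ i) \<longlongrightarrow> 0) at_top))"


section \<open>Associated LTI systems\<close>

definition lti_trajectory ::
  "real set \<Rightarrow> real mat \<Rightarrow> real mat \<Rightarrow> (real \<Rightarrow> real vec) \<Rightarrow> (real \<Rightarrow> real vec) \<Rightarrow> bool" where
  "lti_trajectory I A B v g \<longleftrightarrow>
     v \<in> AC I (dim_row A) \<and> g \<in> L2_loc I (dim_col B) \<and>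
     (AE t in lebesgue. t \<in> I \<longrightarrow> (\<forall>i<dim_row A.
        ((\<lambda>s. v s $ i) has_real_derivative (A *\<^sub>v v t + B *\<^sub>v g t) $ i) (at t within I)))"

definition associated_lti ::
  "real mat \<Rightarrow> real mat \<Rightarrow> real mat \<Rightarrow> nat \<Rightarrow> nat \<Rightarrow>
   real mat \<Rightarrow> real mat \<Rightarrow> real mat \<Rightarrow> real mat \<Rightarrow> bool" where
  "associated_lti F A H nh k Aa Ba Ca Da \<longleftrightarrow>
     (let m = dim_row F; n = dim_col F; p = dim_row H;
          Cs = top_rows m Ca; Ds = top_rows m Da in
      nh > 0 \<and> k > 0 \<and>
      Aa \<in> carrier_mat nh nh \<and> Ba \<in> carrier_mat nh k \<and>
      Ca \<in> carrier_mat (m + p) nh \<and> Da \<in> carrier_mat (m + p) k \<and>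
      (k = 1 \<and> Da = 0\<^sub>m (m + p) k \<and> Ba = 0\<^sub>m nh k \<or> vec_space.rank (m + p) Da = k) \<and>
      transpose_mat F * Ds = 0\<^sub>m n k \<and> vec_space.rank n (transpose_mat F * Cs) = nh \<and>
      (\<forall>I q u. time_interval I \<and> (\<forall>t\<in>I. q t \<in> carrier_vec m \<and> u t \<in> carrier_vec p) \<longrightarrow>
        (dual_solution I F A H q u \<longleftrightarrow>
         (\<exists>v g. lti_trajectory I Aa Ba v g \<and>
            (AE t in lebesgue. t \<in> I \<longrightarrow> q t @\<^sub>v u t = Ca *\<^sub>v v t + Da *\<^sub>v g t)))))"

definition state_map :: "real mat \<Rightarrow> real mat \<Rightarrow> real mat" where
  "state_map F Ca = pseudoinverse (transpose_mat F * top_rows (dim_row F) Ca)"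

definition stabilizability_subspace :: "real mat \<Rightarrow> real mat \<Rightarrow> real vec set" where
  "stabilizability_subspace A B = {v0 \<in> carrier_vec (dim_row A).
     \<exists>v g. lti_trajectory {0..} A B v g \<and> v 0 = v0 \<and>
       (\<forall>i<dim_row A. ((\<lambda>t. v t $ i) \<longlongrightarrow> 0) at_top)}"

text \<open>
  As \<open>T\<close> is invertible, the condition on the image of the stabilizability subspace forces
  \<open>l\<close> to be its dimension. The block rows \<open>[Cg Z]\<close> and \<open>[I 0]\<close> are written as
  \<open>four_block_mat\<close> with an empty lower block row.
\<close>

definition stabilizable_associated_lti ::
  "real mat \<Rightarrow> real mat \<Rightarrow> real mat \<Rightarrow> nat \<Rightarrow> nat \<Rightarrow>
   real mat \<Rightarrow> real mat \<Rightarrow> real mat \<Rightarrow> real mat \<Rightarrow> real mat \<Rightarrow> bool" where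
  "stabilizable_associated_lti F A H l k Ag Bg Cg Dg Mg \<longleftrightarrow>
     (\<exists>nh Aa Ba Ca Da T Ti X Y Z.
        associated_lti F A H nh k Aa Ba Ca Da \<and> l \<le> nh \<and>
        Ag \<in> carrier_mat l l \<and> Bg \<in> carrier_mat l k \<and>
        Cg \<in> carrier_mat (dim_row F + dim_row H) l \<and>
        X \<in> carrier_mat l (nh - l) \<and> Y \<in> carrier_mat (nh - l) (nh - l) \<and>
        Z \<in> carrier_mat (dim_row F + dim_row H) (nh - l) \<and>
        T \<in> carrier_mat nh nh \<and> Ti \<in> carrier_mat nh nh \<and> T * Ti = 1\<^sub>m nh \<and> Ti * T = 1\<^sub>m nh \<and>
        (\<lambda>v. T *\<^sub>v v) ` stabilizability_subspace Aa Ba =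
          (\<lambda>w. four_block_mat (1\<^sub>m l) (0\<^sub>m l (nh - l)) (0\<^sub>m (nh - l) l) (0\<^sub>m (nh - l) (nh - l)) *\<^sub>v w)
            ` carrier_vec nh \<and>
        T * Aa * Ti = four_block_mat Ag X (0\<^sub>m (nh - l) l) Y \<and>
        T * Ba = Bg @\<^sub>r 0\<^sub>m (nh - l) k \<and>
        Ca * Ti = four_block_mat Cg Z (0\<^sub>m 0 l) (0\<^sub>m 0 (nh - l)) \<and>
        Dg = Da \<and>
        Mg = four_block_mat (1\<^sub>m l) (0\<^sub>m l (nh - l)) (0\<^sub>m 0 l) (0\<^sub>m 0 (nh - l)) * T * state_map F Ca)"


section \<open>The algebraic Riccati equation\<close>

definition weight_mat :: "real mat \<Rightarrow> real mat \<Rightarrow> real mat" where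
  "weight_mat Q R = four_block_mat (mat_inv Q) (0\<^sub>m (dim_row Q) (dim_col R))
     (0\<^sub>m (dim_row R) (dim_col Q)) (mat_inv R)"

definition riccati_gain ::
  "real mat \<Rightarrow> real mat \<Rightarrow> real mat \<Rightarrow> real mat \<Rightarrow> real mat \<Rightarrow> real mat \<Rightarrow> real mat" where
  "riccati_gain S Ag Bg Cg Dg P =
     (if Dg \<noteq> 0\<^sub>m (dim_row Dg) (dim_col Dg)
      then mat_inv (transpose_mat Dg * S * Dg) * (transpose_mat Bg * P + transpose_mat Dg * S * Cg)
      else 0\<^sub>m 1 (dim_col Ag))"

definition pos_def_riccati_solution ::
  "real mat \<Rightarrow> real mat \<Rightarrow> real mat \<Rightarrow> real mat \<Rightarrow> real mat \<Rightarrow> real mat \<Rightarrow> bool" where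
  "pos_def_riccati_solution S Ag Bg Cg Dg P \<longleftrightarrow> pos_def_mat (dim_row Ag) P \<and>
     (let K = riccati_gain S Ag Bg Cg Dg P in
      0\<^sub>m (dim_row Ag) (dim_row Ag) =
        P * Ag + transpose_mat Ag * P - transpose_mat K * (transpose_mat Dg * S * Dg) * K
          + transpose_mat Cg * S * Cg)"

end

theory Submission
  imports Defs
begin

text \<open>
  Write \<open>AK = Ag - Bg K\<close>, \<open>W = Cg - Dg K\<close>, and split \<open>W\<close> into its first \<open>m\<close> rows \<open>Cq\<close> and its
  last \<open>p\<close> rows \<open>Cu\<close>, so that the observer kernel is \<open>Cu v(t - s)\<close>.

  The formula for the error is a duality statement. Let \<open>z\<close> be the absolutely continuous version of
  \<open>F x\<close>. Along the closed loop, \<open>q = Cq v\<close> and \<open>u = Cu v\<close> solve the dual DAE, because the associated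
  system parametrizes its solutions; since \<open>q\<close> and \<open>u\<close> are smooth, the dual DAE then holds pointwise,
  \<open>F\<^sup>T q' = A\<^sup>T q - H\<^sup>T u\<close>. Consequently
  \<open>\<phi>(s) = v(t - s) \<bullet> r(s) - q(t - s) \<bullet> z(s)\<close> has the derivative \<open>- u(t - s) \<bullet> y(s)\<close> almost everywhere,
  and it vanishes at \<open>s = 0\<close> by the choice of \<open>r(0)\<close>. Integrating over \<open>[0, t]\<close> expresses the output of
  the observer by \<open>q(0) \<bullet> z(t) - v(0) \<bullet> r(t)\<close> (\<open>observer_error_identity\<close>). Detectability says that
  the initial state \<open>v(0)\<close> of the stabilizable system reproduces \<open>F\<^sup>T q(0) = F\<^sup>T \<ell>\<close>
  (\<open>detectable_initial_state\<close>), whence \<open>q(0) \<bullet> z(t) = \<ell> \<bullet> z(t)\<close> and \<open>e(t) = v(0) \<bullet> r(t)\<close>.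

  For the three asymptotic statements, no spectral theory of \<open>AK\<close> is needed. The Riccati equation
  gives \<open>P AK + AK\<^sup>T P = - W\<^sup>T S W\<close> (\<open>riccati_lyapunov\<close>), and \<open>W\<close> is injective, as already \<open>F\<^sup>T Cq\<close>
  is: it is a restriction of \<open>F\<^sup>T C\<^sub>s\<close>, which has full column rank. So \<open>W\<^sup>T S W\<close> is positive
  definite, and \<open>V = r \<bullet> P\<^sup>-\<^sup>1 r\<close> satisfies \<open>V' \<le> - \<alpha> V + \<beta> (f \<bullet> f + \<eta> \<bullet> \<eta>)\<close> almost everywhere with
  \<open>\<alpha> > 0\<close> (\<open>lyapunov_dissipation\<close>), while \<open>e\<^sup>2 \<le> \<gamma> V\<close>. Convergence, boundedness and square
  integrability of \<open>e\<close> follow from this differential inequality (\<open>dissipative_estimates\<close>).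

  Two facts from real analysis carry the argument: an absolutely continuous function is the integral
  of its almost everywhere derivative, and the indefinite integral of an integrable function is
  differentiable almost everywhere with the expected derivative. The first is proved directly with
  gauges; the second turns the integral form of the DAE into a differential equation and, with the
  matrix exponential, yields the existence of \<open>r\<close>.
\<close>

section \<open>Absolutely continuous functions\<close>

lemma division_of_subset_intervalE:
  fixes a b :: real
  assumes "\<D> division_of S" "S \<subseteq> {a..b}" "K \<in> \<D>"
  obtains u v where "K = {u..v}" "a \<le> u" "u \<le> v" "v \<le> b"
proof -
  obtain u v where "K = cbox u v" using division_ofD(4)[OF assms(1,3)] by blast
  moreover have "K \<noteq> {}" "K \<subseteq> {a..b}" using division_ofD(2,3)[OF assms(1,3)] assms(2) by auto
  ultimately show thesis using that[of u v] by (auto simp: cbox_interval)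
qed

text \<open>
  Closure properties of absolute continuity all come from this comparison: sums, products and
  Lipschitz functions have increments dominated by those of absolutely continuous functions.
\<close>

lemma abs_continuous_on_dominated:
  fixes g g1 g2 :: "real \<Rightarrow> real"
  assumes g1: "abs_continuous_on {a..b} g1" and g2: "abs_continuous_on {a..b} g2"
    and dom: "\<And>u v. a \<le> u \<Longrightarrow> u \<le> v \<Longrightarrow> v \<le> b \<Longrightarrow>
      \<bar>g v - g u\<bar> \<le> C * (\<bar>g1 v - g1 u\<bar> + \<bar>g2 v - g2 u\<bar>)"
  shows "abs_continuous_on {a..b} g"
  unfolding abs_continuous_on_def
proof (intro allI impI)
  fix e :: real assume "e > 0"
  define C' where "C' = \<bar>C\<bar> + 1"
  have C': "C' > 0" "C \<le> C'" by (auto simp: C'_def)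
  define e' where "e' = e / (2 * C')"
  have e': "e' > 0" using \<open>e > 0\<close> C' by (simp add: e'_def)
  obtain d1 where d1: "d1 > 0" "\<And>\<D> S. \<D> division_of S \<Longrightarrow> S \<subseteq> {a..b} \<Longrightarrow>
      (\<Sum>K\<in>\<D>. measure lborel K) < d1 \<Longrightarrow> (\<Sum>K\<in>\<D>. \<bar>g1 (Sup K) - g1 (Inf K)\<bar>) < e'"
    using g1 e' unfolding abs_continuous_on_def by meson
  obtain d2 where d2: "d2 > 0" "\<And>\<D> S. \<D> division_of S \<Longrightarrow> S \<subseteq> {a..b} \<Longrightarrow>
      (\<Sum>K\<in>\<D>. measure lborel K) < d2 \<Longrightarrow> (\<Sum>K\<in>\<D>. \<bar>g2 (Sup K) - g2 (Inf K)\<bar>) < e'"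
    using g2 e' unfolding abs_continuous_on_def by meson
  show "\<exists>\<delta>>0. \<forall>\<D> S. \<D> division_of S \<and> S \<subseteq> {a..b} \<and>
     (\<Sum>K\<in>\<D>. measure lborel K) < \<delta> \<longrightarrow> (\<Sum>K\<in>\<D>. \<bar>g (Sup K) - g (Inf K)\<bar>) < e"
  proof (intro exI[of _ "min d1 d2"] conjI allI impI)
    show "min d1 d2 > 0" using d1 d2 by simp
    fix \<D> S assume A: "\<D> division_of S \<and> S \<subseteq> {a..b} \<and> (\<Sum>K\<in>\<D>. measure lborel K) < min d1 d2"
    have "(\<Sum>K\<in>\<D>. \<bar>g (Sup K) - g (Inf K)\<bar>) \<le>
        (\<Sum>K\<in>\<D>. C' * (\<bar>g1 (Sup K) - g1 (Inf K)\<bar> + \<bar>g2 (Sup K) - g2 (Inf K)\<bar>))"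
    proof (rule sum_mono)
      fix K assume K: "K \<in> \<D>"
      then obtain u v where uv: "K = {u..v}" "a \<le> u" "u \<le> v" "v \<le> b"
        using A by (auto elim: division_of_subset_intervalE)
      then have "\<bar>g (Sup K) - g (Inf K)\<bar> \<le>
        C * (\<bar>g1 (Sup K) - g1 (Inf K)\<bar> + \<bar>g2 (Sup K) - g2 (Inf K)\<bar>)"
        using dom[of u v] uv by (simp add: cbox_interval)
      also have "\<dots> \<le> C' * (\<bar>g1 (Sup K) - g1 (Inf K)\<bar> + \<bar>g2 (Sup K) - g2 (Inf K)\<bar>)"
        using C' by (intro mult_right_mono) auto
      finally show "\<bar>g (Sup K) - g (Inf K)\<bar> \<le> \<dots>" .
    qed
    also have "\<dots> = C' * ((\<Sum>K\<in>\<D>. \<bar>g1 (Sup K) - g1 (Inf K)\<bar>) + (\<Sum>K\<in>\<D>. \<bar>g2 (Sup K) - g2 (Inf K)\<bar>))"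
      by (simp only: sum_distrib_left[symmetric] sum.distrib)
    also have "\<dots> < C' * (e' + e')"
      using d1(2)[of \<D> S] d2(2)[of \<D> S] A C' by (intro mult_strict_left_mono add_strict_mono) auto
    also have "\<dots> = e" using C' by (simp add: e'_def)
    finally show "(\<Sum>K\<in>\<D>. \<bar>g (Sup K) - g (Inf K)\<bar>) < e" .
  qed
qed

lemma abs_continuous_on_id: "abs_continuous_on J (\<lambda>t. t)"
  unfolding abs_continuous_on_def
proof (intro allI impI)
  fix e :: real assume "e > 0"
  show "\<exists>\<delta>>0. \<forall>\<D> S. \<D> division_of S \<and> S \<subseteq> J \<and>
     (\<Sum>K\<in>\<D>. measure lborel K) < \<delta> \<longrightarrow> (\<Sum>K\<in>\<D>. \<bar>Sup K - Inf K\<bar>) < e"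
  proof (intro exI[of _ e] conjI allI impI)
    fix \<D> S assume A: "\<D> division_of S \<and> S \<subseteq> J \<and> (\<Sum>K\<in>\<D>. measure lborel K) < e"
    have "(\<Sum>K\<in>\<D>. \<bar>Sup K - Inf K\<bar>) = (\<Sum>K\<in>\<D>. measure lborel K)"
    proof (rule sum.cong[OF refl])
      fix K assume K: "K \<in> \<D>"
      then obtain u v where "K = cbox u v" "K \<noteq> {}"
        using A division_ofD(3,4)[of \<D> S] by metis
      then show "\<bar>Sup K - Inf K\<bar> = measure lborel K" by auto
    qed
    then show "(\<Sum>K\<in>\<D>. \<bar>Sup K - Inf K\<bar>) < e" using A by simp
  qed fact
qed

lemma abs_continuous_on_lipschitz:
  assumes "\<And>u v. a \<le> u \<Longrightarrow> u \<le> v \<Longrightarrow> v \<le> b \<Longrightarrow> \<bar>g v - g u\<bar> \<le> C * (v - u)"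
  shows "abs_continuous_on {a..b} g"
proof (rule abs_continuous_on_dominated[OF abs_continuous_on_id abs_continuous_on_id, where C = C])
  fix u v assume *: "a \<le> u" "u \<le> v" "v \<le> b"
  have "C * (v - u) \<ge> 0" using assms[OF *] by linarith
  then show "\<bar>g v - g u\<bar> \<le> C * (\<bar>v - u\<bar> + \<bar>v - u\<bar>)"
    using assms[OF *] * by (simp add: algebra_simps)
qed

lemma abs_continuous_on_const: "abs_continuous_on {a..b} (\<lambda>t. c)"
  by (rule abs_continuous_on_lipschitz[where C = 0]) simp

lemma abs_continuous_on_add:
  assumes "abs_continuous_on {a..b} f" "abs_continuous_on {a..b} g"
  shows "abs_continuous_on {a..b} (\<lambda>t. f t + g t)"
  by (rule abs_continuous_on_dominated[OF assms, where C = 1]) simp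

lemma abs_continuous_on_sum:
  assumes "\<And>i. i \<in> I \<Longrightarrow> abs_continuous_on {a..b} (f i)"
  shows "abs_continuous_on {a..b} (\<lambda>t. \<Sum>i\<in>I. f i t)"
  using assms
  by (induction I rule: infinite_finite_induct)
     (simp_all add: abs_continuous_on_const abs_continuous_on_add)

lemma abs_continuous_on_imp_continuous:
  assumes "abs_continuous_on {a..b} g"
  shows "continuous_on {a..b} g"
  unfolding continuous_on_iff
proof (intro ballI allI impI)
  fix x e :: real assume x: "x \<in> {a..b}" and "e > 0"
  obtain d where d: "d > 0" "\<And>\<D> S. \<D> division_of S \<Longrightarrow> S \<subseteq> {a..b} \<Longrightarrow>
      (\<Sum>K\<in>\<D>. measure lborel K) < d \<Longrightarrow> (\<Sum>K\<in>\<D>. \<bar>g (Sup K) - g (Inf K)\<bar>) < e"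
    using assms \<open>e > 0\<close> unfolding abs_continuous_on_def by meson
  have *: "\<bar>g v - g u\<bar> < e" if "a \<le> u" "u \<le> v" "v \<le> b" "v - u < d" for u v
    using d(2)[of "{{u..v}}" "{u..v}"] that division_of_self[of u v] by (simp add: cbox_interval)
  show "\<exists>d>0. \<forall>x'\<in>{a..b}. dist x' x < d \<longrightarrow> dist (g x') (g x) < e"
  proof (intro exI[of _ d] conjI ballI impI)
    fix y assume "y \<in> {a..b}" "dist y x < d"
    then show "dist (g y) (g x) < e"
      using *[of x y] *[of y x] x by (cases "x \<le> y") (auto simp: dist_real_def abs_minus_commute)
  qed fact
qed

lemma abs_continuous_on_mult:
  assumes f: "abs_continuous_on {a..b} f" and g: "abs_continuous_on {a..b} g"
  shows "abs_continuous_on {a..b} (\<lambda>t. f t * g t)"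
proof -
  have "bounded (f ` {a..b})" "bounded (g ` {a..b})"
    using assms by (auto intro!: compact_imp_bounded compact_continuous_image
      abs_continuous_on_imp_continuous)
  then obtain A B where A: "\<And>t. t \<in> {a..b} \<Longrightarrow> \<bar>f t\<bar> \<le> A" and B: "\<And>t. t \<in> {a..b} \<Longrightarrow> \<bar>g t\<bar> \<le> B"
    unfolding bounded_iff by (metis image_eqI real_norm_def)
  show ?thesis
  proof (rule abs_continuous_on_dominated[OF f g, where C = "max A B"])
    fix u v assume *: "a \<le> u" "u \<le> v" "v \<le> b"
    have "\<bar>f v * g v - f u * g u\<bar> = \<bar>(f v - f u) * g v + f u * (g v - g u)\<bar>"
      by (simp add: algebra_simps)
    also have "\<dots> \<le> \<bar>f v - f u\<bar> * \<bar>g v\<bar> + \<bar>f u\<bar> * \<bar>g v - g u\<bar>"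
      by (metis abs_mult abs_triangle_ineq)
    also have "\<dots> \<le> \<bar>f v - f u\<bar> * max A B + max A B * \<bar>g v - g u\<bar>"
      using A[of u] B[of v] * by (intro add_mono mult_left_mono mult_right_mono) auto
    finally show "\<bar>f v * g v - f u * g u\<bar> \<le> max A B * (\<bar>f v - f u\<bar> + \<bar>g v - g u\<bar>)"
      by (simp add: algebra_simps)
  qed
qed

lemma abs_continuous_on_cmult:
  "abs_continuous_on {a..b} f \<Longrightarrow> abs_continuous_on {a..b} (\<lambda>t. c * f t)"
  by (rule abs_continuous_on_mult[OF abs_continuous_on_const])

lemma abs_continuous_on_continuous_derivative:
  assumes D: "\<And>t. t \<in> {a..b} \<Longrightarrow> (g has_real_derivative g' t) (at t within {a..b})"
    and c: "continuous_on {a..b} g'"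
  shows "abs_continuous_on {a..b} g"
proof -
  have "bounded (g' ` {a..b})"
    using c by (intro compact_imp_bounded compact_continuous_image) auto
  then obtain B where B: "\<And>t. t \<in> {a..b} \<Longrightarrow> \<bar>g' t\<bar> \<le> B" unfolding bounded_iff by (metis image_eqI real_norm_def)
  show ?thesis
  proof (rule abs_continuous_on_lipschitz[where C = B])
    fix u v assume *: "a \<le> u" "u \<le> v" "v \<le> b"
    have "norm (g v - g u) \<le> B * norm (v - u)"
      by (rule field_differentiable_bound[of "{a..b}" g g']) (use D B * in auto)
    then show "\<bar>g v - g u\<bar> \<le> B * (v - u)" using * by simp
  qed
qed

text \<open>
  Truncating \<open>f\<close> at a large height \<open>n\<close> leaves a remainder \<open>\<rho> n\<close> of small integral; the truncated
  part contributes at most \<open>n\<close> times the total length of the intervals.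
\<close>

lemma abs_continuous_on_indefinite_integral:
  fixes f :: "real \<Rightarrow> real"
  assumes f: "f absolutely_integrable_on {a..b}"
  shows "abs_continuous_on {a..b} (\<lambda>t. integral {a..t} f)"
  unfolding abs_continuous_on_def
proof (intro allI impI)
  fix e :: real assume "e > 0"
  define \<rho> where "\<rho> n x = \<bar>f x\<bar> - min \<bar>f x\<bar> (real n)" for n x
  have absf: "(\<lambda>x. \<bar>f x\<bar>) integrable_on {a..b}" and fi: "f integrable_on {a..b}"
    using f by (auto simp: absolutely_integrable_on_def)
  have absf': "(\<lambda>x. \<bar>f x\<bar>) absolutely_integrable_on {a..b}"
    using absolutely_integrable_norm[OF f] by (simp add: o_def)
  have "(\<lambda>x. min \<bar>f x\<bar> (real n)) absolutely_integrable_on {a..b}" for n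
    using absf' by (intro absolutely_integrable_min_1) auto
  then have \<rho>i: "\<rho> n integrable_on {a..b}" for n
    unfolding \<rho>_def using absf
    by (intro integrable_diff) (auto simp: absolutely_integrable_on_def)
  have "(\<lambda>n. integral {a..b} (\<rho> n)) \<longlonglongrightarrow> integral {a..b} (\<lambda>x. 0)"
  proof (rule dominated_convergence(2)[OF \<rho>i absf])
    fix n x show "norm (\<rho> n x) \<le> \<bar>f x\<bar>" by (auto simp: \<rho>_def)
  next
    fix x
    obtain N where "\<bar>f x\<bar> \<le> real N" using real_arch_simple by blast
    then have "eventually (\<lambda>n. \<rho> n x = 0) sequentially"
      by (intro eventually_sequentiallyI[of N]) (auto simp: \<rho>_def)
    then show "(\<lambda>n. \<rho> n x) \<longlonglongrightarrow> 0" by (rule tendsto_eventually)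
  qed
  then have "eventually (\<lambda>n. integral {a..b} (\<rho> n) < e / 2) sequentially"
    using order_tendstoD(2)[of _ 0 sequentially "e / 2"] \<open>e > 0\<close> by simp
  then obtain n where n: "integral {a..b} (\<rho> n) < e / 2" by (auto simp: eventually_sequentially)
  define \<delta> where "\<delta> = e / (2 * (real n + 1))"
  show "\<exists>\<delta>>0. \<forall>\<D> S. \<D> division_of S \<and> S \<subseteq> {a..b} \<and> (\<Sum>K\<in>\<D>. measure lborel K) < \<delta> \<longrightarrow>
      (\<Sum>K\<in>\<D>. \<bar>integral {a..Sup K} f - integral {a..Inf K} f\<bar>) < e"
  proof (intro exI[of _ \<delta>] conjI allI impI)
    show "\<delta> > 0" using \<open>e > 0\<close> by (simp add: \<delta>_def)
    fix \<D> S assume A: "\<D> division_of S \<and> S \<subseteq> {a..b} \<and> (\<Sum>K\<in>\<D>. measure lborel K) < \<delta>"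
    have iS: "\<rho> n integrable_on S"
      using A \<rho>i by (meson integrable_on_subdivision)
    have "(\<Sum>K\<in>\<D>. \<bar>integral {a..Sup K} f - integral {a..Inf K} f\<bar>) \<le>
       (\<Sum>K\<in>\<D>. real n * measure lborel K + integral K (\<rho> n))"
    proof (rule sum_mono)
      fix K assume K: "K \<in> \<D>"
      then obtain u v where uv: "K = {u..v}" and uv': "a \<le> u" "u \<le> v" "v \<le> b"
        using A by (auto elim: division_of_subset_intervalE)
      have sub: "{u..v} \<subseteq> {a..b}" using uv' by auto
      have "f integrable_on {a..v}" using fi uv' by (auto intro: integrable_subinterval_real)
      then have "integral {a..v} f - integral {a..u} f = integral {u..v} f"
        using Henstock_Kurzweil_Integration.integral_combine[of a u v f] uv' by simp
      moreover have "\<bar>integral {u..v} f\<bar> \<le> integral {u..v} (\<lambda>x. real n + \<rho> n x)"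
      proof (rule integral_norm_bound_integral[where 'a = real, simplified])
        show "f integrable_on {u..v}" using fi sub by (rule integrable_subinterval_real)
        show "(\<lambda>x. real n + \<rho> n x) integrable_on {u..v}"
          using integrable_subinterval_real[OF \<rho>i[of n] sub] by (intro integrable_add) auto
      qed (auto simp: \<rho>_def)
      moreover have "integral {u..v} (\<lambda>x. real n + \<rho> n x) = real n * (v - u) + integral {u..v} (\<rho> n)"
        using integrable_subinterval_real[OF \<rho>i[of n] sub] uv'
        by (subst Henstock_Kurzweil_Integration.integral_add) auto
      ultimately show "\<bar>integral {a..Sup K} f - integral {a..Inf K} f\<bar> \<le>
          real n * measure lborel K + integral K (\<rho> n)"
        using uv uv' by (simp add: cbox_interval)
    qed
    also have "\<dots> = real n * (\<Sum>K\<in>\<D>. measure lborel K) + (\<Sum>K\<in>\<D>. integral K (\<rho> n))"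
      by (simp add: sum.distrib sum_distrib_left)
    also have "(\<Sum>K\<in>\<D>. integral K (\<rho> n)) = integral S (\<rho> n)"
      by (rule integral_combine_division_topdown[OF iS, symmetric]) (use A in simp)
    also have "\<dots> \<le> integral {a..b} (\<rho> n)"
      using A iS \<rho>i by (intro integral_subset_le) (auto simp: \<rho>_def)
    also have "real n * (\<Sum>K\<in>\<D>. measure lborel K) \<le> real n * \<delta>"
      using A by (intro mult_left_mono) auto
    also have "real n * \<delta> \<le> e / 2"
      using \<open>e > 0\<close> by (simp add: \<delta>_def field_simps)
    finally show "(\<Sum>K\<in>\<D>. \<bar>integral {a..Sup K} f - integral {a..Inf K} f\<bar>) < e"
      using n by linarith
  qed
qed

lemma abs_continuous_on_cong:
  assumes "abs_continuous_on {a..b} f" "\<And>t. t \<in> {a..b} \<Longrightarrow> f t = g t"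
  shows "abs_continuous_on {a..b} g"
  by (rule abs_continuous_on_dominated[OF assms(1) assms(1), where C = 1]) (use assms(2) in force)

lemma abs_continuous_on_subset:
  assumes "abs_continuous_on J f" "K \<subseteq> J"
  shows "abs_continuous_on K f"
  using assms unfolding abs_continuous_on_def by (meson order_trans)

section \<open>Absolute continuity and almost everywhere derivatives\<close>

text \<open>
  The fundamental theorem of calculus for absolutely continuous functions, with the gauge integral;
  no integrability of the derivative is assumed. Let \<open>N\<close> be the null set where the derivative fails to
  exist. Intervals tagged outside \<open>N\<close> are controlled by differentiability at the tag. Intervals tagged
  in \<open>N\<close> are forced by the gauge into an open set of small measure, so that their increments are
  controlled by absolute continuity.
\<close>

lemma has_integral_derivative_abs_continuous:
  fixes g :: "real \<Rightarrow> real"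
  assumes ab: "a \<le> b" and ac: "abs_continuous_on {a..b} g"
    and D: "AE t in lebesgue. t \<in> {a..b} \<longrightarrow> (g has_real_derivative h t) (at t within {a..b})"
  shows "(h has_integral (g b - g a)) {a..b}"
proof -
  obtain N where N: "N \<in> null_sets lebesgue"
    and DN: "\<And>t. t \<in> {a..b} \<Longrightarrow> t \<notin> N \<Longrightarrow> (g has_real_derivative h t) (at t within {a..b})"
    using D by (auto elim!: AE_E3)
  define h' where "h' t = (if t \<in> N then 0 else h t)" for t
  have "(h' has_integral (g b - g a)) {a..b}"
    unfolding has_integral_real
  proof (intro allI impI)
    fix e :: real assume "e > 0"
    define e1 where "e1 = e / (2 * (b - a + 1))"
    have e1: "e1 > 0" "e1 * (b - a) \<le> e / 2"
      using \<open>e > 0\<close> ab by (auto simp: e1_def field_simps)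
    obtain \<delta> where \<delta>: "\<delta> > 0" "\<And>\<D> S. \<D> division_of S \<Longrightarrow> S \<subseteq> {a..b} \<Longrightarrow>
        (\<Sum>K\<in>\<D>. measure lborel K) < \<delta> \<Longrightarrow> (\<Sum>K\<in>\<D>. \<bar>g (Sup K) - g (Inf K)\<bar>) < e / 2"
      using ac \<open>e > 0\<close> unfolding abs_continuous_on_def by (meson half_gt_zero)
    obtain G where G: "open G" "N \<subseteq> G" "G - N \<in> lmeasurable" "emeasure lebesgue (G - N) < ennreal \<delta>"
      using sets_lebesgue_outer_open[of N \<delta>] N \<delta>(1) by auto
    have Gm: "G \<in> lmeasurable" "measure lebesgue G < \<delta>"
    proof -
      have Geq: "G = (G - N) \<union> N" using G(2) by auto
      show *: "G \<in> lmeasurable"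
        using fmeasurable.Un[OF G(3)] N Geq by (metis null_setsD1 null_setsD2 fmeasurableI infinity_ennreal_def ennreal_zero_less_top)
      have "emeasure lebesgue G = emeasure lebesgue (G - N)"
        using emeasure_Diff_null_set[OF N] G(1) by (simp add: borel_open)
      then show "measure lebesgue G < \<delta>"
        using G(4) * by (metis emeasure_eq_measure2 ennreal_less_iff measure_nonneg)
    qed
    have "\<exists>d>0. \<forall>y\<in>{a..b}. \<bar>y - x\<bar> < d \<longrightarrow> \<bar>g y - g x - h x * (y - x)\<bar> \<le> e1 * \<bar>y - x\<bar>"
      if "x \<in> {a..b}" "x \<notin> N" for x
      using DN[OF that] e1(1)
      unfolding has_field_derivative_def has_derivative_within_alt by (auto simp: real_norm_def)
    then obtain d where d: "\<And>x. x \<in> {a..b} \<Longrightarrow> x \<notin> N \<Longrightarrow> d x > 0"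
      "\<And>x y. x \<in> {a..b} \<Longrightarrow> x \<notin> N \<Longrightarrow> y \<in> {a..b} \<Longrightarrow> \<bar>y - x\<bar> < d x \<Longrightarrow>
        \<bar>g y - g x - h x * (y - x)\<bar> \<le> e1 * \<bar>y - x\<bar>"
      by metis
    \<comment> \<open>the gauge confines intervals tagged in \<open>N\<close> to the small open set \<open>G\<close>\<close>
    define \<gamma> where "\<gamma> x = (if x \<in> N then G else if x \<in> {a..b} then ball x (d x) else UNIV)" for x
    have "gauge \<gamma>" using G d by (auto simp: gauge_def \<gamma>_def)
    show "\<exists>\<gamma>. gauge \<gamma> \<and> (\<forall>\<D>. \<D> tagged_division_of {a..b} \<and> \<gamma> fine \<D> \<longrightarrow>
        norm ((\<Sum>(x, k)\<in>\<D>. measure lborel k *\<^sub>R h' x) - (g b - g a)) < e)"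
    proof (intro exI[of _ \<gamma>] conjI allI impI)
      fix \<D> assume A: "\<D> tagged_division_of {a..b} \<and> \<gamma> fine \<D>"
      have fin: "finite \<D>" using A by (meson tagged_division_ofD(1))
      have el: "\<exists>u v. K = {u..v} \<and> u \<le> x \<and> x \<le> v \<and> a \<le> u \<and> v \<le> b" if xK: "(x, K) \<in> \<D>" for x K
      proof -
        have td: "\<D> tagged_division_of {a..b}" using A by simp
        obtain u v where "K = cbox u v" using tagged_division_ofD(4)[OF td xK] by blast
        moreover have "x \<in> K" "K \<subseteq> {a..b}" using tagged_division_ofD(2,3)[OF td xK] by auto
        ultimately show ?thesis by (auto simp: cbox_interval)
      qed
      define D1 D2 where "D1 = {(x, K) \<in> \<D>. x \<notin> N}" and "D2 = {(x, K) \<in> \<D>. x \<in> N}"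
      define T where "T = (\<lambda>(x, K). measure lborel K * h' x - (g (Sup K) - g (Inf K)))"
      have "(\<Sum>(x, k)\<in>\<D>. measure lborel k *\<^sub>R h' x) - (g b - g a) = sum T \<D>"
        using additive_tagged_division_1[OF ab, of \<D> g] A
        by (simp add: T_def split_def sum_subtractf)
      moreover have "sum T \<D> = sum T D1 + sum T D2"
        using fin by (subst sum.union_disjoint[symmetric])
          (auto simp: D1_def D2_def intro!: sum.cong finite_subset[OF _ fin])
      moreover have "\<bar>sum T D1\<bar> \<le> e / 2"
      proof -
        have "\<bar>sum T D1\<bar> \<le> (\<Sum>(x, K)\<in>D1. e1 * measure lborel K)"
        proof (rule sum_norm_le[where 'a = real, simplified])
          fix p assume "p \<in> D1"
          then obtain x K where p: "p = (x, K)" "(x, K) \<in> \<D>" "x \<notin> N" by (auto simp: D1_def)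
          obtain u v where uv: "K = {u..v}" "u \<le> x" "x \<le> v" "a \<le> u" "v \<le> b" using el[OF p(2)] by blast
          have "K \<subseteq> \<gamma> x" using A p(2) by (auto simp: fine_def)
          moreover have "x \<in> {a..b}" using uv by auto
          ultimately have "{u..v} \<subseteq> ball x (d x)" using p uv by (auto simp: \<gamma>_def)
          moreover have "u \<in> {u..v}" "v \<in> {u..v}" using uv by auto
          ultimately have "u \<in> ball x (d x)" "v \<in> ball x (d x)" by blast+
          then have "\<bar>u - x\<bar> < d x" "\<bar>v - x\<bar> < d x" by (auto simp: dist_real_def)
          then have "\<bar>g v - g x - h x * (v - x)\<bar> \<le> e1 * (v - x)" "\<bar>g u - g x - h x * (u - x)\<bar> \<le> e1 * (x - u)"
            using d(2)[of x v] d(2)[of x u] p uv by auto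
          moreover have "T p = (g u - g x - h x * (u - x)) - (g v - g x - h x * (v - x))"
            using p uv by (simp add: T_def h'_def algebra_simps)
          ultimately have "\<bar>T p\<bar> \<le> e1 * (v - x) + e1 * (x - u)" by linarith
          then show "\<bar>T p\<bar> \<le> (case p of (x, K) \<Rightarrow> e1 * measure lborel K)"
            using p uv by (simp add: algebra_simps)
        qed
        also have "\<dots> \<le> (\<Sum>(x, K)\<in>\<D>. e1 * measure lborel K)"
          using fin e1 by (intro sum_mono2) (auto simp: D1_def)
        also have "\<dots> = e1 * (b - a)"
          using additive_content_tagged_division[of \<D> a b] A ab
          by (simp add: split_def sum_distrib_left[symmetric])
        finally show ?thesis using e1 by simp
      qed
      moreover have "\<bar>sum T D2\<bar> < e / 2"
      proof -
        have pd: "D2 tagged_partial_division_of {a..b}"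
          using A by (auto simp: D2_def tagged_division_of_def
            intro: tagged_partial_division_subset)
        have ne: "K \<noteq> {} \<and> K \<subseteq> {a..b} \<and> K \<subseteq> G" if "K \<in> snd ` D2" for K
        proof -
          obtain x where x: "(x, K) \<in> \<D>" "x \<in> N" using \<open>K \<in> snd ` D2\<close> by (auto simp: D2_def)
          then have "K \<subseteq> \<gamma> x" using A by (auto simp: fine_def)
          then show ?thesis using el[OF x(1)] x(2) by (auto simp: \<gamma>_def)
        qed
        define d where "d K = (if K = {} then 0 else \<bar>g (Sup K) - g (Inf K)\<bar>)" for K
        note td = tagged_partial_division_of_Union_self[OF pd]
        have "\<bar>sum T D2\<bar> \<le> (\<Sum>(x, K)\<in>D2. d K)"
        proof (rule sum_norm_le[where 'a = real, simplified])
          fix p assume "p \<in> D2"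
          then obtain x K where p: "p = (x, K)" "(x, K) \<in> \<D>" "x \<in> N" by (auto simp: D2_def)
          have "K \<noteq> {}" using ne[of K] \<open>p \<in> D2\<close> p(1) by force
          then show "\<bar>T p\<bar> \<le> (case p of (x, K) \<Rightarrow> d K)" using p by (simp add: T_def h'_def d_def)
        qed
        also have "\<dots> = sum d (snd ` D2)"
          by (rule sum.over_tagged_division_lemma[OF td]) (auto simp: d_def)
        also have "\<dots> = (\<Sum>K\<in>snd ` D2. \<bar>g (Sup K) - g (Inf K)\<bar>)"
          using ne by (intro sum.cong) (auto simp: d_def)
        also have "\<dots> < e / 2"
        proof (rule \<delta>(2)[OF division_of_tagged_division[OF td]])
          show sub: "\<Union> (snd ` D2) \<subseteq> {a..b}" using ne by blast
          have "(\<Sum>K\<in>snd ` D2. measure lborel K) = (\<Sum>K\<in>snd ` D2. measure lebesgue K)"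
          proof (rule sum.cong[OF refl])
            fix K assume "K \<in> snd ` D2"
            then have "K \<in> sets lborel"
              using division_ofD(4)[OF division_of_tagged_division[OF td], of K] by auto
            then show "measure lborel K = measure lebesgue K" by (rule measure_completion[symmetric])
          qed
          also have "\<dots> = measure lebesgue (\<Union> (snd ` D2))"
            by (rule content_division[OF division_of_tagged_division[OF td]])
          also have "\<dots> \<le> measure lebesgue G"
          proof (rule measure_mono_fmeasurable)
            show "\<Union> (snd ` D2) \<subseteq> G" using ne by blast
            show "\<Union> (snd ` D2) \<in> sets lebesgue"
              by (rule fmeasurableD[OF lmeasurable_division[OF division_of_tagged_division[OF td]]])
          qed fact
          finally show "(\<Sum>K\<in>snd ` D2. measure lborel K) < \<delta>" using Gm(2) by (rule le_less_trans)
        qed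
        finally show ?thesis .
      qed
      ultimately show "norm ((\<Sum>(x, k)\<in>\<D>. measure lborel k *\<^sub>R h' x) - (g b - g a)) < e"
        by (simp only: real_norm_def)
    qed fact
  qed
  moreover have "negligible N" using N by (simp only: negligible_iff_null_sets)
  moreover have "h x = h' x" if "x \<in> {a..b} - N" for x using that by (simp add: h'_def)
  ultimately show ?thesis by (intro has_integral_spike[of N "{a..b}" h h'])
qed

text \<open>
  The derivative is only required to be below \<open>k\<close>, which is the form in which differential
  inequalities are used.
\<close>

lemma abs_continuous_on_increment_le:
  fixes g k :: "real \<Rightarrow> real"
  assumes ab: "a \<le> b" and ac: "abs_continuous_on {a..b} g"
    and D: "AE t in lebesgue. t \<in> {a..b} \<longrightarrow> (\<exists>D\<le>k t. (g has_real_derivative D) (at t within {a..b}))"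
    and k: "(k has_integral I) {a..b}"
  shows "g b - g a \<le> I"
proof -
  define P where "P t D \<longleftrightarrow> D \<le> k t \<and> (g has_real_derivative D) (at t within {a..b})" for t D
  define h where "h t = (if \<exists>D. P t D then SOME D. P t D else k t)" for t
  have h: "(\<exists>D. P t D) \<Longrightarrow> P t (h t)" for t unfolding h_def by (auto intro: someI)
  have "AE t in lebesgue. t \<in> {a..b} \<longrightarrow> (g has_real_derivative h t) (at t within {a..b})"
    using D by eventually_elim (use h in \<open>auto simp: P_def\<close>)
  then have "(h has_integral (g b - g a)) {a..b}"
    by (rule has_integral_derivative_abs_continuous[OF ab ac])
  moreover have "h t \<le> k t" for t
    using h[of t] by (cases "\<exists>D. P t D") (auto simp: P_def h_def)
  ultimately show ?thesis using k by (auto intro: has_integral_le)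
qed

text \<open>
  Lebesgue's differentiation theorem on a half-line. The theorem \<open>integrable_ccontinuous_explicit\<close>
  provides the derivative from the right; its application to the reflected function provides the one
  from the left.
\<close>

lemma AE_has_derivative_indefinite_integral:
  fixes f :: "real \<Rightarrow> real"
  assumes f: "\<And>b. f integrable_on {a..b}"
  shows "AE t in lebesgue. t \<in> {a..} \<longrightarrow>
    ((\<lambda>t. integral {a..t} f) has_real_derivative f t) (at t within {a..})"
proof -
  define g where "g t = (if t \<in> {a..} then f t else 0)" for t
  have gi: "g integrable_on cbox c d" for c d
  proof -
    have "f integrable_on ({a..} \<inter> cbox c d)"
    proof -
      have "{a..} \<inter> cbox c d = {max a c..d}" by auto
      then show ?thesis using integrable_subinterval_real[OF f[of d]] by simp
    qed
    then show ?thesis unfolding g_def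
      by (subst integrable_restrict_Int) 
  qed
  have gi': "(\<lambda>t. g (- t)) integrable_on cbox c d" for c d
    using gi[of "- d" "- c"] integrable_reflect[of g "- c" "- d"] by simp
  obtain N1 where N1: "negligible N1" "\<And>x e. \<lbrakk>x \<notin> N1; 0 < e\<rbrakk> \<Longrightarrow> \<exists>d>0. \<forall>h. 0 < h \<and> h < d \<longrightarrow>
        norm (integral (cbox x (x + h *\<^sub>R One)) g /\<^sub>R h ^ DIM(real) - g x) < e"
    using integrable_ccontinuous_explicit[of g] gi by metis
  obtain N2 where N2: "negligible N2" "\<And>x e. \<lbrakk>x \<notin> N2; 0 < e\<rbrakk> \<Longrightarrow> \<exists>d>0. \<forall>h. 0 < h \<and> h < d \<longrightarrow>
        norm (integral (cbox x (x + h *\<^sub>R One)) (\<lambda>t. g (- t)) /\<^sub>R h ^ DIM(real) - g (- x)) < e"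
    using integrable_ccontinuous_explicit[of "\<lambda>t. g (- t)"] gi' by metis
  define N where "N = N1 \<union> uminus ` N2"
  have "negligible (uminus ` N2)"
    by (rule negligible_differentiable_image_negligible[OF _ N2(1)])
       (auto intro!: differentiable_on_minus differentiable_on_id[unfolded id_def])
  then have "negligible N"
    unfolding N_def using N1 by (intro negligible_Un)
  then have "AE t in lebesgue. t \<notin> N"
    by (simp add: negligible_iff_null_sets AE_not_in)
  moreover have "((\<lambda>t. integral {a..t} f) has_real_derivative f t) (at t within {a..})"
    if t: "t \<notin> N" "t \<in> {a..}" for t
  proof -
    have t': "t \<notin> N1" "- t \<notin> N2" using t by (auto simp: N_def image_iff)
    have "((\<lambda>y. (integral {a..y} f - integral {a..t} f) / (y - t)) \<longlongrightarrow> f t) (at t within {a..})"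
      unfolding Lim_within
    proof (intro allI impI)
      fix e :: real assume "e > 0"
      obtain d1 where d1: "d1 > 0" "\<And>h. 0 < h \<Longrightarrow> h < d1 \<Longrightarrow> \<bar>integral {t..t + h} g / h - g t\<bar> < e"
        using N1(2)[OF t'(1) \<open>e > 0\<close>] by (auto simp: divide_inverse mult.commute)
      obtain d2 where d2: "d2 > 0" "\<And>h. 0 < h \<Longrightarrow> h < d2 \<Longrightarrow>
          \<bar>integral {- t..- t + h} (\<lambda>t. g (- t)) / h - g t\<bar> < e"
        using N2(2)[OF t'(2) \<open>e > 0\<close>] by (auto simp: divide_inverse mult.commute)
      have fg: "integral {u..v} g = integral {u..v} f" if "a \<le> u" for u v
        using that by (intro integral_cong) (auto simp: g_def)
      have "dist ((integral {a..y} f - integral {a..t} f) / (y - t)) (f t) < e"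
        if y: "y \<in> {a..}" "0 < dist y t" "dist y t < min d1 d2" for y
      proof (cases "t < y")
        case True
        have "integral {a..y} f - integral {a..t} f = integral {t..y} f"
          using Henstock_Kurzweil_Integration.integral_combine[of a t y f] f t True by simp
        then show ?thesis
          using d1(2)[of "y - t"] y True t fg[of t y] by (simp add: dist_real_def g_def)
      next
        case False
        then have lt: "y < t" using y by (simp add: dist_real_def)
        have "integral {a..t} f - integral {a..y} f = integral {y..t} f"
          using Henstock_Kurzweil_Integration.integral_combine[of a y t f] f y lt by simp
        moreover have "integral {- t..- y} (\<lambda>t. g (- t)) = integral {y..t} g"
          using Henstock_Kurzweil_Integration.integral_reflect_real[of t y g] by simp
        moreover have "(integral {a..y} f - integral {a..t} f) / (y - t) =
            (integral {a..t} f - integral {a..y} f) / (t - y)"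
          using lt by (simp add: field_simps)
        ultimately show ?thesis
          using d2(2)[of "t - y"] y lt t fg[of y t] by (simp add: dist_real_def g_def)
      qed
      then show "\<exists>d>0. \<forall>x\<in>{a..}. 0 < dist x t \<and> dist x t < d \<longrightarrow>
          dist ((integral {a..x} f - integral {a..t} f) / (x - t)) (f t) < e"
        using d1(1) d2(1) by (intro exI[of _ "min d1 d2"]) auto
    qed
    then show ?thesis by (simp add: has_field_derivative_iff)
  qed
  ultimately show ?thesis by (simp add: eventually_mono)
qed

lemma AE_eq_imp_eq_on_halfline:
  fixes f g :: "real \<Rightarrow> real"
  assumes f: "\<And>b. continuous_on {a..b} f" and g: "\<And>b. continuous_on {a..b} g"
    and eq: "AE t in lebesgue. t \<in> {a..} \<longrightarrow> f t = g t" and t: "t \<ge> a"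
  shows "f t = g t"
proof (rule ccontr)
  assume ne: "f t \<noteq> g t"
  have "continuous_on {a..t + 1} (\<lambda>s. f s - g s)" by (intro continuous_on_diff f g)
  then obtain d where d: "d > 0" "\<And>s. s \<in> {a..t + 1} \<Longrightarrow> dist s t < d \<Longrightarrow>
      dist (f s - g s) (f t - g t) < \<bar>f t - g t\<bar>"
    using t ne unfolding continuous_on_iff by (metis atLeastAtMost_iff eq_iff_diff_eq_0 le_add_same_cancel1 zero_le_one zero_less_abs_iff)
  obtain N where N: "N \<in> null_sets lebesgue" "\<And>s. s \<ge> a \<Longrightarrow> s \<notin> N \<Longrightarrow> f s = g s"
    using eq by (auto elim!: AE_E3)
  define d' where "d' = min d 1"
  have "{t..<t + d'} \<subseteq> N"
  proof
    fix s assume s: "s \<in> {t..<t + d'}"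
    then have "dist (f s - g s) (f t - g t) < \<bar>f t - g t\<bar>"
      using t by (intro d) (auto simp: d'_def dist_real_def)
    then have "f s \<noteq> g s" by (auto simp: dist_real_def)
    then show "s \<in> N" using N(2)[of s] s t by auto
  qed
  then have "{t..<t + d'} \<in> null_sets lebesgue"
    using completion.complete2[of "{t..<t + d'}" N lborel] N(1) by simp
  then have "emeasure lborel {t..<t + d'} = 0" by (simp add: null_sets_def)
  moreover have "d' > 0" using d(1) by (simp add: d'_def)
  ultimately show False by simp
qed

section \<open>Positive definite matrices and left inverses\<close>

lemma scalar_prod_transpose:
  fixes A :: "real mat"
  assumes "A \<in> carrier_mat n m" "x \<in> carrier_vec n" "y \<in> carrier_vec m"
  shows "x \<bullet> (A *\<^sub>v y) = (transpose_mat A *\<^sub>v x) \<bullet> y" "(A *\<^sub>v y) \<bullet> x = y \<bullet> (transpose_mat A *\<^sub>v x)"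
  using transpose_vec_mult_scalar[OF assms(1,3,2)] assms comm_scalar_prod[of "A *\<^sub>v y" n x]
    comm_scalar_prod[of y m "transpose_mat A *\<^sub>v x"] by auto

lemma scalar_prod_eq_sum: "x \<in> carrier_vec n \<Longrightarrow> y \<in> carrier_vec n \<Longrightarrow> x \<bullet> y = (\<Sum>i<n. x $ i * (y $ i :: real))"
  by (simp add: scalar_prod_def lessThan_atLeast0)

lemma scalar_prod_self_nonneg: "x \<bullet> (x :: real vec) \<ge> 0"
  by (simp add: scalar_prod_def sum_nonneg)

lemma scalar_prod_self_eq_0:
  assumes "x \<in> carrier_vec n" "x \<bullet> (x :: real vec) = 0"
  shows "x = 0\<^sub>v n"
proof (rule eq_vecI)
  have "\<forall>i\<in>{..<n}. x $ i * x $ i = 0"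
    using assms by (subst sum_nonneg_eq_0_iff[symmetric]) (auto simp: scalar_prod_eq_sum)
  then show "\<And>i. i < dim_vec (0\<^sub>v n) \<Longrightarrow> x $ i = 0\<^sub>v n $ i" by auto
qed (use assms in auto)

lemma entry_square_le_scalar_prod_self:
  assumes "x \<in> carrier_vec n" "i < n"
  shows "(x $ i)\<^sup>2 \<le> x \<bullet> (x :: real vec)"
  using assms member_le_sum[of i "{..<n}" "\<lambda>i. x $ i * x $ i"]
  by (simp add: scalar_prod_eq_sum power2_eq_square)

text \<open>
  The constant is one more than the sum of the absolute values of the entries, which makes it positive
  also in dimension zero.
\<close>

lemma quadratic_form_bound:
  fixes M :: "real mat"
  assumes M: "M \<in> carrier_mat n n"
  shows "\<exists>C>0. \<forall>x\<in>carrier_vec n. \<bar>x \<bullet> (M *\<^sub>v x)\<bar> \<le> C * (x \<bullet> x)"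
proof (intro exI conjI ballI)
  let ?C = "1 + (\<Sum>i<n. \<Sum>j<n. \<bar>M $$ (i, j)\<bar>)"
  show "?C > 0" by (smt (verit) abs_ge_zero sum_nonneg)
  fix x :: "real vec" assume x: "x \<in> carrier_vec n"
  have "\<bar>x \<bullet> (M *\<^sub>v x)\<bar> = \<bar>\<Sum>i<n. \<Sum>j<n. x $ i * (M $$ (i, j) * x $ j)\<bar>"
    using M x by (simp add: scalar_prod_def lessThan_atLeast0 sum_distrib_left)
  also have "\<dots> \<le> (\<Sum>i<n. \<Sum>j<n. \<bar>x $ i * (M $$ (i, j) * x $ j)\<bar>)"
    by (intro order_trans[OF sum_abs] sum_mono sum_abs)
  also have "\<dots> \<le> (\<Sum>i<n. \<Sum>j<n. \<bar>M $$ (i, j)\<bar> * (x \<bullet> x))"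
  proof (intro sum_mono)
    fix i j assume "i \<in> {..<n}" "j \<in> {..<n}"
    then have "(x $ i)\<^sup>2 \<le> x \<bullet> x" "(x $ j)\<^sup>2 \<le> x \<bullet> x"
      using x by (auto intro: entry_square_le_scalar_prod_self)
    moreover have "2 * (\<bar>x $ i\<bar> * \<bar>x $ j\<bar>) \<le> (x $ i)\<^sup>2 + (x $ j)\<^sup>2"
      using zero_le_power2[of "\<bar>x $ i\<bar> - \<bar>x $ j\<bar>"] by (simp add: power2_diff)
    ultimately have "\<bar>x $ i\<bar> * \<bar>x $ j\<bar> \<le> x \<bullet> x" by linarith
    then have "\<bar>M $$ (i, j)\<bar> * (\<bar>x $ i\<bar> * \<bar>x $ j\<bar>) \<le> \<bar>M $$ (i, j)\<bar> * (x \<bullet> x)"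
      by (intro mult_left_mono) auto
    then show "\<bar>x $ i * (M $$ (i, j) * x $ j)\<bar> \<le> \<bar>M $$ (i, j)\<bar> * (x \<bullet> x)"
      by (simp add: abs_mult ac_simps)
  qed
  also have "\<dots> = (\<Sum>i<n. \<Sum>j<n. \<bar>M $$ (i, j)\<bar>) * (x \<bullet> x)"
    by (simp add: sum_distrib_right)
  also have "\<dots> \<le> ?C * (x \<bullet> x)"
    using scalar_prod_self_nonneg[of x] by (intro mult_right_mono) auto
  finally show "\<bar>x \<bullet> (M *\<^sub>v x)\<bar> \<le> ?C * (x \<bullet> x)" .
qed

lemma mat_inv_of_injective:
  fixes M :: "real mat"
  assumes M: "M \<in> carrier_mat n n"
    and inj: "\<And>v. v \<in> carrier_vec n \<Longrightarrow> M *\<^sub>v v = 0\<^sub>v n \<Longrightarrow> v = 0\<^sub>v n"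
  shows "mat_inv M \<in> carrier_mat n n" "M * mat_inv M = 1\<^sub>m n" "mat_inv M * M = 1\<^sub>m n"
proof -
  have "det M \<noteq> 0" using inj det_0_iff_vec_prod_zero_field[OF M] by blast
  then have "M \<in> Units (ring_mat TYPE(real) n ())" by (rule det_non_zero_imp_unit[OF M])
  then obtain B where B: "mat_inverse M = Some B"
    using mat_inverse(1)[OF M, where b = "()"] by (cases "mat_inverse M") auto
  then show "mat_inv M \<in> carrier_mat n n" "M * mat_inv M = 1\<^sub>m n" "mat_inv M * M = 1\<^sub>m n"
    using mat_inverse(2)[OF M B] by (auto simp: mat_inv_def)
qed

lemma pos_def_mat_inv:
  assumes pd: "pos_def_mat n M"
  shows "mat_inv M \<in> carrier_mat n n" "M * mat_inv M = 1\<^sub>m n" "mat_inv M * M = 1\<^sub>m n"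
    and "pos_def_mat n (mat_inv M)"
proof -
  have M: "M \<in> carrier_mat n n" and sym: "transpose_mat M = M"
    and pos: "\<And>v. v \<in> carrier_vec n \<Longrightarrow> v \<noteq> 0\<^sub>v n \<Longrightarrow> v \<bullet> (M *\<^sub>v v) > 0"
    using pd by (auto simp: pos_def_mat_def)
  have inj: "v = 0\<^sub>v n" if "v \<in> carrier_vec n" "M *\<^sub>v v = 0\<^sub>v n" for v
    using pos[OF that(1)] that by fastforce
  note I = mat_inv_of_injective[OF M inj]
  show I1: "mat_inv M \<in> carrier_mat n n" and I2: "M * mat_inv M = 1\<^sub>m n" and I3: "mat_inv M * M = 1\<^sub>m n"
    using I by simp_all
  have "transpose_mat (mat_inv M) = transpose_mat (mat_inv M) * (M * mat_inv M)"
    using I1 I2 by simp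
  also have "\<dots> = (transpose_mat (mat_inv M) * transpose_mat M) * mat_inv M"
    using I1 M sym by (simp add: assoc_mult_mat[of _ n n _ n _ n])
  also have "transpose_mat (mat_inv M) * transpose_mat M = 1\<^sub>m n"
    using transpose_mult[OF M I1] I2 by simp
  finally have "transpose_mat (mat_inv M) = mat_inv M" using I1 by simp
  moreover have "v \<bullet> (mat_inv M *\<^sub>v v) > 0" if v: "v \<in> carrier_vec n" "v \<noteq> 0\<^sub>v n" for v
  proof -
    define w where "w = mat_inv M *\<^sub>v v"
    have w: "w \<in> carrier_vec n" "M *\<^sub>v w = v"
      using v I1 M I2 by (auto simp: w_def assoc_mult_mat_vec[of _ n n _ n, symmetric])
    then have "w \<noteq> 0\<^sub>v n" using v M by auto
    then have "w \<bullet> v > 0" using pos[OF w(1)] w by simp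
    then show ?thesis using comm_scalar_prod[OF w(1) v(1)] by (simp add: w_def)
  qed
  ultimately show "pos_def_mat n (mat_inv M)" using I1 by (auto simp: pos_def_mat_def)
qed

lemma pos_def_mat_nonneg:
  assumes "pos_def_mat n M" "x \<in> carrier_vec n"
  shows "x \<bullet> (M *\<^sub>v x) \<ge> 0"
proof (cases "x = 0\<^sub>v n")
  case True
  then show ?thesis using assms by (auto simp: pos_def_mat_def)
next
  case False
  then show ?thesis using assms by (auto simp: pos_def_mat_def less_imp_le)
qed

lemma pos_def_mat_cauchy_schwarz:
  assumes pd: "pos_def_mat n M" and x: "x \<in> carrier_vec n" and y: "y \<in> carrier_vec n"
  shows "(x \<bullet> (M *\<^sub>v y))\<^sup>2 \<le> (x \<bullet> (M *\<^sub>v x)) * (y \<bullet> (M *\<^sub>v y))"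
proof -
  have M: "M \<in> carrier_mat n n" and sym: "transpose_mat M = M"
    using pd by (auto simp: pos_def_mat_def)
  define a b c where "a = x \<bullet> (M *\<^sub>v x)" and "b = x \<bullet> (M *\<^sub>v y)" and "c = y \<bullet> (M *\<^sub>v y)"
  have b': "y \<bullet> (M *\<^sub>v x) = b"
    using scalar_prod_transpose(1)[OF M y x] comm_scalar_prod[of "M *\<^sub>v y" n x] M x y sym
    by (simp add: b_def)
  show ?thesis
  proof (cases "y = 0\<^sub>v n")
    case True
    then have "M *\<^sub>v y = 0\<^sub>v n" using M by auto
    then show ?thesis using True M x by simp
  next
    case False
    then have c: "c > 0" using pd y by (auto simp: pos_def_mat_def c_def)
    \<comment> \<open>up to the factor \<open>c\<close>, the component of \<open>x\<close> orthogonal to \<open>y\<close> with respect to \<open>M\<close>\<close>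
    define z where "z = c \<cdot>\<^sub>v x - b \<cdot>\<^sub>v y"
    have z: "z \<in> carrier_vec n" using x y by (simp add: z_def)
    have Mz: "M *\<^sub>v z = c \<cdot>\<^sub>v (M *\<^sub>v x) - b \<cdot>\<^sub>v (M *\<^sub>v y)"
      using M x y by (simp add: z_def mult_minus_distrib_mat_vec[of _ n n] mult_mat_vec[of _ n n])
    have "0 \<le> z \<bullet> (M *\<^sub>v z)" by (rule pos_def_mat_nonneg[OF pd z])
    also have "\<dots> = c * (c * a - b * b)"
    proof -
      have e1: "x \<bullet> (M *\<^sub>v z) = c * a - b * b"
        unfolding Mz using M x y
        by (subst scalar_prod_minus_distrib[of _ n]) (auto simp: a_def b_def)
      have e2: "y \<bullet> (M *\<^sub>v z) = c * b - b * c"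
        unfolding Mz using M x y b'
        by (subst scalar_prod_minus_distrib[of _ n]) (auto simp: c_def)
      have e3: "z \<bullet> (M *\<^sub>v z) = c * (x \<bullet> (M *\<^sub>v z)) - b * (y \<bullet> (M *\<^sub>v z))"
      proof -
        have "z \<bullet> u = c * (x \<bullet> u) - b * (y \<bullet> u)" if "u \<in> carrier_vec n" for u
          unfolding z_def using x y that
          by (subst minus_scalar_prod_distrib[of _ n]) auto
        then show ?thesis using M z by (metis mult_mat_vec_carrier)
      qed
      show ?thesis unfolding e3 e1 e2 by (simp add: algebra_simps)
    qed
    finally have "0 \<le> c * a - b * b" using c by (simp add: zero_le_mult_iff)
    then show ?thesis by (simp add: a_def b_def c_def power2_eq_square mult.commute)
  qed
qed

text \<open>
  Instead of minimizing over the unit sphere, the Cauchy-Schwarz inequality for the form \<open>M\<close> is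
  applied to \<open>x\<close> and \<open>M\<^sup>-\<^sup>1 x\<close>: \<open>(x \<bullet> x)\<^sup>2 \<le> (x \<bullet> M x) (x \<bullet> M\<^sup>-\<^sup>1 x)\<close>, and the last factor is bounded
  by a multiple of \<open>x \<bullet> x\<close>.
\<close>

lemma pos_def_mat_coercive:
  assumes pd: "pos_def_mat n M"
  shows "\<exists>c>0. \<forall>x\<in>carrier_vec n. c * (x \<bullet> x) \<le> x \<bullet> (M *\<^sub>v x)"
proof -
  have M: "M \<in> carrier_mat n n" using pd by (auto simp: pos_def_mat_def)
  note I = pos_def_mat_inv[OF pd]
  obtain C where C: "C > 0" "\<And>x. x \<in> carrier_vec n \<Longrightarrow> \<bar>x \<bullet> (mat_inv M *\<^sub>v x)\<bar> \<le> C * (x \<bullet> x)"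
    using quadratic_form_bound[OF I(1)] by auto
  have "(1 / C) * (x \<bullet> x) \<le> x \<bullet> (M *\<^sub>v x)" if x: "x \<in> carrier_vec n" for x
  proof (cases "x \<bullet> x = 0")
    case True
    then show ?thesis using pos_def_mat_nonneg[OF pd x] by simp
  next
    case False
    then have pos: "x \<bullet> x > 0" using scalar_prod_self_nonneg[of x] by simp
    define y where "y = mat_inv M *\<^sub>v x"
    have y: "y \<in> carrier_vec n" "M *\<^sub>v y = x"
      using x I M by (auto simp: y_def assoc_mult_mat_vec[of _ n n _ n, symmetric])
    have "(x \<bullet> x)\<^sup>2 \<le> (x \<bullet> (M *\<^sub>v x)) * (y \<bullet> x)"
      using pos_def_mat_cauchy_schwarz[OF pd x y(1)] y by simp
    also have "\<dots> \<le> (x \<bullet> (M *\<^sub>v x)) * (C * (x \<bullet> x))"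
      using C(2)[OF x] comm_scalar_prod[OF y(1) x] pos_def_mat_nonneg[OF pd x]
      by (intro mult_left_mono) (auto simp: y_def)
    finally have "x \<bullet> x \<le> (x \<bullet> (M *\<^sub>v x)) * C" using pos by (simp add: power2_eq_square)
    then show ?thesis using C(1) by (simp add: field_simps)
  qed
  then show ?thesis using C(1) by (intro exI[of _ "1 / C"]) auto
qed

lemma full_column_rank_injective:
  fixes A :: "real mat"
  assumes A: "A \<in> carrier_mat n k" and rk: "vec_space.rank n A = k"
    and v: "v \<in> carrier_vec k" and Av: "A *\<^sub>v v = 0\<^sub>v n"
  shows "v = 0\<^sub>v k"
proof (rule ccontr)
  interpret vec_space "TYPE(real)" n .
  assume ne: "v \<noteq> 0\<^sub>v k"
  have dist: "distinct (cols A)"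
  proof (rule ccontr)
    assume nd: "\<not> distinct (cols A)"
    obtain S where S: "maximal S (\<lambda>T. T \<subseteq> set (cols A) \<and> lin_indpt T)"
      using maximal_exists[of "(\<lambda>T. T \<subseteq> set (cols A) \<and> lin_indpt T)" "card (set (cols A))" "{}"]
      by (meson List.finite_set card_mono empty_iff empty_subsetI finite_lin_indpt2 rev_finite_subset)
    then have "card S \<le> card (set (cols A))" by (simp add: card_mono maximal_def)
    also have "\<dots> < k"
      using nd A card_distinct[of "cols A"] card_length[of "cols A"] by fastforce
    finally show False using rank_card_indpt[OF A S] rk by simp
  qed
  have "lin_dep (set (cols A))" by (rule lin_depI[OF A v ne Av dist])
  then show False using full_rank_lin_indpt[OF A rk dist] by simp
qed

lemma pos_def_gram_mat:
  fixes A :: "real mat"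
  assumes A: "A \<in> carrier_mat n k" and S: "pos_def_mat n S"
    and inj: "\<And>v. v \<in> carrier_vec k \<Longrightarrow> A *\<^sub>v v = 0\<^sub>v n \<Longrightarrow> v = 0\<^sub>v k"
  shows "pos_def_mat k (transpose_mat A * S * A)"
proof -
  have Sc: "S \<in> carrier_mat n n" and sym: "transpose_mat S = S" using S by (auto simp: pos_def_mat_def)
  have form: "v \<bullet> ((transpose_mat A * S * A) *\<^sub>v v) = (A *\<^sub>v v) \<bullet> (S *\<^sub>v (A *\<^sub>v v))"
    if v: "v \<in> carrier_vec k" for v
  proof -
    have "(transpose_mat A * S * A) *\<^sub>v v = transpose_mat A *\<^sub>v (S *\<^sub>v (A *\<^sub>v v))"
      using A Sc v by (simp add: assoc_mult_mat_vec[of _ k n _ n] assoc_mult_mat_vec[of _ k n _ k])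
    then show ?thesis
      using scalar_prod_transpose(1)[of "transpose_mat A" k n v "S *\<^sub>v (A *\<^sub>v v)"] A Sc v by simp
  qed
  have "transpose_mat (transpose_mat A * S * A) = transpose_mat A * S * A"
    using A Sc sym transpose_mult[of "transpose_mat A * S" k n A k] transpose_mult[of "transpose_mat A" k n S n]
    by (simp add: assoc_mult_mat[of _ k n _ n _ k])
  moreover have "v \<bullet> ((transpose_mat A * S * A) *\<^sub>v v) > 0" if v: "v \<in> carrier_vec k" "v \<noteq> 0\<^sub>v k" for v
  proof -
    have "A *\<^sub>v v \<in> carrier_vec n" "A *\<^sub>v v \<noteq> 0\<^sub>v n" using A inj[OF v(1)] v by auto
    then show ?thesis using S unfolding form[OF v(1)] pos_def_mat_def by blast
  qed
  ultimately show ?thesis using A Sc by (auto simp: pos_def_mat_def)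
qed

lemma pos_def_one_mat: "pos_def_mat n (1\<^sub>m n)"
  using scalar_prod_self_nonneg scalar_prod_self_eq_0 by (fastforce simp: pos_def_mat_def less_le)

text \<open>
  The matrix \<open>(M\<^sup>T M)\<^sup>-\<^sup>1 M\<^sup>T\<close> satisfies the Penrose equations, and they have only one solution.
\<close>

lemma pseudoinverse_left_inverse:
  fixes M :: "real mat"
  assumes M: "M \<in> carrier_mat n k"
    and inj: "\<And>v. v \<in> carrier_vec k \<Longrightarrow> M *\<^sub>v v = 0\<^sub>v n \<Longrightarrow> v = 0\<^sub>v k"
  shows "pseudoinverse M \<in> carrier_mat k n" "pseudoinverse M * M = 1\<^sub>m k"
proof -
  let ?P = "\<lambda>X. X \<in> carrier_mat (dim_col M) (dim_row M) \<and>
     M * X * M = M \<and> X * M * X = X \<and>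
     transpose_mat (M * X) = M * X \<and> transpose_mat (X * M) = X * M"
  define G where "G = transpose_mat M * M"
  have G: "pos_def_mat k G"
    using pos_def_gram_mat[OF M pos_def_one_mat inj] M by (simp add: G_def)
  note GI = pos_def_mat_inv[OF G]
  have Gc: "G \<in> carrier_mat k k" using M by (simp add: G_def)
  have Gs: "transpose_mat (mat_inv G) = mat_inv G" using GI(4) by (simp add: pos_def_mat_def)
  define X where "X = mat_inv G * transpose_mat M"
  have X: "X \<in> carrier_mat k n" using M GI by (simp add: X_def)
  have XM: "X * M = 1\<^sub>m k"
    using M GI by (simp add: X_def G_def assoc_mult_mat[of _ k k _ n _ k])
  have PX: "?P X"
  proof (intro conjI)
    show "X \<in> carrier_mat (dim_col M) (dim_row M)" using X M by auto
    show "M * X * M = M" using M X XM by (simp add: assoc_mult_mat[of _ n k _ n _ k])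
    show "X * M * X = X" using X XM by simp
    show "transpose_mat (X * M) = X * M" using XM by simp
    have "transpose_mat (M * X) = transpose_mat X * transpose_mat M" by (rule transpose_mult[OF M X])
    also have "transpose_mat X = M * mat_inv G"
      using transpose_mult[OF GI(1), of "transpose_mat M" n] M Gs by (simp add: X_def)
    also have "M * mat_inv G * transpose_mat M = M * X"
      using M GI(1) by (simp add: X_def assoc_mult_mat[of _ n k _ k _ n])
    finally show "transpose_mat (M * X) = M * X" .
  qed
  have left: "Z = XX" if Z: "M * Z = M * XX" "Z \<in> carrier_mat k n" "XX \<in> carrier_mat k n" for Z XX
  proof -
    have "X * (M * Z) = X * (M * XX)" using Z by simp
    then have "(X * M) * Z = (X * M) * XX"
      using X M Z by (simp add: assoc_mult_mat[of _ k n _ k _ n])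
    then show ?thesis using XM Z by simp
  qed
  have uniq: "Z = X" if Z: "?P Z" for Z
  proof -
    have Zc: "Z \<in> carrier_mat k n" using Z M by auto
    have MZ: "M * Z \<in> carrier_mat n n" and MX: "M * X \<in> carrier_mat n n" using M X Zc by auto
    have "M * Z = (M * X * M) * Z" using PX by simp
    also have "\<dots> = (M * X) * (M * Z)" using MX M Zc by (rule assoc_mult_mat)
    also have "\<dots> = transpose_mat (M * X) * transpose_mat (M * Z)" using PX Z by simp
    also have "\<dots> = transpose_mat ((M * Z) * (M * X))" using transpose_mult[OF MZ MX] by simp
    also have "(M * Z) * (M * X) = (M * Z * M) * X"
      using MZ M X by (rule assoc_mult_mat[symmetric])
    also have "transpose_mat ((M * Z * M) * X) = M * X" using Z PX by simp
    finally show ?thesis using left Zc X by blast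
  qed
  have "pseudoinverse M = X"
    unfolding pseudoinverse_def using PX uniq by (rule the_equality)
  then show "pseudoinverse M \<in> carrier_mat k n" "pseudoinverse M * M = 1\<^sub>m k"
    using X XM by auto
qed

section \<open>The Riccati equation and stabilizable associated systems\<close>

lemma zero_mat_mult_vec: "w \<in> carrier_vec c \<Longrightarrow> 0\<^sub>m r c *\<^sub>v w = (0\<^sub>v r :: real vec)"
  by (intro eq_vecI) auto

lemma mat_mult_zero_vec: "A \<in> carrier_mat r c \<Longrightarrow> A *\<^sub>v 0\<^sub>v c = (0\<^sub>v r :: real vec)"
  by (intro eq_vecI) auto

lemma pos_def_weight_mat:
  assumes Q: "pos_def_mat m Q" and R: "pos_def_mat p R"
  shows "pos_def_mat (m + p) (weight_mat Q R)"
proof -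
  note q = pos_def_mat_inv[OF Q] and r = pos_def_mat_inv[OF R]
  have dims: "dim_row Q = m" "dim_col Q = m" "dim_row R = p" "dim_col R = p"
    using Q R by (auto simp: pos_def_mat_def)
  define Qi Ri where "Qi = mat_inv Q" and "Ri = mat_inv R"
  have W: "weight_mat Q R = four_block_mat Qi (0\<^sub>m m p) (0\<^sub>m p m) Ri"
    by (simp add: weight_mat_def dims Qi_def Ri_def)
  have c: "Qi \<in> carrier_mat m m" "Ri \<in> carrier_mat p p"
    and s: "transpose_mat Qi = Qi" "transpose_mat Ri = Ri"
    using q r by (auto simp: Qi_def Ri_def pos_def_mat_def)
  have "transpose_mat (weight_mat Q R) = weight_mat Q R"
    unfolding W using transpose_four_block_mat[OF c(1) _ _ c(2), of "0\<^sub>m m p" "0\<^sub>m p m"] s by simp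
  moreover have "v \<bullet> (weight_mat Q R *\<^sub>v v) > 0"
    if v: "v \<in> carrier_vec (m + p)" and ne: "v \<noteq> 0\<^sub>v (m + p)" for v
  proof -
    define a b where "a = vec_first v m" and "b = vec_last v p"
    have ab: "a \<in> carrier_vec m" "b \<in> carrier_vec p" "v = a @\<^sub>v b"
      using v by (auto simp: a_def b_def)
    have eq: "v \<bullet> (weight_mat Q R *\<^sub>v v) = a \<bullet> (Qi *\<^sub>v a) + b \<bullet> (Ri *\<^sub>v b)"
      unfolding W ab(3) mult_mat_vec_split[OF c ab(1,2)]
      by (rule scalar_prod_append) (use ab c in auto)
    have "a \<noteq> 0\<^sub>v m \<or> b \<noteq> 0\<^sub>v p"
    proof (rule ccontr)
      assume "\<not> ?thesis"
      then have "v = 0\<^sub>v (m + p)" unfolding ab(3) by (intro eq_vecI) auto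
      then show False using ne by simp
    qed
    then have "a \<bullet> (Qi *\<^sub>v a) > 0 \<or> b \<bullet> (Ri *\<^sub>v b) > 0"
      using q(4) r(4) ab by (auto simp: pos_def_mat_def Qi_def Ri_def)
    moreover have "a \<bullet> (Qi *\<^sub>v a) \<ge> 0" "b \<bullet> (Ri *\<^sub>v b) \<ge> 0"
      using pos_def_mat_nonneg[OF q(4)] pos_def_mat_nonneg[OF r(4)] ab by (auto simp: Qi_def Ri_def)
    ultimately show ?thesis unfolding eq by linarith
  qed
  ultimately show ?thesis using c by (auto simp: pos_def_mat_def W)
qed

lemma top_rows_carrier: "C \<in> carrier_mat r c \<Longrightarrow> top_rows m C \<in> carrier_mat m c"
  by (auto simp: top_rows_def)

lemma bottom_rows_carrier: "C \<in> carrier_mat r c \<Longrightarrow> bottom_rows p C \<in> carrier_mat p c"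
  by (auto simp: bottom_rows_def)

lemma top_rows_mult_vec:
  assumes "C \<in> carrier_mat (m + p) c" "v \<in> carrier_vec c"
  shows "top_rows m C *\<^sub>v v = vec_first (C *\<^sub>v v) m"
  using assms by (intro eq_vecI) (auto simp: top_rows_def vec_first_def scalar_prod_def)

lemma bottom_rows_mult_vec:
  assumes "C \<in> carrier_mat (m + p) c" "v \<in> carrier_vec c"
  shows "bottom_rows p C *\<^sub>v v = vec_last (C *\<^sub>v v) p"
  using assms by (intro eq_vecI) (auto simp: bottom_rows_def vec_last_def scalar_prod_def)

lemma vec_first_append: "a \<in> carrier_vec m \<Longrightarrow> vec_first (a @\<^sub>v b) m = a"
  by (intro eq_vecI) (auto simp: vec_first_def)

text \<open>
  The Lyapunov identity \<open>P AK + AK\<^sup>T P = - W\<^sup>T S W\<close> for \<open>AK = Ag - Bg K\<close> and \<open>W = Cg - Dg K\<close>, stated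
  for the associated quadratic forms. The disjunction covers the two admissible kinds of input: a
  single one without effect, or one with \<open>Dg\<close> of full column rank, for which \<open>Dg\<^sup>T S Dg\<close> is invertible.
\<close>

lemma riccati_lyapunov:
  fixes S Ag Bg Cg Dg P K :: "real mat"
  assumes Ag: "Ag \<in> carrier_mat l l" and Bg: "Bg \<in> carrier_mat l k"
    and Cg: "Cg \<in> carrier_mat r l" and Dg: "Dg \<in> carrier_mat r k"
    and S: "pos_def_mat r S"
    and D: "k = 1 \<and> Dg = 0\<^sub>m r k \<and> Bg = 0\<^sub>m l k \<or> k > 0 \<and> vec_space.rank r Dg = k"
    and P: "pos_def_riccati_solution S Ag Bg Cg Dg P"
    and K: "K = riccati_gain S Ag Bg Cg Dg P"
  shows "K \<in> carrier_mat k l"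
    and "w \<in> carrier_vec l \<Longrightarrow> 2 * ((P *\<^sub>v w) \<bullet> ((Ag - Bg * K) *\<^sub>v w)) =
      - (((Cg - Dg * K) *\<^sub>v w) \<bullet> (S *\<^sub>v ((Cg - Dg * K) *\<^sub>v w)))"
proof -
  define G where "G = transpose_mat Dg * S * Dg"
  have Sc: "S \<in> carrier_mat r r" and Ss: "transpose_mat S = S" using S by (auto simp: pos_def_mat_def)
  have Pd: "pos_def_mat l P" using P Ag by (auto simp: pos_def_riccati_solution_def)
  then have Pc: "P \<in> carrier_mat l l" and Ps: "transpose_mat P = P" by (auto simp: pos_def_mat_def)
  have Gc: "G \<in> carrier_mat k k" using Dg Sc by (auto simp: G_def intro!: mult_carrier_mat)
  have gain: "K \<in> carrier_mat k l \<and> (Dg = 0\<^sub>m r k \<or> G * K = transpose_mat Bg * P + transpose_mat Dg * S * Cg)"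
  proof (cases "Dg = 0\<^sub>m r k")
    case True
    \<comment> \<open>a zero matrix has rank zero, which excludes the second kind of input\<close>
    have "k = 1"
    proof (rule ccontr)
      interpret vec_space "TYPE(real)" r .
      assume "k \<noteq> 1"
      then have "rank Dg = k" "k > 0" using D by auto
      then show False using True rank_0I[of k] by simp
    qed
    then show ?thesis using True K Dg Ag by (auto simp: riccati_gain_def)
  next
    case False
    then have rk: "vec_space.rank r Dg = k" using D by auto
    have "pos_def_mat k G"
      unfolding G_def using full_column_rank_injective[OF Dg rk]
      by (rule pos_def_gram_mat[OF Dg S])
    note GI = pos_def_mat_inv[OF this]
    define Y where "Y = transpose_mat Bg * P + transpose_mat Dg * S * Cg"
    have Y: "Y \<in> carrier_mat k l" using Bg Pc Dg Sc Cg by (simp add: Y_def)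
    have Keq: "K = mat_inv G * Y" using False K Dg by (auto simp: riccati_gain_def G_def Y_def)
    have "G * K = (G * mat_inv G) * Y"
      unfolding Keq using Gc GI(1) Y by (rule assoc_mult_mat[symmetric])
    then have "G * K = Y" using GI(2) Y by simp
    then show ?thesis using Keq GI(1) Y by (auto simp: Y_def)
  qed
  then show Kc: "K \<in> carrier_mat k l" by simp
  assume w: "w \<in> carrier_vec l"
  define a b c d where "a = Ag *\<^sub>v w" and "b = Bg *\<^sub>v (K *\<^sub>v w)" and "c = Cg *\<^sub>v w"
    and "d = Dg *\<^sub>v (K *\<^sub>v w)"
  have Kw: "K *\<^sub>v w \<in> carrier_vec k" using Kc w by simp
  have car: "a \<in> carrier_vec l" "b \<in> carrier_vec l" "c \<in> carrier_vec r" "d \<in> carrier_vec r"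
    "P *\<^sub>v w \<in> carrier_vec l" "S *\<^sub>v c \<in> carrier_vec r" "S *\<^sub>v d \<in> carrier_vec r"
    using Ag Bg Cg Dg Kw w Pc Sc by (auto simp: a_def b_def c_def d_def)
  have ric: "0\<^sub>m l l = P * Ag + transpose_mat Ag * P - transpose_mat K * G * K + transpose_mat Cg * S * Cg"
    using P Ag by (simp add: pos_def_riccati_solution_def Let_def K[symmetric] G_def[symmetric])
  have "0 = w \<bullet> (0\<^sub>m l l *\<^sub>v w)" using w by (simp add: zero_mat_mult_vec)
  also have "\<dots> = w \<bullet> (P *\<^sub>v a) + w \<bullet> (transpose_mat Ag *\<^sub>v (P *\<^sub>v w))
      - w \<bullet> (transpose_mat K *\<^sub>v (transpose_mat Dg *\<^sub>v (S *\<^sub>v d)))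
      + w \<bullet> (transpose_mat Cg *\<^sub>v (S *\<^sub>v c))"
  proof -
    define M1 M2 M3 M4 where "M1 = P * Ag" and "M2 = transpose_mat Ag * P"
      and "M3 = transpose_mat K * G * K" and "M4 = transpose_mat Cg * S * Cg"
    have M: "M1 \<in> carrier_mat l l" "M2 \<in> carrier_mat l l" "M3 \<in> carrier_mat l l" "M4 \<in> carrier_mat l l"
      using Pc Ag Kc Gc Cg Sc by (auto simp: M1_def M2_def M3_def M4_def)
    have "(M1 + M2 - M3 + M4) *\<^sub>v w = M1 *\<^sub>v w + M2 *\<^sub>v w - M3 *\<^sub>v w + M4 *\<^sub>v w"
      using M w add_mult_distrib_mat_vec[of "M1 + M2 - M3" l l M4 w]
        minus_mult_distrib_mat_vec[of "M1 + M2" l l M3 w] add_mult_distrib_mat_vec[of M1 l l M2 w] minus_carrier_mat[OF M(3), of "M1 + M2"] by simp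
    moreover have "M1 *\<^sub>v w = P *\<^sub>v a" "M2 *\<^sub>v w = transpose_mat Ag *\<^sub>v (P *\<^sub>v w)"
      using Pc Ag w by (auto simp: M1_def M2_def a_def intro!: assoc_mult_mat_vec[of _ l l _ l])
    moreover have "M3 *\<^sub>v w = transpose_mat K *\<^sub>v (transpose_mat Dg *\<^sub>v (S *\<^sub>v d))"
    proof -
      have "M3 *\<^sub>v w = transpose_mat K *\<^sub>v (G *\<^sub>v (K *\<^sub>v w))"
        unfolding M3_def using Kc Gc w Kw by (simp add: assoc_mult_mat_vec[of _ l k _ l] assoc_mult_mat_vec[of _ l k _ k])
      moreover have "G *\<^sub>v (K *\<^sub>v w) = transpose_mat Dg *\<^sub>v (S *\<^sub>v d)"
        unfolding G_def d_def using Dg Sc Kw by (simp add: assoc_mult_mat_vec[of _ k r _ k] assoc_mult_mat_vec[of _ k r _ r])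
      ultimately show ?thesis by simp
    qed
    moreover have "M4 *\<^sub>v w = transpose_mat Cg *\<^sub>v (S *\<^sub>v c)"
      unfolding M4_def c_def using Cg Sc w by (simp add: assoc_mult_mat_vec[of _ l r _ l] assoc_mult_mat_vec[of _ l r _ r])
    moreover have "w \<bullet> (x1 + x2 - x3 + x4) = w \<bullet> x1 + w \<bullet> x2 - w \<bullet> x3 + w \<bullet> x4"
      if "x1 \<in> carrier_vec l" "x2 \<in> carrier_vec l" "x3 \<in> carrier_vec l" "x4 \<in> carrier_vec l" for x1 x2 x3 x4
      using that w by (simp add: scalar_prod_add_distrib[of _ l] scalar_prod_minus_distrib[of _ l])
    ultimately show ?thesis
      using M w unfolding ric M1_def[symmetric] M2_def[symmetric] M3_def[symmetric] M4_def[symmetric]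
      by (metis mult_mat_vec_carrier)
  qed
  also have "w \<bullet> (P *\<^sub>v a) = (P *\<^sub>v w) \<bullet> a"
    using scalar_prod_transpose(1)[OF Pc w car(1)] Ps by simp
  also have "w \<bullet> (transpose_mat Ag *\<^sub>v (P *\<^sub>v w)) = (P *\<^sub>v w) \<bullet> a"
    using scalar_prod_transpose(2)[OF Ag car(5) w] car comm_scalar_prod[OF car(1,5)] by (simp add: a_def)
  also have "w \<bullet> (transpose_mat K *\<^sub>v (transpose_mat Dg *\<^sub>v (S *\<^sub>v d))) = d \<bullet> (S *\<^sub>v d)"
    using scalar_prod_transpose(2)[OF Kc _ w, of "transpose_mat Dg *\<^sub>v (S *\<^sub>v d)"]
      scalar_prod_transpose(2)[OF Dg car(7) Kw] Dg car(7) by (simp add: d_def)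
  also have "w \<bullet> (transpose_mat Cg *\<^sub>v (S *\<^sub>v c)) = c \<bullet> (S *\<^sub>v c)"
    using scalar_prod_transpose(2)[OF Cg car(6) w] by (simp add: c_def)
  finally have eq1: "2 * ((P *\<^sub>v w) \<bullet> a) = d \<bullet> (S *\<^sub>v d) - c \<bullet> (S *\<^sub>v c)" by simp
  have eq2: "(P *\<^sub>v w) \<bullet> b = d \<bullet> (S *\<^sub>v d) - d \<bullet> (S *\<^sub>v c)"
  proof (cases "Dg = 0\<^sub>m r k")
    case True
    have "Bg = 0\<^sub>m l k"
    proof (rule ccontr)
      interpret vec_space "TYPE(real)" r .
      assume "Bg \<noteq> 0\<^sub>m l k"
      then have "rank Dg = k" "k > 0" using D by auto
      then show False using True rank_0I[of k] by simp
    qed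
    then have "b = 0\<^sub>v l" "d = 0\<^sub>v r" using True Kw by (auto simp: b_def d_def)
    then show ?thesis using car Sc by simp
  next
    case False
    then have GK: "G * K = transpose_mat Bg * P + transpose_mat Dg * S * Cg" using gain by blast
    have "(G * K) *\<^sub>v w = transpose_mat Dg *\<^sub>v (S *\<^sub>v d)"
      unfolding G_def d_def using Dg Sc Kw Kc w by (simp add: assoc_mult_mat_vec[of _ k k _ l] assoc_mult_mat_vec[of _ k r _ k] assoc_mult_mat_vec[of _ k r _ r])
    moreover have "(G * K) *\<^sub>v w = transpose_mat Bg *\<^sub>v (P *\<^sub>v w) + transpose_mat Dg *\<^sub>v (S *\<^sub>v c)"
      unfolding GK c_def using Bg Pc Dg Sc Cg w
      by (simp add: add_mult_distrib_mat_vec[of _ k l] assoc_mult_mat_vec[of _ k l _ l] assoc_mult_mat_vec[of _ k r _ l] assoc_mult_mat_vec[of _ k r _ r])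
    ultimately have "(K *\<^sub>v w) \<bullet> (transpose_mat Dg *\<^sub>v (S *\<^sub>v d)) =
        (K *\<^sub>v w) \<bullet> (transpose_mat Bg *\<^sub>v (P *\<^sub>v w)) + (K *\<^sub>v w) \<bullet> (transpose_mat Dg *\<^sub>v (S *\<^sub>v c))"
      using scalar_prod_add_distrib[OF Kw, of "transpose_mat Bg *\<^sub>v (P *\<^sub>v w)" "transpose_mat Dg *\<^sub>v (S *\<^sub>v c)"]
        Bg Dg car by (metis mult_mat_vec_carrier transpose_carrier_mat)
    then show ?thesis
      using scalar_prod_transpose(2)[OF Dg car(7) Kw] scalar_prod_transpose(2)[OF Dg car(6) Kw]
        scalar_prod_transpose(2)[OF Bg car(5) Kw] comm_scalar_prod[OF car(2,5)]
      by (simp add: b_def d_def)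
  qed
  have Aw: "(Ag - Bg * K) *\<^sub>v w = a - b"
    using Ag Bg Kc w by (simp add: a_def b_def minus_mult_distrib_mat_vec[of _ l l] assoc_mult_mat_vec[of _ l k _ l])
  have Cw: "(Cg - Dg * K) *\<^sub>v w = c - d"
    using Cg Dg Kc w by (simp add: c_def d_def minus_mult_distrib_mat_vec[of _ r l] assoc_mult_mat_vec[of _ r k _ l])
  have cd: "c \<bullet> (S *\<^sub>v d) = d \<bullet> (S *\<^sub>v c)"
    using scalar_prod_transpose(1)[OF Sc car(3,4)] comm_scalar_prod[OF car(6,4)] Ss by simp
  have "(c - d) \<bullet> (S *\<^sub>v (c - d)) = c \<bullet> (S *\<^sub>v c) - 2 * (d \<bullet> (S *\<^sub>v c)) + d \<bullet> (S *\<^sub>v d)"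
    using car Sc cd by (simp add: mult_minus_distrib_mat_vec[of _ r r] minus_scalar_prod_distrib[of _ r] scalar_prod_minus_distrib[of _ r])
  moreover have "(P *\<^sub>v w) \<bullet> (a - b) = (P *\<^sub>v w) \<bullet> a - (P *\<^sub>v w) \<bullet> b"
    using car by (simp add: scalar_prod_minus_distrib[of _ l])
  ultimately show "2 * ((P *\<^sub>v w) \<bullet> ((Ag - Bg * K) *\<^sub>v w)) =
      - (((Cg - Dg * K) *\<^sub>v w) \<bullet> (S *\<^sub>v ((Cg - Dg * K) *\<^sub>v w)))"
    unfolding Aw Cw using eq1 eq2 by simp
qed

text \<open>
  The embedding \<open>J\<close> of the stabilizability subspace into the state space of the associated system
  consists of the first \<open>l\<close> columns of \<open>Ti\<close>. It intertwines the two systems, and it maps \<open>Mg z\<close> to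
  the full state \<open>state_map F Ca z\<close> whenever that state is stabilizable. All that is used of the change
  of coordinates is contained in these properties.
\<close>

lemma stabilizable_associated_ltiE:
  assumes stab: "stabilizable_associated_lti F A H l k Ag Bg Cg Dg Mg"
    and F: "F \<in> carrier_mat m n" and H: "H \<in> carrier_mat p n"
  obtains nh Aa Ba Ca J where
    "associated_lti F A H nh k Aa Ba Ca Dg"
    "Ag \<in> carrier_mat l l" "Bg \<in> carrier_mat l k" "Cg \<in> carrier_mat (m + p) l"
    "Dg \<in> carrier_mat (m + p) k" "Mg \<in> carrier_mat l n" "J \<in> carrier_mat nh l"
    "k = 1 \<and> Dg = 0\<^sub>m (m + p) k \<and> Bg = 0\<^sub>m l k \<or> k > 0 \<and> vec_space.rank (m + p) Dg = k"
    "\<And>w. w \<in> carrier_vec l \<Longrightarrow> Aa *\<^sub>v (J *\<^sub>v w) = J *\<^sub>v (Ag *\<^sub>v w)"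
    "\<And>g. g \<in> carrier_vec k \<Longrightarrow> Ba *\<^sub>v g = J *\<^sub>v (Bg *\<^sub>v g)"
    "\<And>w. w \<in> carrier_vec l \<Longrightarrow> Ca *\<^sub>v (J *\<^sub>v w) = Cg *\<^sub>v w"
    "\<And>w. w \<in> carrier_vec l \<Longrightarrow> J *\<^sub>v w = 0\<^sub>v nh \<Longrightarrow> w = 0\<^sub>v l"
    "\<And>z. z \<in> carrier_vec n \<Longrightarrow> state_map F Ca *\<^sub>v z \<in> stabilizability_subspace Aa Ba \<Longrightarrow>
      J *\<^sub>v (Mg *\<^sub>v z) = state_map F Ca *\<^sub>v z"
proof -
  obtain nh Aa Ba Ca Da T Ti X Y Z where
    assoc: "associated_lti F A H nh k Aa Ba Ca Da" and l: "l \<le> nh" and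
    c: "Ag \<in> carrier_mat l l" "Bg \<in> carrier_mat l k" "Cg \<in> carrier_mat (dim_row F + dim_row H) l"
      "X \<in> carrier_mat l (nh - l)" "Y \<in> carrier_mat (nh - l) (nh - l)"
      "Z \<in> carrier_mat (dim_row F + dim_row H) (nh - l)"
    and T: "T \<in> carrier_mat nh nh" "Ti \<in> carrier_mat nh nh" "T * Ti = 1\<^sub>m nh" "Ti * T = 1\<^sub>m nh"
    and img: "(\<lambda>v. T *\<^sub>v v) ` stabilizability_subspace Aa Ba =
          (\<lambda>w. four_block_mat (1\<^sub>m l) (0\<^sub>m l (nh - l)) (0\<^sub>m (nh - l) l) (0\<^sub>m (nh - l) (nh - l)) *\<^sub>v w)
            ` carrier_vec nh"
    and TA: "T * Aa * Ti = four_block_mat Ag X (0\<^sub>m (nh - l) l) Y"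
    and TB: "T * Ba = Bg @\<^sub>r 0\<^sub>m (nh - l) k"
    and CT: "Ca * Ti = four_block_mat Cg Z (0\<^sub>m 0 l) (0\<^sub>m 0 (nh - l))"
    and Dg: "Dg = Da"
    and Mg: "Mg = four_block_mat (1\<^sub>m l) (0\<^sub>m l (nh - l)) (0\<^sub>m 0 l) (0\<^sub>m 0 (nh - l)) * T * state_map F Ca"
    using stab unfolding stabilizable_associated_lti_def by blast
  have dims: "dim_row F = m" "dim_col F = n" "dim_row H = p" using F H by auto
  define M0 where "M0 = transpose_mat F * top_rows m Ca"
  have assoc': "nh > 0" "k > 0" "Aa \<in> carrier_mat nh nh" "Ba \<in> carrier_mat nh k"
      "Ca \<in> carrier_mat (m + p) nh" "Da \<in> carrier_mat (m + p) k"
      "k = 1 \<and> Da = 0\<^sub>m (m + p) k \<and> Ba = 0\<^sub>m nh k \<or> vec_space.rank (m + p) Da = k"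
      "vec_space.rank n M0 = nh"
    using assoc unfolding associated_lti_def Let_def dims M0_def by blast+
  have M0: "M0 \<in> carrier_mat n nh" using F assoc'(5) by (auto simp: M0_def top_rows_def)
  have sm: "state_map F Ca = pseudoinverse M0" by (simp add: state_map_def M0_def dims)
  have smc: "state_map F Ca \<in> carrier_mat nh n"
    unfolding sm using full_column_rank_injective[OF M0 assoc'(8)] by (rule pseudoinverse_left_inverse[OF M0])
  define d where "d = nh - l"
  have nh: "nh = l + d" using l by (simp add: d_def)
  define emb where "emb w = w @\<^sub>v 0\<^sub>v d" for w :: "real vec"
  have emb: "emb w \<in> carrier_vec nh" if "w \<in> carrier_vec l" for w
    using that by (simp add: emb_def nh)
  define J where "J = Ti * (1\<^sub>m l @\<^sub>r 0\<^sub>m d l)"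
  have E: "1\<^sub>m l @\<^sub>r 0\<^sub>m d l \<in> carrier_mat nh l" unfolding nh by auto
  have Jc: "J \<in> carrier_mat nh l" unfolding J_def using T(2) E by (rule mult_carrier_mat)
  have J: "J *\<^sub>v w = Ti *\<^sub>v emb w" if w: "w \<in> carrier_vec l" for w
  proof -
    have "J *\<^sub>v w = Ti *\<^sub>v ((1\<^sub>m l @\<^sub>r 0\<^sub>m d l) *\<^sub>v w)"
      unfolding J_def using T(2) E w by (rule assoc_mult_mat_vec)
    also have "(1\<^sub>m l @\<^sub>r 0\<^sub>m d l) *\<^sub>v w = emb w"
      using mat_mult_append[of "1\<^sub>m l" l l "0\<^sub>m d l" d w] w by (simp add: emb_def zero_mat_mult_vec)
    finally show ?thesis .
  qed
  have TJ: "T *\<^sub>v (J *\<^sub>v w) = emb w" if w: "w \<in> carrier_vec l" for w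
  proof -
    have "T *\<^sub>v (J *\<^sub>v w) = (T * Ti) *\<^sub>v emb w"
      unfolding J[OF w] using T emb[OF w] by (intro assoc_mult_mat_vec[symmetric]) auto
    then show ?thesis using T emb[OF w] by simp
  qed
  have TiT: "Ti *\<^sub>v (T *\<^sub>v x) = x" if "x \<in> carrier_vec nh" for x
    using T that by (simp add: assoc_mult_mat_vec[of _ nh nh _ nh, symmetric])
  have AJ: "Aa *\<^sub>v (J *\<^sub>v w) = J *\<^sub>v (Ag *\<^sub>v w)" if w: "w \<in> carrier_vec l" for w
  proof -
    have "T *\<^sub>v (Aa *\<^sub>v (J *\<^sub>v w)) = (T * Aa * Ti) *\<^sub>v emb w"
      unfolding J[OF w] using T assoc'(3) emb[OF w]
      by (simp add: assoc_mult_mat_vec[of _ nh nh _ nh])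
    also have "\<dots> = emb (Ag *\<^sub>v w)"
      unfolding TA emb_def using four_block_mat_mult_vec[OF c(1,4) _ c(5) w, of "0\<^sub>m (nh - l) l" "0\<^sub>v d"] c w
      by (simp add: d_def[symmetric] zero_mat_mult_vec mat_mult_zero_vec)
    finally have "Ti *\<^sub>v (T *\<^sub>v (Aa *\<^sub>v (J *\<^sub>v w))) = J *\<^sub>v (Ag *\<^sub>v w)"
      using J[of "Ag *\<^sub>v w"] c(1) w by simp
    then show ?thesis using TiT assoc'(3) Jc w by simp
  qed
  have BJ: "Ba *\<^sub>v g = J *\<^sub>v (Bg *\<^sub>v g)" if g: "g \<in> carrier_vec k" for g
  proof -
    have "T *\<^sub>v (Ba *\<^sub>v g) = (T * Ba) *\<^sub>v g"
      using T(1) assoc'(4) g by (rule assoc_mult_mat_vec[symmetric])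
    also have "\<dots> = emb (Bg *\<^sub>v g)"
      unfolding TB emb_def using mat_mult_append[OF c(2) _ g, of "0\<^sub>m (nh - l) k" d] g by (simp add: d_def zero_mat_mult_vec)
    finally have "Ti *\<^sub>v (T *\<^sub>v (Ba *\<^sub>v g)) = J *\<^sub>v (Bg *\<^sub>v g)"
      using J[of "Bg *\<^sub>v g"] c(2) g by simp
    then show ?thesis using TiT assoc'(4) g by simp
  qed
  have CJ: "Ca *\<^sub>v (J *\<^sub>v w) = Cg *\<^sub>v w" if w: "w \<in> carrier_vec l" for w
  proof -
    have "Ca *\<^sub>v (J *\<^sub>v w) = (Ca * Ti) *\<^sub>v emb w"
      unfolding J[OF w] using T(2) assoc'(5) emb[OF w] by (intro assoc_mult_mat_vec[symmetric]) auto
    also have "\<dots> = (Cg *\<^sub>v w + Z *\<^sub>v 0\<^sub>v d) @\<^sub>v (0\<^sub>m 0 l *\<^sub>v w + 0\<^sub>m 0 d *\<^sub>v 0\<^sub>v d)"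
      unfolding CT emb_def d_def[symmetric]
      by (rule four_block_mat_mult_vec[OF c(3) _ _ _ w]) (use c(6) d_def in auto)
    also have "\<dots> = Cg *\<^sub>v w"
      using c(3,6) w by (intro eq_vecI) (auto simp: d_def)
    finally show ?thesis .
  qed
  have Jinj: "w = 0\<^sub>v l" if w: "w \<in> carrier_vec l" "J *\<^sub>v w = 0\<^sub>v nh" for w
  proof -
    have "emb w = 0\<^sub>v nh" using TJ[OF w(1)] w(2) mat_mult_zero_vec[OF T(1)] by simp
    also have "\<dots> = 0\<^sub>v l @\<^sub>v 0\<^sub>v d" unfolding nh by (intro eq_vecI) auto
    finally show ?thesis using w(1) append_vec_eq[of w l "0\<^sub>v l"] by (simp add: emb_def)
  qed
  define F1 where "F1 = four_block_mat (1\<^sub>m l) (0\<^sub>m l (nh - l)) (0\<^sub>m 0 l) (0\<^sub>m 0 (nh - l) :: real mat)"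
  have F1: "F1 \<in> carrier_mat l nh" unfolding F1_def using four_block_carrier_mat[of "1\<^sub>m l" l l "0\<^sub>m 0 (nh - l)" 0 "nh - l"] l by simp
  have Mg': "Mg = F1 * T * state_map F Ca" by (simp add: Mg F1_def)
  have Mgc: "Mg \<in> carrier_mat l n" unfolding Mg' using F1 T smc by auto
  have st: "J *\<^sub>v (Mg *\<^sub>v z) = state_map F Ca *\<^sub>v z"
    if z: "z \<in> carrier_vec n" and zs: "state_map F Ca *\<^sub>v z \<in> stabilizability_subspace Aa Ba" for z
  proof -
    define x where "x = state_map F Ca *\<^sub>v z"
    have x: "x \<in> carrier_vec nh" using smc z by (simp add: x_def)
    have "T *\<^sub>v x \<in> (\<lambda>w. four_block_mat (1\<^sub>m l) (0\<^sub>m l (nh - l)) (0\<^sub>m (nh - l) l) (0\<^sub>m (nh - l) (nh - l)) *\<^sub>v w)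
            ` carrier_vec nh"
      using zs unfolding x_def img[symmetric] by blast
    then obtain u where u: "u \<in> carrier_vec nh"
      "T *\<^sub>v x = four_block_mat (1\<^sub>m l) (0\<^sub>m l (nh - l)) (0\<^sub>m (nh - l) l) (0\<^sub>m (nh - l) (nh - l)) *\<^sub>v u"
      by blast
    define w where "w = vec_first u l"
    have w: "w \<in> carrier_vec l" by (simp add: w_def)
    have u': "u = w @\<^sub>v vec_last u d" using u(1) by (simp add: w_def nh)
    have Tx: "T *\<^sub>v x = emb w"
      unfolding u(2) emb_def using four_block_mat_mult_vec[OF one_carrier_mat _ _ _ w, of "0\<^sub>m l d" d "0\<^sub>m d l" d "0\<^sub>m d d" "vec_last u d"] w
      by (subst u') (simp add: d_def zero_mat_mult_vec)
    have "Mg *\<^sub>v z = F1 *\<^sub>v (T *\<^sub>v x)"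
      unfolding Mg' x_def using F1 T smc z by (simp add: assoc_mult_mat_vec[of _ l nh _ n] assoc_mult_mat_vec[of _ l nh _ nh])
    also have "\<dots> = (1\<^sub>m l *\<^sub>v w + 0\<^sub>m l d *\<^sub>v 0\<^sub>v d) @\<^sub>v (0\<^sub>m 0 l *\<^sub>v w + 0\<^sub>m 0 d *\<^sub>v 0\<^sub>v d)"
      unfolding Tx F1_def emb_def d_def[symmetric]
      by (rule four_block_mat_mult_vec[OF _ _ _ _ w]) auto
    also have "\<dots> = w" using w by (intro eq_vecI) auto
    finally show ?thesis using J[OF w] Tx TiT[OF x] by (simp add: x_def)
  qed
  have Bg0: "Bg = 0\<^sub>m l k" if "Ba = 0\<^sub>m nh k"
  proof (rule eq_matI)
    fix i j assume "i < dim_row (0\<^sub>m l k :: real mat)" "j < dim_col (0\<^sub>m l k :: real mat)"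
    then have ij: "i < l" "j < k" by auto
    have "(T * Ba) $$ (i, j) = 0" using that T(1) ij l by simp
    moreover have "(T * Ba) $$ (i, j) = Bg $$ (i, j)"
      unfolding TB append_rows_def using ij c(2) by simp
    ultimately show "Bg $$ (i, j) = 0\<^sub>m l k $$ (i, j)" using ij by simp
  qed (use c in auto)
  have disj: "k = 1 \<and> Dg = 0\<^sub>m (m + p) k \<and> Bg = 0\<^sub>m l k \<or> k > 0 \<and> vec_space.rank (m + p) Dg = k"
    using assoc'(2,7) Bg0 Dg by blast
  show thesis
    by (rule that[OF assoc[folded Dg] c(1,2) _ _ Mgc Jc disj AJ BJ CJ Jinj st]) (use c(3) dims assoc'(6) Dg in auto)
qed

section \<open>Linear differential equations with integrable inhomogeneity\<close>

text \<open>
  The entries of \<open>exp (t A)\<close> as power series. Matrices are functions of two indices below \<open>l\<close>. Both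
  forms \<open>E' = A E\<close> and \<open>E' = E A\<close> are needed: together they show that \<open>E(t) E(-t)\<close> is constant.
\<close>

lemma matrix_exponential_exists:
  fixes A :: "nat \<Rightarrow> nat \<Rightarrow> real"
  obtains E :: "nat \<Rightarrow> nat \<Rightarrow> real \<Rightarrow> real" where
    "\<And>i j t. i < l \<Longrightarrow> j < l \<Longrightarrow> (E i j has_real_derivative (\<Sum>k<l. A i k * E k j t)) (at t)"
    "\<And>i j t. i < l \<Longrightarrow> j < l \<Longrightarrow> (E i j has_real_derivative (\<Sum>k<l. E i k t * A k j)) (at t)"
    "\<And>i j. i < l \<Longrightarrow> j < l \<Longrightarrow> E i j 0 = (if i = j then 1 else 0)"
proof -
  define pw :: "nat \<Rightarrow> nat \<Rightarrow> nat \<Rightarrow> real" where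
    "pw = rec_nat (\<lambda>i j. if i = j then 1 else 0) (\<lambda>_ p i j. \<Sum>k<l. p i k * A k j)"
  have pw0: "pw 0 i j = (if i = j then 1 else 0)" for i j by (simp add: pw_def)
  have pwS: "pw (Suc n) i j = (\<Sum>k<l. pw n i k * A k j)" for n i j by (simp add: pw_def)
  have pwS': "pw (Suc n) i j = (\<Sum>k<l. A i k * pw n k j)" if "i < l" "j < l" for n i j
    using that
  proof (induction n arbitrary: j)
    case 0
    have "(\<Sum>k<l. pw 0 i k * A k j) = A i j"
      using 0 by (simp add: pw0 if_distrib[of "\<lambda>x. x * _"] sum.delta cong: if_cong)
    moreover have "(\<Sum>k<l. A i k * pw 0 k j) = A i j"
      using 0 by (simp add: pw0 if_distrib[of "\<lambda>x. _ * x"] sum.delta cong: if_cong)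
    ultimately show ?case by (simp add: pwS)
  next
    case (Suc n)
    have "pw (Suc (Suc n)) i j = (\<Sum>k<l. (\<Sum>m<l. A i m * pw n m k) * A k j)"
      using Suc by (simp add: pwS[of "Suc n"])
    also have "\<dots> = (\<Sum>k<l. \<Sum>m<l. A i m * (pw n m k * A k j))"
      by (simp add: sum_distrib_right mult.assoc)
    also have "\<dots> = (\<Sum>m<l. A i m * (\<Sum>k<l. pw n m k * A k j))"
      by (subst sum.swap) (simp add: sum_distrib_left)
    finally show ?case by (simp add: pwS)
  qed
  define a where "a = (\<Sum>i<l. \<Sum>j<l. \<bar>A i j\<bar>)"
  have a0: "a \<ge> 0" by (simp add: a_def sum_nonneg)
  have bound: "\<bar>pw n i j\<bar> \<le> a ^ n" if "j < l" for n i j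
    using that
  proof (induction n arbitrary: j)
    case (Suc n)
    have "\<bar>pw (Suc n) i j\<bar> \<le> (\<Sum>k<l. \<bar>pw n i k\<bar> * \<bar>A k j\<bar>)"
      unfolding pwS by (rule order_trans[OF sum_abs]) (simp add: abs_mult)
    also have "\<dots> \<le> (\<Sum>k<l. a ^ n * \<bar>A k j\<bar>)"
      using Suc.IH by (intro sum_mono mult_right_mono) auto
    also have "\<dots> = a ^ n * (\<Sum>k<l. \<bar>A k j\<bar>)" by (simp add: sum_distrib_left)
    also have "\<dots> \<le> a ^ n * a"
      unfolding a_def using Suc.prems
      by (intro mult_left_mono sum_mono member_le_sum) (auto simp: sum_nonneg)
    finally show ?case by (simp add: mult.commute)
  qed (simp add: pw0)
  define E where "E i j t = (\<Sum>n. pw n i j / fact n * t ^ n)" for i j t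
  have summ: "summable (\<lambda>n. pw n i j / fact n * t ^ n)" if "j < l" for i j t
  proof (rule summable_comparison_test')
    show "summable (\<lambda>n. inverse (fact n) * (a * \<bar>t\<bar>) ^ n)" by (rule summable_exp)
    fix n
    have "norm (pw n i j / fact n * t ^ n) = \<bar>pw n i j\<bar> * \<bar>t\<bar> ^ n / fact n"
      by (simp add: abs_mult power_abs)
    also have "\<dots> \<le> a ^ n * \<bar>t\<bar> ^ n / fact n"
      using bound[OF that] by (intro divide_right_mono mult_right_mono) auto
    finally show "norm (pw n i j / fact n * t ^ n) \<le> inverse (fact n) * (a * \<bar>t\<bar>) ^ n"
      by (simp add: power_mult_distrib field_simps)
  qed
  have diffs: "diffs (\<lambda>n. pw n i j / fact n) = (\<lambda>n. pw (Suc n) i j / fact n)" for i j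
    by (rule ext) (simp add: diffs_def fact_Suc del: of_nat_Suc)
  have deriv: "(E i j has_real_derivative (\<Sum>n. pw (Suc n) i j / fact n * t ^ n)) (at t)"
    if "j < l" for i j t
    using termdiffs_strong_converges_everywhere[of "\<lambda>n. pw n i j / fact n" t, OF summ[OF that]]
    by (simp add: diffs E_def[abs_def])
  show thesis
  proof (rule that[of E])
    fix i j t assume ij: "i < l" "j < l"
    have sE: "(\<lambda>n. pw n k m / fact n * t ^ n) sums E k m t" if "m < l" for k m
      unfolding E_def by (rule summable_sums[OF summ[OF that]])
    have "(\<lambda>n. \<Sum>k<l. A i k * (pw n k j / fact n * t ^ n)) sums (\<Sum>k<l. A i k * E k j t)"
      using ij by (intro sums_sum sums_mult sE)
    moreover have "(\<Sum>k<l. A i k * (pw n k j / fact n * t ^ n)) = pw (Suc n) i j / fact n * t ^ n" for n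
      using ij by (simp add: pwS' sum_distrib_right sum_divide_distrib mult.assoc)
    ultimately show "(E i j has_real_derivative (\<Sum>k<l. A i k * E k j t)) (at t)"
      using deriv[OF ij(2), of i t] by (simp add: sums_iff)
    have "(\<lambda>n. \<Sum>k<l. pw n i k / fact n * t ^ n * A k j) sums (\<Sum>k<l. E i k t * A k j)"
      by (intro sums_sum sums_mult2 sE) auto
    moreover have "(\<Sum>k<l. pw n i k / fact n * t ^ n * A k j) = pw (Suc n) i j / fact n * t ^ n" for n
      unfolding pwS sum_divide_distrib sum_distrib_right by (intro sum.cong) (auto simp: field_simps)
    ultimately show "(E i j has_real_derivative (\<Sum>k<l. E i k t * A k j)) (at t)"
      using deriv[OF ij(2), of i t] by (simp add: sums_iff)
  next
    fix i j assume "i < l" "j < l"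
    show "E i j 0 = (if i = j then 1 else 0)"
      unfolding E_def using powser_zero[of "\<lambda>n. pw n i j / fact n"] by (simp add: pw0)
  qed
qed

lemma absolutely_integrable_continuous_mult:
  fixes f g :: "real \<Rightarrow> real"
  assumes "continuous_on {a..b} f" "g absolutely_integrable_on {a..b}"
  shows "(\<lambda>t. f t * g t) absolutely_integrable_on {a..b}"
proof (rule absolutely_integrable_bounded_measurable_product_real[OF _ _ _ assms(2)])
  show "f \<in> borel_measurable (lebesgue_on {a..b})"
    by (rule continuous_imp_measurable_on_sets_lebesgue[OF assms(1)]) simp
  show "bounded (f ` {a..b})"
    using assms(1) by (intro compact_imp_bounded compact_continuous_image) auto
qed simp

text \<open>
  Variation of constants, \<open>r(t) = E(t) (r0 + \<integral>\<^sub>0\<^sup>t E(-s) b(s) ds)\<close>. The equation holds only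
  almost everywhere, because the inhomogeneity is merely integrable.
\<close>

lemma linear_ode_solution_exists:
  fixes A :: "nat \<Rightarrow> nat \<Rightarrow> real" and b :: "nat \<Rightarrow> real \<Rightarrow> real"
  assumes b: "\<And>i T. i < l \<Longrightarrow> b i absolutely_integrable_on {0..T}"
  obtains r :: "nat \<Rightarrow> real \<Rightarrow> real" where
    "\<And>i. i < l \<Longrightarrow> r i 0 = r0 i"
    "\<And>i T. i < l \<Longrightarrow> abs_continuous_on {0..T} (r i)"
    "AE t in lebesgue. t \<in> {0..} \<longrightarrow> (\<forall>i<l. (r i has_real_derivative (\<Sum>k<l. A i k * r k t) + b i t)
        (at t within {0..}))"
proof -
  obtain E :: "nat \<Rightarrow> nat \<Rightarrow> real \<Rightarrow> real" where
    E1: "\<And>i j t. i < l \<Longrightarrow> j < l \<Longrightarrow> (E i j has_real_derivative (\<Sum>k<l. A i k * E k j t)) (at t)" and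
    E2: "\<And>i j t. i < l \<Longrightarrow> j < l \<Longrightarrow> (E i j has_real_derivative (\<Sum>k<l. E i k t * A k j)) (at t)" and
    E0: "\<And>i j. i < l \<Longrightarrow> j < l \<Longrightarrow> E i j 0 = (if i = j then 1 else 0)"
    by (rule matrix_exponential_exists[of l A]) (rule that; assumption)
  have Ec: "continuous_on S (E i j)" if "i < l" "j < l" for i j S
    by (rule DERIV_continuous_on[OF has_field_derivative_at_within[OF E1[OF that]]])
  \<comment> \<open>\<open>E(-t)\<close> is the inverse of \<open>E(t)\<close>\<close>
  have inv: "(\<Sum>j<l. E i j t * E j k (- t)) = (if i = k then 1 else 0)" if ik: "i < l" "k < l" for i k t
  proof -
    define g where "g t = (\<Sum>j<l. E i j t * E j k (- t))" for t
    have "(g has_real_derivative 0) (at s)" for s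
    proof -
      have m: "((\<lambda>t. E j k (- t)) has_real_derivative - (\<Sum>m<l. A j m * E m k (- s))) (at s)" if "j < l" for j
        using DERIV_chain2[OF E1[OF that ik(2), of "- s"] DERIV_minus[OF DERIV_ident]] by simp
      have "(g has_real_derivative (\<Sum>j<l. (\<Sum>m<l. E i m s * A m j) * E j k (- s)
          + (- (\<Sum>m<l. A j m * E m k (- s))) * E i j s)) (at s)"
        unfolding g_def using ik by (intro DERIV_sum DERIV_mult E2 m) auto
      moreover have "(\<Sum>j<l. (\<Sum>m<l. E i m s * A m j) * E j k (- s)) =
          (\<Sum>j<l. (\<Sum>m<l. A j m * E m k (- s)) * E i j s)"
        unfolding sum_distrib_right by (subst sum.swap) (simp add: ac_simps)
      ultimately show ?thesis by (simp add: sum_subtractf)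
    qed
    then have "g t = g 0" by (intro DERIV_isconst_all) auto
    also have "\<dots> = (\<Sum>j<l. if i = j then (if j = k then 1 else 0) else 0)"
      unfolding g_def using ik by (intro sum.cong) (auto simp: E0)
    also have "\<dots> = (if i = k then 1 else 0)" using ik by simp
    finally show ?thesis by (simp add: g_def)
  qed
  define c where "c j s = (\<Sum>k<l. E j k (- s) * b k s)" for j s
  have cint: "c j absolutely_integrable_on {0..T}" if "j < l" for j T
  proof -
    have "(\<lambda>s. E j k (- s) * b k s) absolutely_integrable_on {0..T}" if "k < l" for k
      using \<open>j < l\<close> that
      by (intro absolutely_integrable_continuous_mult b continuous_on_compose2[OF Ec[where S = UNIV]] continuous_intros) auto
    then show ?thesis unfolding c_def by (intro absolutely_integrable_sum) auto
  qed
  define h where "h j t = r0 j + integral {0..t} (c j)" for j t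
  define r where "r i t = (\<Sum>j<l. E i j t * h j t)" for i t
  have hac: "abs_continuous_on {0..T} (h j)" if "j < l" for j T
    unfolding h_def using cint[OF that]
    by (intro abs_continuous_on_add abs_continuous_on_const abs_continuous_on_indefinite_integral)
  have Eac: "abs_continuous_on {0..T} (E i j)" if ij: "i < l" "j < l" for i j T
    by (rule abs_continuous_on_continuous_derivative[OF has_field_derivative_at_within[OF E1[OF ij]]])
       (use ij in \<open>auto intro!: continuous_intros Ec\<close>)
  show thesis
  proof (rule that[of r])
    fix i assume i: "i < l"
    have "r i 0 = (\<Sum>j<l. if i = j then r0 j else 0)"
      unfolding r_def h_def using i by (intro sum.cong) (auto simp: E0)
    then show "r i 0 = r0 i" using i by simp
    show "abs_continuous_on {0..T} (r i)" for T
      unfolding r_def using i by (intro abs_continuous_on_sum abs_continuous_on_mult hac Eac) auto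
  next
    have "AE t in lebesgue. \<forall>j\<in>{..<l}. t \<in> {0..} \<longrightarrow> (h j has_real_derivative c j t) (at t within {0..})"
    proof (rule eventually_ball_finite, simp, intro ballI)
      fix j assume "j \<in> {..<l}"
      then have "c j integrable_on {0..T}" for T
        using cint[of j T] by (auto simp: absolutely_integrable_on_def)
      from AE_has_derivative_indefinite_integral[OF this]
      show "AE t in lebesgue. t \<in> {0..} \<longrightarrow> (h j has_real_derivative c j t) (at t within {0..})"
      proof (rule eventually_mono, intro impI)
        fix t :: real
        assume *: "t \<in> {0..} \<longrightarrow> ((\<lambda>t. integral {0..t} (c j)) has_real_derivative c j t) (at t within {0..})"
          and t: "t \<in> {0..}"
        show "(h j has_real_derivative c j t) (at t within {0..})"
          unfolding h_def using DERIV_add[OF DERIV_const *[rule_format, OF t]] by simp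
      qed
    qed
    then show "AE t in lebesgue. t \<in> {0..} \<longrightarrow> (\<forall>i<l. (r i has_real_derivative
        (\<Sum>k<l. A i k * r k t) + b i t) (at t within {0..}))"
    proof (rule eventually_mono, intro impI allI)
      fix t i assume t: "t \<in> {0..}" and i: "i < l"
        and H: "\<forall>j\<in>{..<l}. t \<in> {0..} \<longrightarrow> (h j has_real_derivative c j t) (at t within {0..})"
      have "(r i has_real_derivative (\<Sum>j<l. (\<Sum>k<l. A i k * E k j t) * h j t + c j t * E i j t))
          (at t within {0..})"
        unfolding r_def using H t i
        by (intro DERIV_sum DERIV_mult has_field_derivative_at_within[OF E1]) auto
      moreover have "(\<Sum>j<l. (\<Sum>k<l. A i k * E k j t) * h j t) = (\<Sum>k<l. A i k * r k t)"
        unfolding r_def sum_distrib_right sum_distrib_left by (subst sum.swap) (simp add: ac_simps)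
      moreover have "(\<Sum>j<l. c j t * E i j t) = b i t"
      proof -
        have "(\<Sum>j<l. c j t * E i j t) = (\<Sum>k<l. (\<Sum>j<l. E i j t * E j k (- t)) * b k t)"
          unfolding c_def sum_distrib_right by (subst sum.swap) (simp add: ac_simps)
        also have "\<dots> = (\<Sum>k<l. if i = k then b k t else 0)"
          using i by (intro sum.cong) (auto simp: inv)
        finally show ?thesis using i by simp
      qed
      ultimately show "(r i has_real_derivative (\<Sum>k<l. A i k * r k t) + b i t) (at t within {0..})"
        by (simp add: sum.distrib)
    qed
  qed
qed

section \<open>Square integrable and vector-valued functions\<close>

lemma set_borel_measurable_times:
  fixes f g :: "real \<Rightarrow> real"
  assumes "set_borel_measurable lebesgue S f" "set_borel_measurable lebesgue S g"
  shows "set_borel_measurable lebesgue S (\<lambda>t. f t * g t)"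
proof -
  have "(\<lambda>t. (indicator S t *\<^sub>R f t) * (indicator S t *\<^sub>R g t)) \<in> borel_measurable lebesgue"
    using assms unfolding set_borel_measurable_def by (intro borel_measurable_times)
  moreover have "(\<lambda>t. (indicator S t *\<^sub>R f t) * (indicator S t *\<^sub>R g t)) =
      (\<lambda>t. indicator S t *\<^sub>R (f t * g t))"
    by (auto simp: fun_eq_iff indicator_def)
  ultimately show ?thesis unfolding set_borel_measurable_def by simp
qed

lemma square_integrable_mult:
  assumes f: "square_integrable S f" and g: "square_integrable S g"
  shows "set_integrable lebesgue S (\<lambda>t. f t * g t)"
proof (rule set_integrable_bound)
  show "set_integrable lebesgue S (\<lambda>t. (f t)\<^sup>2 + (g t)\<^sup>2)"
    using f g by (auto simp: square_integrable_def)
  show "set_borel_measurable lebesgue S (\<lambda>t. f t * g t)"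
    using f g by (auto simp: square_integrable_def intro: set_borel_measurable_times)
  show "AE t in lebesgue. t \<in> S \<longrightarrow> norm (f t * g t) \<le> norm ((f t)\<^sup>2 + (g t)\<^sup>2)"
  proof (rule AE_I2, rule impI)
    fix t
    have "2 * (\<bar>f t\<bar> * \<bar>g t\<bar>) \<le> (f t)\<^sup>2 + (g t)\<^sup>2"
      using zero_le_power2[of "\<bar>f t\<bar> - \<bar>g t\<bar>"] by (simp add: power2_diff)
    then show "norm (f t * g t) \<le> norm ((f t)\<^sup>2 + (g t)\<^sup>2)"
      by (simp add: abs_mult) (smt (verit) mult_nonneg_nonneg abs_ge_zero)
  qed
qed

lemma square_integrable_continuous:
  assumes "continuous_on {a..b} f"
  shows "square_integrable {a..b} f"
proof -
  have "set_integrable lebesgue {a..b} f" "set_integrable lebesgue {a..b} (\<lambda>t. (f t)\<^sup>2)"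
    using assms by (auto intro!: absolutely_integrable_continuous_real continuous_intros)
  then show ?thesis
    unfolding square_integrable_def set_borel_measurable_def set_integrable_def
    by (auto intro: borel_measurable_integrable)
qed

lemma square_integrable_imp_integrable:
  "square_integrable {a..b} f \<Longrightarrow> set_integrable lebesgue {a..b} f"
  using square_integrable_mult[of "{a..b}" f "\<lambda>_. 1"] square_integrable_continuous[of a b "\<lambda>_. 1"] by simp

lemma square_integrable_cong:
  assumes "square_integrable S f" "\<And>t. t \<in> S \<Longrightarrow> f t = g t"
  shows "square_integrable S g"
proof -
  have "(\<lambda>t. indicator S t *\<^sub>R f t) = (\<lambda>t. indicator S t *\<^sub>R g t)"
    "(\<lambda>t. indicator S t *\<^sub>R (f t)\<^sup>2) = (\<lambda>t. indicator S t *\<^sub>R (g t)\<^sup>2)"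
    using assms(2) by (auto simp: fun_eq_iff indicator_def)
  then show ?thesis
    using assms(1) by (simp only: square_integrable_def set_borel_measurable_def set_integrable_def)
qed

lemma square_integrable_cmult:
  assumes "square_integrable S f"
  shows "square_integrable S (\<lambda>t. c * f t)"
proof -
  have "(\<lambda>t. c * (indicator S t *\<^sub>R f t)) \<in> borel_measurable lebesgue"
    using assms unfolding square_integrable_def set_borel_measurable_def
    by (intro borel_measurable_times borel_measurable_const) auto
  moreover have "(\<lambda>t. c * (indicator S t *\<^sub>R f t)) = (\<lambda>t. indicator S t *\<^sub>R (c * f t))"
    by (simp add: fun_eq_iff)
  ultimately show ?thesis
    using assms by (simp add: square_integrable_def set_borel_measurable_def power_mult_distrib)
qed

lemma square_integrable_add:
  assumes f: "square_integrable S f" and g: "square_integrable S g"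
  shows "square_integrable S (\<lambda>t. f t + g t)"
proof -
  have "(\<lambda>t. indicator S t *\<^sub>R f t + indicator S t *\<^sub>R g t) \<in> borel_measurable lebesgue"
    using assms unfolding square_integrable_def set_borel_measurable_def
    by (intro borel_measurable_add) auto
  then have "set_borel_measurable lebesgue S (\<lambda>t. f t + g t)"
    by (simp add: set_borel_measurable_def distrib_left)
  moreover have "set_integrable lebesgue S (\<lambda>t. (f t)\<^sup>2 + (g t)\<^sup>2 + 2 * (f t * g t))"
    using f g square_integrable_mult[OF f g] by (intro set_integral_add set_integrable_mult_right) (auto simp: square_integrable_def)
  ultimately show ?thesis
    by (simp add: square_integrable_def power2_sum mult.assoc)
qed

lemma square_integrable_sum:
  assumes "\<And>i. i \<in> I \<Longrightarrow> square_integrable {a..b} (f i)"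
  shows "square_integrable {a..b} (\<lambda>t. \<Sum>i\<in>I. f i t)"
  using assms
proof (induction I rule: infinite_finite_induct)
  case (insert i I)
  then show ?case by (simp add: square_integrable_add)
qed (simp_all add: square_integrable_continuous)

lemma L2_loc_halflineD:
  assumes "g \<in> L2_loc {0..} n"
  shows "t \<ge> 0 \<Longrightarrow> g t \<in> carrier_vec n"
    and "i < n \<Longrightarrow> square_integrable {0..b} (\<lambda>t. g t $ i)"
  using assms by (auto simp: L2_loc_def L2_def)

lemma L2_loc_halflineI:
  assumes "\<And>t. t \<ge> 0 \<Longrightarrow> g t \<in> carrier_vec n"
    and "\<And>i a b. i < n \<Longrightarrow> 0 \<le> a \<Longrightarrow> a \<le> b \<Longrightarrow> square_integrable {a..b} (\<lambda>t. g t $ i)"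
  shows "g \<in> L2_loc {0..} n"
proof -
  have "square_integrable {a..b} (\<lambda>t. g t $ i)" if "{a..b} \<subseteq> {0..}" "i < n" for a b i
  proof (cases "a \<le> b")
    case True
    then show ?thesis using assms(2) that by auto
  next
    case False
    then show ?thesis
      by (simp add: square_integrable_def set_borel_measurable_def set_integrable_def)
  qed
  then show ?thesis using assms(1) by (fastforce simp: L2_loc_def L2_def)
qed

lemma AC_halflineD:
  assumes "g \<in> AC {0..} n"
  shows "t \<ge> 0 \<Longrightarrow> g t \<in> carrier_vec n"
    and "i < n \<Longrightarrow> abs_continuous_on {0..b} (\<lambda>t. g t $ i)"
  using assms by (auto simp: AC_def)

lemma AC_halflineI:
  assumes "\<And>t. t \<ge> 0 \<Longrightarrow> g t \<in> carrier_vec n"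
    and "\<And>i b. i < n \<Longrightarrow> 0 \<le> b \<Longrightarrow> abs_continuous_on {0..b} (\<lambda>t. g t $ i)"
  shows "g \<in> AC {0..} n"
proof -
  have "abs_continuous_on {a..b} (\<lambda>t. g t $ i)" if "{a..b} \<subseteq> {0..}" "i < n" for a b i
    using assms(2)[OF that(2), of "max 0 b"] by (rule abs_continuous_on_subset) (use that in auto)
  then show ?thesis using assms(1) by (auto simp: AC_def)
qed

lemma abs_continuous_on_scalar_prod:
  assumes "\<And>t. t \<in> {a..b} \<Longrightarrow> x t \<in> carrier_vec n" "\<And>t. t \<in> {a..b} \<Longrightarrow> y t \<in> carrier_vec n"
    and "\<And>i. i < n \<Longrightarrow> abs_continuous_on {a..b} (\<lambda>t. x t $ i)"
    and "\<And>i. i < n \<Longrightarrow> abs_continuous_on {a..b} (\<lambda>t. y t $ i)"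
  shows "abs_continuous_on {a..b} (\<lambda>t. x t \<bullet> y t)"
proof (rule abs_continuous_on_cong)
  show "abs_continuous_on {a..b} (\<lambda>t. \<Sum>i<n. x t $ i * y t $ i)"
    using assms by (intro abs_continuous_on_sum abs_continuous_on_mult) auto
qed (use assms in \<open>simp add: scalar_prod_eq_sum[of _ n]\<close>)

lemma index_mult_mat_vec_sum:
  assumes "M \<in> carrier_mat r c" "x \<in> carrier_vec c" "i < r"
  shows "(M *\<^sub>v x) $ i = (\<Sum>j<c. M $$ (i, j) * (x $ j :: real))"
  using assms by (simp add: scalar_prod_def lessThan_atLeast0)

lemma abs_continuous_on_mult_mat_vec:
  assumes "M \<in> carrier_mat r c" "i < r" "\<And>t. t \<in> {a..b} \<Longrightarrow> x t \<in> carrier_vec c"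
    and "\<And>j. j < c \<Longrightarrow> abs_continuous_on {a..b} (\<lambda>t. x t $ j)"
  shows "abs_continuous_on {a..b} (\<lambda>t. (M *\<^sub>v x t) $ i)"
proof (rule abs_continuous_on_cong)
  show "abs_continuous_on {a..b} (\<lambda>t. \<Sum>j<c. M $$ (i, j) * x t $ j)"
    using assms by (intro abs_continuous_on_sum abs_continuous_on_cmult) auto
qed (use assms in \<open>simp only: index_mult_mat_vec_sum\<close>)

lemma square_integrable_mult_mat_vec:
  assumes "M \<in> carrier_mat r c" "i < r" "\<And>t. t \<in> {a..b} \<Longrightarrow> x t \<in> carrier_vec c"
    and "\<And>j. j < c \<Longrightarrow> square_integrable {a..b} (\<lambda>t. x t $ j)"
  shows "square_integrable {a..b} (\<lambda>t. (M *\<^sub>v x t) $ i)"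
proof (rule square_integrable_cong)
  show "square_integrable {a..b} (\<lambda>t. \<Sum>j<c. M $$ (i, j) * x t $ j)"
    using assms by (intro square_integrable_sum square_integrable_cmult) auto
qed (use assms in \<open>simp only: index_mult_mat_vec_sum\<close>)

lemma set_integrable_scalar_prod:
  assumes "\<And>t. t \<in> S \<Longrightarrow> x t \<in> carrier_vec n" "\<And>t. t \<in> S \<Longrightarrow> y t \<in> carrier_vec n"
    and "\<And>i. i < n \<Longrightarrow> square_integrable S (\<lambda>t. x t $ i)"
    and "\<And>i. i < n \<Longrightarrow> square_integrable S (\<lambda>t. y t $ i)"
  shows "set_integrable lebesgue S (\<lambda>t. x t \<bullet> y t)"
proof -
  have "set_integrable lebesgue S (\<lambda>t. \<Sum>i<n. x t $ i * y t $ i)"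
    using assms by (intro absolutely_integrable_sum square_integrable_mult) auto
  then show ?thesis
    by (rule set_integrable_cong[THEN iffD1, rotated -1]) (use assms in \<open>auto simp: scalar_prod_eq_sum[of _ n]\<close>)
qed

lemma has_real_derivative_scalar_prod:
  assumes "t \<in> S" "\<And>s. s \<in> S \<Longrightarrow> x s \<in> carrier_vec n" "\<And>s. s \<in> S \<Longrightarrow> y s \<in> carrier_vec n"
    and "x' \<in> carrier_vec n" "y' \<in> carrier_vec n"
    and "\<And>i. i < n \<Longrightarrow> ((\<lambda>s. x s $ i) has_real_derivative x' $ i) (at t within S)"
    and "\<And>i. i < n \<Longrightarrow> ((\<lambda>s. y s $ i) has_real_derivative y' $ i) (at t within S)"
  shows "((\<lambda>s. x s \<bullet> y s) has_real_derivative (x' \<bullet> y t + x t \<bullet> y')) (at t within S)"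
proof (rule has_field_derivative_transform_within[where d = 1])
  have "((\<lambda>s. \<Sum>i<n. x s $ i * y s $ i) has_real_derivative
      (\<Sum>i<n. x' $ i * y t $ i + y' $ i * x t $ i)) (at t within S)"
    using assms by (intro DERIV_sum DERIV_mult) auto
  also have "(\<Sum>i<n. x' $ i * y t $ i + y' $ i * x t $ i) = x' \<bullet> y t + x t \<bullet> y'"
    using assms by (simp add: scalar_prod_eq_sum[of _ n] sum.distrib mult.commute)
  finally show "((\<lambda>s. \<Sum>i<n. x s $ i * y s $ i) has_real_derivative (x' \<bullet> y t + x t \<bullet> y')) (at t within S)" .
qed (use assms in \<open>auto simp: scalar_prod_eq_sum[of _ n]\<close>)

lemma has_real_derivative_mult_mat_vec:
  assumes M: "M \<in> carrier_mat r c" "i < r" and "t \<in> S" and x: "\<And>s. s \<in> S \<Longrightarrow> x s \<in> carrier_vec c"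
    and x': "x' \<in> carrier_vec c"
    and "\<And>j. j < c \<Longrightarrow> ((\<lambda>s. x s $ j) has_real_derivative x' $ j) (at t within S)"
  shows "((\<lambda>s. (M *\<^sub>v x s) $ i) has_real_derivative (M *\<^sub>v x') $ i) (at t within S)"
proof (rule has_field_derivative_transform_within[where d = 1])
  show "((\<lambda>s. \<Sum>j<c. M $$ (i, j) * x s $ j) has_real_derivative (M *\<^sub>v x') $ i) (at t within S)"
    unfolding index_mult_mat_vec_sum[OF M(1) x' M(2)]
    using assms by (intro DERIV_sum DERIV_cmult) auto
qed (use assms in \<open>auto simp only: index_mult_mat_vec_sum\<close>)

lemma AE_ball_finite:
  assumes "finite I" "\<And>i. i \<in> I \<Longrightarrow> AE t in M. P i t"
  shows "AE t in M. \<forall>i\<in>I. P i t"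
  using assms by (intro eventually_ball_finite) auto

section \<open>Duality between the plant and the observer\<close>

text \<open>
  The output of an observer with kernel \<open>Cu v(t - s)\<close> along a trajectory of the plant. Here \<open>z\<close> plays the
  role of the absolutely continuous version of \<open>F x\<close>, and the hypothesis \<open>dual\<close> says that \<open>Cq v\<close> and
  \<open>Cu v\<close> solve the dual DAE. Integrate the derivative of
  \<open>\<phi>(s) = v(T - s) \<bullet> r(s) - Cq v(T - s) \<bullet> z(s)\<close>, in which all terms cancel except \<open>- u \<bullet> y\<close>.
\<close>

lemma observer_error_identity:
  fixes F A H AK Cq Cu :: "real mat"
  assumes mats: "F \<in> carrier_mat m n" "A \<in> carrier_mat m n" "H \<in> carrier_mat p n"
      "AK \<in> carrier_mat l l" "Cq \<in> carrier_mat m l" "Cu \<in> carrier_mat p l"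
    and v: "\<And>t. t \<ge> 0 \<Longrightarrow> v t \<in> carrier_vec l"
    and v': "\<And>t i. t \<ge> 0 \<Longrightarrow> i < l \<Longrightarrow>
      ((\<lambda>s. v s $ i) has_real_derivative (AK *\<^sub>v v t) $ i) (at t within {0..})"
    and dual: "\<And>t. t > 0 \<Longrightarrow> transpose_mat F *\<^sub>v (Cq *\<^sub>v (AK *\<^sub>v v t)) =
      transpose_mat A *\<^sub>v (Cq *\<^sub>v v t) - transpose_mat H *\<^sub>v (Cu *\<^sub>v v t)"
    and r: "r \<in> AC {0..} l"
    and r': "AE t in lebesgue. t \<in> {0..} \<longrightarrow> (\<forall>i<l. ((\<lambda>s. r s $ i) has_real_derivative
      (transpose_mat AK *\<^sub>v r t + (transpose_mat Cq *\<^sub>v f t - transpose_mat Cu *\<^sub>v \<eta> t)) $ i) (at t within {0..}))"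
    and z: "z \<in> AC {0..} m"
    and z': "AE t in lebesgue. t \<in> {0..} \<longrightarrow> (\<forall>i<m. ((\<lambda>s. z s $ i) has_real_derivative
      (A *\<^sub>v x t + f t) $ i) (at t within {0..}))"
    and zF: "AE t in lebesgue. t \<in> {0..} \<longrightarrow> z t = F *\<^sub>v x t"
    and x: "\<And>t. t \<ge> 0 \<Longrightarrow> x t \<in> carrier_vec n" and f: "\<And>t. t \<ge> 0 \<Longrightarrow> f t \<in> carrier_vec m"
    and \<eta>: "\<And>t. t \<ge> 0 \<Longrightarrow> \<eta> t \<in> carrier_vec p"
    and y: "y \<in> L2_loc {0..} p"
    and yH: "AE t in lebesgue. t \<in> {0..} \<longrightarrow> y t = H *\<^sub>v x t + \<eta> t"
    and r0: "r 0 = transpose_mat Cq *\<^sub>v z 0"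
    and T: "T \<ge> 0"
  shows "(LINT s:{0..T}|lebesgue. y s \<bullet> (Cu *\<^sub>v v (T - s))) = (Cq *\<^sub>v v 0) \<bullet> z T - v 0 \<bullet> r T"
proof -
  define w where "w s = v (T - s)" for s
  have wc: "w s \<in> carrier_vec l" if "s \<in> {0..T}" for s using v that by (simp add: w_def)
  have w': "((\<lambda>s. w s $ i) has_real_derivative (- (AK *\<^sub>v w s)) $ i) (at s within {0..T})"
    if s: "s \<in> {0..T}" and i: "i < l" for s i
  proof -
    have "((\<lambda>u. v u $ i) has_real_derivative (AK *\<^sub>v w s) $ i) (at (T - s) within (\<lambda>s. T - s) ` {0..T})"
      by (rule has_field_derivative_subset[where s = "{0..}"]) (use v'[of "T - s", OF _ i] s in \<open>auto simp: w_def\<close>)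
    from DERIV_image_chain[OF this DERIV_diff[OF DERIV_const DERIV_ident]]
    have "((\<lambda>s. v (T - s) $ i) has_real_derivative (AK *\<^sub>v w s) $ i * (0 - 1)) (at s within {0..T})"
      by (simp only: o_def)
    then show ?thesis using i mats(4) by (simp add: w_def)
  qed
  have wac: "abs_continuous_on {0..T} (\<lambda>s. w s $ i)" if i: "i < l" for i
  proof (rule abs_continuous_on_continuous_derivative[OF w'[OF _ i]])
    have wcont: "continuous_on {0..T} (\<lambda>s. w s $ j)" if "j < l" for j
      using w'[OF _ that] by (rule DERIV_continuous_on)
    have "continuous_on {0..T} (\<lambda>s. - (\<Sum>j<l. AK $$ (i, j) * w s $ j))"
      using wcont by (intro continuous_intros) auto
    moreover have "- (\<Sum>j<l. AK $$ (i, j) * w s $ j) = (- (AK *\<^sub>v w s)) $ i" if "s \<in> {0..T}" for s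
      using index_mult_mat_vec_sum[OF mats(4) wc[OF that] i] mats(4) i by simp
    ultimately show "continuous_on {0..T} (\<lambda>s. (- (AK *\<^sub>v w s)) $ i)"
      by (rule continuous_on_cong[THEN iffD1, rotated -1, OF _ refl]) 
  qed
  define q where "q s = Cq *\<^sub>v w s" for s
  define u where "u s = Cu *\<^sub>v w s" for s
  have qc: "q s \<in> carrier_vec m" and uc: "u s \<in> carrier_vec p" if "s \<in> {0..T}" for s
    using wc[OF that] mats by (auto simp: q_def u_def)
  have rc: "\<And>t. t \<ge> 0 \<Longrightarrow> r t \<in> carrier_vec l" and zc: "\<And>t. t \<ge> 0 \<Longrightarrow> z t \<in> carrier_vec m"
    using AC_halflineD(1)[OF r] AC_halflineD(1)[OF z] by auto
  define \<phi> where "\<phi> s = w s \<bullet> r s + (- 1) * (q s \<bullet> z s)" for s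
  have ac: "abs_continuous_on {0..T} \<phi>"
    unfolding \<phi>_def q_def
    using wc wac qc[unfolded q_def] rc zc AC_halflineD(2)[OF r] AC_halflineD(2)[OF z] mats
    by (intro abs_continuous_on_add abs_continuous_on_cmult abs_continuous_on_scalar_prod[of _ _ _ l]
      abs_continuous_on_scalar_prod[of _ _ _ m] abs_continuous_on_mult_mat_vec[OF mats(5)]) auto
  \<comment> \<open>the endpoint is excluded because the pointwise dual DAE is available at positive times only\<close>
  have "AE s in lebesgue. s \<noteq> T" by (rule AE_completion[OF AE_lborel_singleton])
  with r' z' zF yH
  have "AE s in lebesgue. s \<in> {0..T} \<longrightarrow> (\<phi> has_real_derivative - (y s \<bullet> u s)) (at s within {0..T})"
  proof eventually_elim
    case (elim s)
    show ?case
    proof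
      assume s: "s \<in> {0..T}"
      then have s0: "s \<ge> 0" "s \<in> {0..}" and Ts: "T - s > 0" using elim by auto
      have sub: "{0..T} \<subseteq> {0..}" by auto
      define a b d where "a = AK *\<^sub>v w s" and "b = transpose_mat Cq *\<^sub>v f s - transpose_mat Cu *\<^sub>v \<eta> s"
        and "d = A *\<^sub>v x s + f s"
      have cs: "w s \<in> carrier_vec l" "r s \<in> carrier_vec l" "z s \<in> carrier_vec m" "x s \<in> carrier_vec n"
        "f s \<in> carrier_vec m" "\<eta> s \<in> carrier_vec p" "q s \<in> carrier_vec m" "u s \<in> carrier_vec p"
        using wc[OF s] rc zc x f \<eta> qc[OF s] uc[OF s] s0 by auto
      have cs': "a \<in> carrier_vec l" "b \<in> carrier_vec l" "d \<in> carrier_vec m"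
        "transpose_mat Cq *\<^sub>v f s \<in> carrier_vec l" "transpose_mat Cu *\<^sub>v \<eta> s \<in> carrier_vec l"
        "A *\<^sub>v x s \<in> carrier_vec m" "H *\<^sub>v x s \<in> carrier_vec p" "F *\<^sub>v x s \<in> carrier_vec m"
        "Cq *\<^sub>v a \<in> carrier_vec m" "transpose_mat AK *\<^sub>v r s \<in> carrier_vec l"
        "transpose_mat A *\<^sub>v q s \<in> carrier_vec n" "transpose_mat H *\<^sub>v u s \<in> carrier_vec n"
        using cs mats by (auto simp: a_def b_def d_def)
      have D1: "((\<lambda>s. w s \<bullet> r s) has_real_derivative ((- a) \<bullet> r s + w s \<bullet> (transpose_mat AK *\<^sub>v r s + b)))
          (at s within {0..T})"
      proof (rule has_real_derivative_scalar_prod[of s _ _ l])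
        show "((\<lambda>s. r s $ i) has_real_derivative (transpose_mat AK *\<^sub>v r s + b) $ i) (at s within {0..T})"
          if "i < l" for i
          using elim(1) s0 that unfolding b_def by (intro has_field_derivative_subset[OF _ sub]) auto
        show "((\<lambda>s. w s $ i) has_real_derivative (- a) $ i) (at s within {0..T})" if "i < l" for i
          using w'[OF s that] by (simp add: a_def)
      qed (use s cs' rc wc in auto)
      have D2: "((\<lambda>s. q s \<bullet> z s) has_real_derivative ((Cq *\<^sub>v (- a)) \<bullet> z s + q s \<bullet> d))
          (at s within {0..T})"
      proof (rule has_real_derivative_scalar_prod[of s _ _ m])
        show "((\<lambda>s. z s $ i) has_real_derivative d $ i) (at s within {0..T})"
          if "i < m" for i
          using elim(2) s0 that unfolding d_def by (intro has_field_derivative_subset[OF _ sub]) auto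
        show "((\<lambda>s. q s $ i) has_real_derivative (Cq *\<^sub>v (- a)) $ i) (at s within {0..T})" if "i < m" for i
          unfolding q_def
        proof (rule has_real_derivative_mult_mat_vec[OF mats(5) that s])
          show "((\<lambda>s. w s $ j) has_real_derivative (- a) $ j) (at s within {0..T})" if "j < l" for j
            using w'[OF s that] by (simp add: a_def)
        qed (use wc cs' in auto)
      qed (use s cs' zc qc mats in auto)
      have e1: "(- a) \<bullet> r s + w s \<bullet> (transpose_mat AK *\<^sub>v r s + b) = q s \<bullet> f s - u s \<bullet> \<eta> s"
      proof -
        have "w s \<bullet> (transpose_mat AK *\<^sub>v r s) = a \<bullet> r s"
          using scalar_prod_transpose(2)[OF mats(4) cs(2,1)] by (simp add: a_def)
        moreover have "w s \<bullet> b = q s \<bullet> f s - u s \<bullet> \<eta> s"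
          using scalar_prod_transpose(2)[OF mats(5) cs(5,1)] scalar_prod_transpose(2)[OF mats(6) cs(6,1)]
            scalar_prod_minus_distrib[OF cs(1) cs'(4,5)] by (simp add: b_def q_def u_def)
        moreover have "w s \<bullet> (transpose_mat AK *\<^sub>v r s + b) = w s \<bullet> (transpose_mat AK *\<^sub>v r s) + w s \<bullet> b"
          by (rule scalar_prod_add_distrib) (use cs cs' in auto)
        moreover have "(- a) \<bullet> r s = - (a \<bullet> r s)" using cs cs' by simp
        ultimately show ?thesis by simp
      qed
      have e2: "(Cq *\<^sub>v (- a)) \<bullet> z s + q s \<bullet> d = u s \<bullet> (H *\<^sub>v x s) + q s \<bullet> f s"
      proof -
        have "Cq *\<^sub>v (- a) = - (Cq *\<^sub>v a)" using cs' mats by (intro eq_vecI) auto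
        moreover have "- (Cq *\<^sub>v a) \<bullet> (F *\<^sub>v x s) = - ((Cq *\<^sub>v a) \<bullet> (F *\<^sub>v x s))"
          by (rule scalar_prod_uminus_left) (use cs'(8,9) in \<open>simp only: carrier_vec_def mem_Collect_eq\<close>)
        ultimately have "(Cq *\<^sub>v (- a)) \<bullet> z s = - ((Cq *\<^sub>v a) \<bullet> (F *\<^sub>v x s))"
          using elim(3) s0 by simp
        also have "(Cq *\<^sub>v a) \<bullet> (F *\<^sub>v x s) = (transpose_mat F *\<^sub>v (Cq *\<^sub>v a)) \<bullet> x s"
          by (rule scalar_prod_transpose(1)[OF mats(1) cs'(9) cs(4)])
        also have "transpose_mat F *\<^sub>v (Cq *\<^sub>v a) = transpose_mat A *\<^sub>v q s - transpose_mat H *\<^sub>v u s"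
          using dual[OF Ts] by (simp add: a_def q_def u_def w_def)
        also have "\<dots> \<bullet> x s = q s \<bullet> (A *\<^sub>v x s) - u s \<bullet> (H *\<^sub>v x s)"
          using minus_scalar_prod_distrib[OF cs'(11,12) cs(4)] scalar_prod_transpose(1)[OF mats(2) cs(7,4)]
            scalar_prod_transpose(1)[OF mats(3) cs(8,4)] by simp
        finally show ?thesis
          using scalar_prod_add_distrib[OF cs(7) cs'(6) cs(5)] by (simp add: d_def)
      qed
      have e3: "y s \<bullet> u s = u s \<bullet> (H *\<^sub>v x s) + u s \<bullet> \<eta> s"
        using elim(4) s0 comm_scalar_prod[of "H *\<^sub>v x s + \<eta> s" p "u s"] cs cs'
          scalar_prod_add_distrib[OF cs(8) cs'(7) cs(6)] by simp
      have "(\<phi> has_real_derivative (q s \<bullet> f s - u s \<bullet> \<eta> s) + (- 1) * (u s \<bullet> (H *\<^sub>v x s) + q s \<bullet> f s))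
          (at s within {0..T})"
        unfolding \<phi>_def by (intro DERIV_add DERIV_cmult D1[unfolded e1] D2[unfolded e2])
      then show "(\<phi> has_real_derivative - (y s \<bullet> u s)) (at s within {0..T})"
        using e3 by (simp add: algebra_simps)
    qed
  qed
  from has_integral_derivative_abs_continuous[OF T ac this]
  have "((\<lambda>s. y s \<bullet> u s) has_integral - (\<phi> T - \<phi> 0)) {0..T}"
    using has_integral_neg[of "\<lambda>s. - (y s \<bullet> u s)" "\<phi> T - \<phi> 0"] by simp
  moreover have "set_integrable lebesgue {0..T} (\<lambda>s. y s \<bullet> u s)"
  proof (rule set_integrable_scalar_prod)
    show "square_integrable {0..T} (\<lambda>s. u s $ i)" if "i < p" for i
      unfolding u_def using mats wc wac that
      by (intro square_integrable_mult_mat_vec[OF mats(6)] square_integrable_continuous abs_continuous_on_imp_continuous) auto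
  qed (use uc L2_loc_halflineD[OF y] in auto)
  ultimately have "(LINT s:{0..T}|lebesgue. y s \<bullet> u s) = \<phi> 0 - \<phi> T"
    using set_lebesgue_integral_eq_integral(2) by (metis integral_unique minus_diff_eq)
  moreover have "\<phi> 0 = 0"
    using scalar_prod_transpose(2)[OF mats(5) zc[of 0] wc[of 0]] T by (simp add: \<phi>_def q_def r0)
  ultimately show ?thesis by (simp add: \<phi>_def u_def q_def w_def)
qed

section \<open>Dissipation inequalities\<close>

lemma gronwall_integral:
  fixes V \<beta> :: "real \<Rightarrow> real"
  assumes T: "T \<ge> 0" and ac: "abs_continuous_on {0..T} V" and V: "V T \<ge> 0"
    and D: "AE t in lebesgue. t \<in> {0..T} \<longrightarrow>
      (\<exists>D \<le> - \<alpha> * V t + \<beta> t. (V has_real_derivative D) (at t within {0..T}))"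
    and \<beta>: "(\<beta> has_integral I) {0..T}"
  shows "\<alpha> * integral {0..T} V \<le> V 0 + I"
proof -
  have "V integrable_on {0..T}"
    by (rule integrable_continuous_real[OF abs_continuous_on_imp_continuous[OF ac]])
  then have "((\<lambda>t. - \<alpha> * V t + \<beta> t) has_integral (- \<alpha> * integral {0..T} V + I)) {0..T}"
    by (intro has_integral_add has_integral_mult_right \<beta> integrable_integral)
  from abs_continuous_on_increment_le[OF T ac D this] show ?thesis using V by simp
qed

lemma gronwall_bound:
  fixes V :: "real \<Rightarrow> real"
  assumes T: "T \<ge> 0" and ac: "abs_continuous_on {0..T} V" and \<alpha>: "\<alpha> > 0" and c: "c \<ge> 0"
    and D: "AE t in lebesgue. t \<in> {0..T} \<longrightarrow>
      (\<exists>D \<le> - \<alpha> * V t + c. (V has_real_derivative D) (at t within {0..T}))"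
  shows "V T \<le> exp (- \<alpha> * T) * V 0 + c / \<alpha>"
proof -
  define g where "g t = exp (\<alpha> * t) * V t" for t
  have e': "((\<lambda>t. exp (\<alpha> * t)) has_real_derivative \<alpha> * exp (\<alpha> * t)) (at t within S)" for t S
    by (auto intro!: derivative_eq_intros)
  have acg: "abs_continuous_on {0..T} g"
    unfolding g_def
    by (intro abs_continuous_on_mult ac abs_continuous_on_continuous_derivative[OF e'] continuous_intros)
  have Dg: "AE t in lebesgue. t \<in> {0..T} \<longrightarrow>
      (\<exists>D \<le> c * exp (\<alpha> * t). (g has_real_derivative D) (at t within {0..T}))"
    using D
  proof eventually_elim
    case (elim t)
    show ?case
    proof
      assume "t \<in> {0..T}"
      then obtain D where D: "D \<le> - \<alpha> * V t + c" "(V has_real_derivative D) (at t within {0..T})"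
        using elim by blast
      have "(g has_real_derivative (\<alpha> * exp (\<alpha> * t) * V t + D * exp (\<alpha> * t))) (at t within {0..T})"
        unfolding g_def by (rule DERIV_mult[OF e' D(2)])
      moreover have "D * exp (\<alpha> * t) \<le> (- \<alpha> * V t + c) * exp (\<alpha> * t)"
        using D(1) by (intro mult_right_mono) auto
      then have "\<alpha> * exp (\<alpha> * t) * V t + D * exp (\<alpha> * t) \<le> c * exp (\<alpha> * t)"
        by (simp add: algebra_simps)
      ultimately show "\<exists>D \<le> c * exp (\<alpha> * t). (g has_real_derivative D) (at t within {0..T})" by blast
    qed
  qed
  have "((\<lambda>t. c * exp (\<alpha> * t)) has_integral (c * exp (\<alpha> * T) / \<alpha> - c * exp (\<alpha> * 0) / \<alpha>)) {0..T}"
    using \<alpha> by (intro fundamental_theorem_of_calculus T)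
      (auto intro!: derivative_eq_intros simp flip: has_real_derivative_iff_has_vector_derivative)
  from abs_continuous_on_increment_le[OF T acg Dg this]
  have "exp (\<alpha> * T) * V T - V 0 \<le> c * exp (\<alpha> * T) / \<alpha> - c / \<alpha>" by (simp add: g_def)
  moreover have "c / \<alpha> \<ge> 0" using c \<alpha> by simp
  ultimately have "exp (\<alpha> * T) * V T \<le> V 0 + exp (\<alpha> * T) * (c / \<alpha>)"
    by (simp add: mult.commute)
  then have "exp (- (\<alpha> * T)) * (exp (\<alpha> * T) * V T) \<le> exp (- (\<alpha> * T)) * (V 0 + exp (\<alpha> * T) * (c / \<alpha>))"
    by (intro mult_left_mono) auto
  then show ?thesis
    by (simp add: distrib_left mult.assoc[symmetric] exp_add[symmetric])
qed

text \<open>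
  If \<open>P\<close> is a Lyapunov matrix for \<open>A\<close>, then \<open>P\<^sup>-\<^sup>1\<close> is one for \<open>A\<^sup>T\<close>: the left-hand side is the
  derivative of \<open>r \<bullet> P\<^sup>-\<^sup>1 r\<close> along \<open>r' = A\<^sup>T r + b\<close>.
\<close>

lemma lyapunov_dissipation:
  fixes P A N :: "real mat"
  assumes P: "pos_def_mat l P" and N: "pos_def_mat l N" and A: "A \<in> carrier_mat l l"
    and eq: "\<And>w. w \<in> carrier_vec l \<Longrightarrow> 2 * ((P *\<^sub>v w) \<bullet> (A *\<^sub>v w)) = - (w \<bullet> (N *\<^sub>v w))"
  obtains \<alpha> \<beta> :: real where "\<alpha> > 0" "\<beta> > 0"
    "\<And>r b. r \<in> carrier_vec l \<Longrightarrow> b \<in> carrier_vec l \<Longrightarrow>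
      2 * ((mat_inv P *\<^sub>v r) \<bullet> (transpose_mat A *\<^sub>v r + b)) \<le>
        - \<alpha> * (r \<bullet> (mat_inv P *\<^sub>v r)) + \<beta> * (b \<bullet> b)"
proof -
  have Pc: "P \<in> carrier_mat l l" and Ps: "transpose_mat P = P" using P by (auto simp: pos_def_mat_def)
  note I = pos_def_mat_inv[OF P]
  obtain c where c: "c > 0" "\<And>x. x \<in> carrier_vec l \<Longrightarrow> c * (x \<bullet> x) \<le> x \<bullet> (N *\<^sub>v x)"
    using pos_def_mat_coercive[OF N] by auto
  obtain C where C: "C > 0" "\<And>x. x \<in> carrier_vec l \<Longrightarrow> \<bar>x \<bullet> (P *\<^sub>v x)\<bar> \<le> C * (x \<bullet> x)"
    using quadratic_form_bound[OF Pc] by auto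
  show thesis
  proof (rule that[of "c / (2 * C)" "2 / c"])
    fix r b :: "real vec" assume r: "r \<in> carrier_vec l" and b: "b \<in> carrier_vec l"
    define w where "w = mat_inv P *\<^sub>v r"
    have w: "w \<in> carrier_vec l" using I(1) r by (simp add: w_def)
    have Pw: "P *\<^sub>v w = r" using I Pc r by (simp add: w_def assoc_mult_mat_vec[of _ l l _ l, symmetric])
    have Ar: "transpose_mat A *\<^sub>v r \<in> carrier_vec l" using A r by simp
    have "w \<bullet> (transpose_mat A *\<^sub>v r + b) = w \<bullet> (transpose_mat A *\<^sub>v r) + w \<bullet> b"
      by (rule scalar_prod_add_distrib[OF w Ar b])
    also have "w \<bullet> (transpose_mat A *\<^sub>v r) = (P *\<^sub>v w) \<bullet> (A *\<^sub>v w)"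
      using scalar_prod_transpose(2)[OF A r w] comm_scalar_prod[of "A *\<^sub>v w" l r] A w r by (simp add: Pw)
    finally have "2 * (w \<bullet> (transpose_mat A *\<^sub>v r + b)) = - (w \<bullet> (N *\<^sub>v w)) + 2 * (w \<bullet> b)"
      using eq[OF w] by simp
    also have "\<dots> \<le> - (c / 2) * (w \<bullet> w) + 2 / c * (b \<bullet> b)"
    proof -
      \<comment> \<open>half of the dissipation absorbs the cross term\<close>
      have "2 * (x * y) \<le> c / 2 * (x * x) + 2 / c * (y * y)" for x y :: real
      proof -
        have "0 \<le> (c * x - 2 * y)\<^sup>2 / (2 * c)" using c by simp
        also have "\<dots> = c / 2 * (x * x) + 2 / c * (y * y) - 2 * (x * y)"
          using c by (simp add: power2_eq_square field_simps)
        finally show ?thesis by simp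
      qed
      then have "(\<Sum>i<l. 2 * (w $ i * b $ i)) \<le> (\<Sum>i<l. c / 2 * (w $ i * w $ i) + 2 / c * (b $ i * b $ i))"
        by (intro sum_mono)
      then have "2 * (w \<bullet> b) \<le> c / 2 * (w \<bullet> w) + 2 / c * (b \<bullet> b)"
        using w b by (simp only: scalar_prod_eq_sum[of _ l] sum.distrib sum_distrib_left)
      then show ?thesis using c(2)[OF w] by (simp add: field_simps)
    qed
    also have "- (c / 2) * (w \<bullet> w) \<le> - (c / (2 * C)) * (r \<bullet> w)"
    proof -
      have "r \<bullet> w \<le> C * (w \<bullet> w)"
        using C(2)[OF w] comm_scalar_prod[OF r w] by (simp add: Pw)
      then have "c / (2 * C) * (r \<bullet> w) \<le> c / (2 * C) * (C * (w \<bullet> w))"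
        using c C by (intro mult_left_mono) auto
      then show ?thesis using C by simp
    qed
    finally show "2 * ((mat_inv P *\<^sub>v r) \<bullet> (transpose_mat A *\<^sub>v r + b)) \<le>
        - (c / (2 * C)) * (r \<bullet> (mat_inv P *\<^sub>v r)) + 2 / c * (b \<bullet> b)"
      by (simp add: w_def)
  qed (use c C in auto)
qed

lemma continuous_on_halflineI:
  fixes f :: "real \<Rightarrow> real"
  assumes "\<And>T. continuous_on {0..T} f"
  shows "continuous_on {0..} f"
  unfolding continuous_on_iff
proof (intro ballI allI impI)
  fix x e :: real assume x: "x \<in> {0..}" and e: "e > 0"
  have "x \<in> {0..x + 1}" using x by auto
  then obtain d where "d > 0" "\<forall>x'\<in>{0..x + 1}. dist x' x < d \<longrightarrow> dist (f x') (f x) < e"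
    using assms[of "x + 1"] e unfolding continuous_on_iff by blast
  then show "\<exists>d>0. \<forall>x'\<in>{0..}. dist x' x < d \<longrightarrow> dist (f x') (f x) < e"
    by (intro exI[of _ "min d 1"]) (auto simp: dist_real_def)
qed

lemma square_integrable_halflineI:
  fixes e :: "real \<Rightarrow> real"
  assumes c: "continuous_on {0..} e" and B: "\<And>T. T \<ge> 0 \<Longrightarrow> integral {0..T} (\<lambda>t. (e t)\<^sup>2) \<le> B"
  shows "square_integrable {0..} e"
proof -
  have ci: "(\<lambda>t. (e t)\<^sup>2) integrable_on {0..T}" for T
    by (intro integrable_continuous_real continuous_intros continuous_on_subset[OF c]) auto
  have "(\<lambda>t. indicator {0..} t *\<^sub>R e t) \<in> borel_measurable borel"
    by (intro borel_measurable_continuous_on_indicator c) auto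
  then have meas: "set_borel_measurable lebesgue {0..} e"
    unfolding set_borel_measurable_def by (intro measurable_completion) (simp add: measurable_lborel1)
  define h where "h k t = (if t \<in> {0..real k} then (e t)\<^sup>2 else 0)" for k t
  have hi: "h k integrable_on {0..}" and hI: "integral {0..} (h k) = integral {0..real k} (\<lambda>t. (e t)\<^sup>2)" for k
  proof -
    have "((\<lambda>t. (e t)\<^sup>2) has_integral integral {0..real k} (\<lambda>t. (e t)\<^sup>2)) {0..real k}"
      using ci by blast
    then have "(h k has_integral integral {0..real k} (\<lambda>t. (e t)\<^sup>2)) {0..}"
      unfolding h_def by (subst has_integral_restrict) auto
    then show "h k integrable_on {0..}" "integral {0..} (h k) = integral {0..real k} (\<lambda>t. (e t)\<^sup>2)"
      by (auto simp: integrable_on_def integral_unique)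
  qed
  have "(\<lambda>t. (e t)\<^sup>2) integrable_on {0..}"
  proof (rule monotone_convergence_increasing[THEN conjunct1])
    show "h k integrable_on {0..}" for k by (rule hi)
    show "h k x \<le> h (Suc k) x" for k x by (auto simp: h_def)
    show "(\<lambda>k. h k x) \<longlonglongrightarrow> (e x)\<^sup>2" if "x \<in> {0..}" for x
    proof -
      obtain N where "x \<le> real N" using real_arch_simple by blast
      then have "eventually (\<lambda>k. h k x = (e x)\<^sup>2) sequentially"
        using that by (intro eventually_sequentiallyI[of N]) (auto simp: h_def)
      then show ?thesis by (rule tendsto_eventually)
    qed
    have "\<bar>integral {0..} (h k)\<bar> \<le> B" for k
    proof -
      have "integral {0..real k} (\<lambda>t. (e t)\<^sup>2) \<ge> 0" using ci by (intro integral_nonneg) auto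
      then show ?thesis using B[of "real k"] by (simp add: hI)
    qed
    then show "bounded (range (\<lambda>k. integral {0..} (h k)))"
      unfolding bounded_iff by auto
  qed
  then have "set_integrable lebesgue {0..} (\<lambda>t. (e t)\<^sup>2)"
    by (intro nonnegative_absolutely_integrable_1) auto
  then show ?thesis using meas by (simp add: square_integrable_def)
qed

text \<open>
  Consequences of \<open>V' \<le> - \<alpha> V + \<beta> g\<close> for a quantity \<open>e\<close> whose square is bounded by a multiple of \<open>V\<close>.
\<close>

lemma dissipative_estimates:
  fixes e V g :: "real \<Rightarrow> real"
  assumes \<alpha>: "\<alpha> > 0" and \<beta>: "\<beta> \<ge> 0" and \<gamma>: "\<gamma> \<ge> 0"
    and ac: "\<And>T. abs_continuous_on {0..T} V" and V: "\<And>t. t \<ge> 0 \<Longrightarrow> V t \<ge> 0"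
    and D: "AE t in lebesgue. t \<in> {0..} \<longrightarrow>
      (\<exists>D \<le> - \<alpha> * V t + \<beta> * g t. (V has_real_derivative D) (at t within {0..}))"
    and e: "\<And>t. t \<ge> 0 \<Longrightarrow> (e t)\<^sup>2 \<le> \<gamma> * V t"
  shows "(AE t in lebesgue. t \<in> {0..} \<longrightarrow> g t = 0) \<Longrightarrow> (e \<longlongrightarrow> 0) at_top"
    and "(AE t in lebesgue. t \<in> {0..} \<longrightarrow> g t \<le> c) \<Longrightarrow> bdd_above ((\<lambda>t. (e t)\<^sup>2) ` {0<..})"
    and "continuous_on {0..} e \<Longrightarrow> set_integrable lebesgue {0..} g \<Longrightarrow> (\<And>t. t \<ge> 0 \<Longrightarrow> g t \<ge> 0) \<Longrightarrow>
      square_integrable {0..} e"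
proof -
  have sub: "(V has_real_derivative D) (at t within {0..T})"
    if "(V has_real_derivative D) (at t within {0..})" for D t T
    by (rule has_field_derivative_subset[OF that]) auto
  have bound: "V T \<le> exp (- \<alpha> * T) * V 0 + \<beta> * c / \<alpha>"
    if g: "AE t in lebesgue. t \<in> {0..} \<longrightarrow> g t \<le> c" and c: "c \<ge> 0" and T: "T \<ge> 0" for c T
  proof (rule gronwall_bound[OF T ac \<alpha>])
    show "\<beta> * c \<ge> 0" using \<beta> c by simp
    show "AE t in lebesgue. t \<in> {0..T} \<longrightarrow>
        (\<exists>D \<le> - \<alpha> * V t + \<beta> * c. (V has_real_derivative D) (at t within {0..T}))"
      using D g
    proof eventually_elim
      case (elim t)
      show ?case
      proof
        assume t: "t \<in> {0..T}"
        then obtain D where D: "D \<le> - \<alpha> * V t + \<beta> * g t" "(V has_real_derivative D) (at t within {0..})"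
          using elim by auto
        moreover have "\<beta> * g t \<le> \<beta> * c" using \<beta> elim t by (intro mult_left_mono) auto
        ultimately show "\<exists>D \<le> - \<alpha> * V t + \<beta> * c. (V has_real_derivative D) (at t within {0..T})"
          by (intro exI[of _ D]) (auto intro: sub)
      qed
    qed
  qed
  {
    assume g: "AE t in lebesgue. t \<in> {0..} \<longrightarrow> g t = 0"
    have "AE t in lebesgue. t \<in> {0..} \<longrightarrow> g t \<le> 0" using g by eventually_elim auto
    from bound[OF this] have b: "V T \<le> exp (- \<alpha> * T) * V 0" if "T \<ge> 0" for T using that by simp
    have "((\<lambda>t. \<gamma> * (exp (- \<alpha> * t) * V 0)) \<longlongrightarrow> \<gamma> * (0 * V 0)) at_top"
      by (intro tendsto_intros filterlim_compose[OF exp_at_bot] filterlim_tendsto_neg_mult_at_bot[OF tendsto_const] filterlim_ident)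
         (use \<alpha> in auto)
    then have lim: "((\<lambda>t. \<gamma> * (exp (- \<alpha> * t) * V 0)) \<longlongrightarrow> 0) at_top" by simp
    have "((\<lambda>t. (e t)\<^sup>2) \<longlongrightarrow> 0) at_top"
    proof (rule tendsto_sandwich[OF _ _ tendsto_const lim])
      show "\<forall>\<^sub>F t in at_top. (e t)\<^sup>2 \<le> \<gamma> * (exp (- \<alpha> * t) * V 0)"
        using eventually_ge_at_top[of "0 :: real"]
      proof eventually_elim
        case (elim t)
        show ?case using e[OF elim] mult_left_mono[OF b[OF elim] \<gamma>] by linarith
      qed
    qed auto
    then have "((\<lambda>t. sqrt ((e t)\<^sup>2)) \<longlongrightarrow> sqrt 0) at_top" by (rule tendsto_real_sqrt)
    then show "(e \<longlongrightarrow> 0) at_top" by (simp add: tendsto_rabs_zero_iff)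
  }
  {
    assume g: "AE t in lebesgue. t \<in> {0..} \<longrightarrow> g t \<le> c"
    have "AE t in lebesgue. t \<in> {0..} \<longrightarrow> g t \<le> \<bar>c\<bar>" using g by eventually_elim auto
    from bound[OF this] have b: "V T \<le> exp (- \<alpha> * T) * V 0 + \<beta> * \<bar>c\<bar> / \<alpha>" if "T \<ge> 0" for T using that by simp
    have "(e t)\<^sup>2 \<le> \<gamma> * (V 0 + \<beta> * \<bar>c\<bar> / \<alpha>)" if t: "t > 0" for t
    proof -
      have "exp (- \<alpha> * t) * V 0 \<le> 1 * V 0" using V[of 0] \<alpha> t by (intro mult_right_mono) auto
      then have "V t \<le> V 0 + \<beta> * \<bar>c\<bar> / \<alpha>" using b[of t] t by simp
      from mult_left_mono[OF this \<gamma>] show ?thesis using e[of t] t by simp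
    qed
    then show "bdd_above ((\<lambda>t. (e t)\<^sup>2) ` {0<..})" by (intro bdd_aboveI2) auto
  }
  {
    assume c: "continuous_on {0..} e" and gi: "set_integrable lebesgue {0..} g"
      and g0: "\<And>t. t \<ge> 0 \<Longrightarrow> g t \<ge> 0"
    define G where "G = integral {0..} g"
    show "square_integrable {0..} e"
    proof (rule square_integrable_halflineI[OF c])
      fix T :: real assume T: "T \<ge> 0"
      have giT: "g integrable_on {0..T}"
        by (rule set_lebesgue_integral_eq_integral(1)[OF set_integrable_subset[OF gi]]) auto
      have GT: "integral {0..T} g \<le> G"
        unfolding G_def using giT set_lebesgue_integral_eq_integral(1)[OF gi] g0
        by (intro integral_subset_le) auto
      have "\<alpha> * integral {0..T} V \<le> V 0 + \<beta> * integral {0..T} g"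
      proof (rule gronwall_integral[OF T ac V[OF T]])
        show "((\<lambda>t. \<beta> * g t) has_integral \<beta> * integral {0..T} g) {0..T}"
          using giT by (intro has_integral_mult_right) blast
        show "AE t in lebesgue. t \<in> {0..T} \<longrightarrow>
            (\<exists>D \<le> - \<alpha> * V t + \<beta> * g t. (V has_real_derivative D) (at t within {0..T}))"
          using D
        proof eventually_elim
          case (elim t)
          then show ?case using sub by (meson atLeastAtMost_iff atLeast_iff)
        qed
      qed
      also have "\<dots> \<le> V 0 + \<beta> * G" using GT \<beta> by (intro add_left_mono mult_left_mono)
      finally have IV: "integral {0..T} V \<le> (V 0 + \<beta> * G) / \<alpha>" using \<alpha> by (simp add: field_simps)
      have Vi: "V integrable_on {0..T}"
        by (rule integrable_continuous_real[OF abs_continuous_on_imp_continuous[OF ac]])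
      have "integral {0..T} (\<lambda>t. (e t)\<^sup>2) \<le> integral {0..T} (\<lambda>t. \<gamma> * V t)"
      proof (rule integral_le)
        show "(\<lambda>t. (e t)\<^sup>2) integrable_on {0..T}"
          by (intro integrable_continuous_real continuous_intros continuous_on_subset[OF c]) auto
        show "(\<lambda>t. \<gamma> * V t) integrable_on {0..T}" using Vi by (rule integrable_on_mult_right)
      qed (use e in auto)
      also have "\<dots> = \<gamma> * integral {0..T} V" by simp
      also have "\<dots> \<le> \<gamma> * ((V 0 + \<beta> * G) / \<alpha>)" by (rule mult_left_mono[OF IV \<gamma>])
      finally show "integral {0..T} (\<lambda>t. (e t)\<^sup>2) \<le> \<gamma> * ((V 0 + \<beta> * G) / \<alpha>)" .
    qed
  }
qed

section \<open>Solutions of the DAE and of its dual\<close>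

lemma ac_mult_is_ac_version:
  assumes "\<exists>z. is_ac_version I (dim_row M) (\<lambda>t. M *\<^sub>v x t) z"
  shows "is_ac_version I (dim_row M) (\<lambda>t. M *\<^sub>v x t) (ac_mult I M x)"
  using someI_ex[OF assms] by (simp add: ac_mult_def ac_version_def)

lemma AC_eq_of_AE_eq:
  assumes "z \<in> AC {0..} n" "h \<in> AC {0..} n" "AE t in lebesgue. t \<in> {0..} \<longrightarrow> z t = h t" "t \<ge> 0"
  shows "z t = h t"
proof (rule eq_vecI)
  show "dim_vec (z t) = dim_vec (h t)"
    using AC_halflineD(1)[OF assms(1,4)] AC_halflineD(1)[OF assms(2,4)] by auto
  fix i assume "i < dim_vec (h t)"
  then have i: "i < n" using AC_halflineD(1)[OF assms(2,4)] by auto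
  show "z t $ i = h t $ i"
  proof (rule AE_eq_imp_eq_on_halfline[where a = 0 and f = "\<lambda>t. z t $ i" and g = "\<lambda>t. h t $ i"])
    show "AE t in lebesgue. t \<in> {0..} \<longrightarrow> z t $ i = h t $ i"
      using assms(3) by eventually_elim auto
  qed (use AC_halflineD(2)[OF assms(1) i] AC_halflineD(2)[OF assms(2) i] assms(4) in \<open>auto intro: abs_continuous_on_imp_continuous\<close>)
qed

lemma mult_mat_vec_AC:
  assumes "M \<in> carrier_mat r c" "x \<in> AC {0..} c"
  shows "(\<lambda>t. M *\<^sub>v x t) \<in> AC {0..} r"
  by (rule AC_halflineI) (use assms AC_halflineD[OF assms(2)] in \<open>auto intro!: abs_continuous_on_mult_mat_vec simp del: index_mult_mat_vec\<close>)

lemma vec_integral_index: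
  assumes "i < n" "set_integrable lebesgue {0..t} (\<lambda>s. g s $ i)"
  shows "vec_integral n t g $ i = integral {0..t} (\<lambda>s. g s $ i)"
  using assms by (simp add: vec_integral_def set_lebesgue_integral_eq_integral(2))

text \<open>
  By Lebesgue's differentiation theorem, the integral form of the DAE implies the differential one
  almost everywhere.
\<close>

lemma dae_solution_derivative:
  assumes F: "F \<in> carrier_mat m n" and A: "A \<in> carrier_mat m n"
    and sol: "dae_solution {0..} F A H x f y \<eta>"
  shows "ac_mult {0..} F x \<in> AC {0..} m"
    and "AE t in lebesgue. t \<in> {0..} \<longrightarrow> ac_mult {0..} F x t = F *\<^sub>v x t"
    and "AE t in lebesgue. t \<in> {0..} \<longrightarrow> (\<forall>i<m. ((\<lambda>s. ac_mult {0..} F x s $ i) has_real_derivative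
      (A *\<^sub>v x t + f t) $ i) (at t within {0..}))"
proof -
  define z where "z = ac_mult {0..} F x"
  have dims: "dim_row F = m" "dim_col F = n" using F by auto
  have x: "x \<in> L2_loc {0..} n" and f: "f \<in> L2_loc {0..} m"
    and ver: "is_ac_version {0..} m (\<lambda>t. F *\<^sub>v x t) z"
    and eq: "\<And>t. t \<ge> 0 \<Longrightarrow> z t = z 0 + vec_integral m t (\<lambda>s. A *\<^sub>v x s + f s)"
    using sol ac_mult_is_ac_version[of "{0..}" F x] unfolding dae_solution_def dims z_def atLeast_iff by blast+
  show z: "ac_mult {0..} F x \<in> AC {0..} m"
    and "AE t in lebesgue. t \<in> {0..} \<longrightarrow> ac_mult {0..} F x t = F *\<^sub>v x t"
    using ver by (auto simp: is_ac_version_def z_def)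
  define d where "d i s = (A *\<^sub>v x s + f s) $ i" for i s
  have di: "set_integrable lebesgue {0..T} (d i)" if i: "i < m" for i T
  proof (rule square_integrable_imp_integrable, rule square_integrable_cong)
    show "square_integrable {0..T} (\<lambda>s. (A *\<^sub>v x s) $ i + f s $ i)"
      using L2_loc_halflineD[OF x] L2_loc_halflineD[OF f] A i
      by (intro square_integrable_add square_integrable_mult_mat_vec[OF A]) auto
    show "(A *\<^sub>v x s) $ i + f s $ i = d i s" if "s \<in> {0..T}" for s
      using i that L2_loc_halflineD(1)[OF f, of s] A by (simp add: d_def)
  qed
  have zi: "z t $ i = z 0 $ i + integral {0..t} (d i)" if "t \<ge> 0" "i < m" for t i
  proof -
    have "vec_integral m t (\<lambda>s. A *\<^sub>v x s + f s) $ i = integral {0..t} (d i)"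
      using vec_integral_index[of i m t "\<lambda>s. A *\<^sub>v x s + f s"] di[OF that(2), of t] that by (simp add: d_def[abs_def])
    moreover have "dim_vec (vec_integral m t (\<lambda>s. A *\<^sub>v x s + f s)) = m" by (simp add: vec_integral_def)
    ultimately show ?thesis unfolding eq[OF that(1)] using that(2) by simp
  qed
  have "AE t in lebesgue. \<forall>i\<in>{..<m}. t \<in> {0..} \<longrightarrow> ((\<lambda>s. z s $ i) has_real_derivative d i t) (at t within {0..})"
  proof (rule AE_ball_finite)
    fix i assume "i \<in> {..<m}"
    then have i: "i < m" by simp
    have "d i integrable_on {0..T}" for T by (rule set_lebesgue_integral_eq_integral(1)[OF di[OF i]])
    from AE_has_derivative_indefinite_integral[OF this]
    show "AE t in lebesgue. t \<in> {0..} \<longrightarrow> ((\<lambda>s. z s $ i) has_real_derivative d i t) (at t within {0..})"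
    proof (rule eventually_mono, intro impI)
      fix t :: real
      assume *: "t \<in> {0..} \<longrightarrow> ((\<lambda>t. integral {0..t} (d i)) has_real_derivative d i t) (at t within {0..})"
        and t: "t \<in> {0..}"
      have "((\<lambda>s. z 0 $ i + integral {0..s} (d i)) has_real_derivative d i t) (at t within {0..})"
        using DERIV_add[OF DERIV_const *[rule_format, OF t]] by simp
      then show "((\<lambda>s. z s $ i) has_real_derivative d i t) (at t within {0..})"
        by (rule has_field_derivative_transform_within[where d = 1]) (use t zi[symmetric] i in auto)
    qed
  qed simp
  then show "AE t in lebesgue. t \<in> {0..} \<longrightarrow> (\<forall>i<m. ((\<lambda>s. ac_mult {0..} F x s $ i) has_real_derivative
      (A *\<^sub>v x t + f t) $ i) (at t within {0..}))"
    by eventually_elim (auto simp: z_def d_def)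
qed

text \<open>
  For continuous \<open>q\<close> and \<open>u\<close> the integrand of the dual DAE is continuous, so that the equation holds at
  every positive time.
\<close>

lemma dual_solution_continuous_derivative:
  assumes F: "F \<in> carrier_mat m n" and A: "A \<in> carrier_mat m n" and H: "H \<in> carrier_mat p n"
    and sol: "dual_solution {0..} F A H q u"
    and q: "q \<in> AC {0..} m" and u: "u \<in> AC {0..} p"
    and t: "t > 0" and i: "i < n"
    and d: "((\<lambda>s. (transpose_mat F *\<^sub>v q s) $ i) has_real_derivative d) (at t within {0..})"
  shows "d = (transpose_mat A *\<^sub>v q t - transpose_mat H *\<^sub>v u t) $ i"
proof -
  define w where "w = ac_mult {0..} (transpose_mat F) q"
  have dims: "dim_col F = n" "dim_row (transpose_mat F) = n" using F by auto
  have ver: "is_ac_version {0..} n (\<lambda>t. transpose_mat F *\<^sub>v q t) w"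
    and eq: "\<And>t. t \<ge> 0 \<Longrightarrow> w t = w 0 + vec_integral n t (\<lambda>s. transpose_mat A *\<^sub>v q s - transpose_mat H *\<^sub>v u s)"
    using sol ac_mult_is_ac_version[of "{0..}" "transpose_mat F" q] unfolding dual_solution_def dims w_def atLeast_iff by blast+
  have Fq: "w s = transpose_mat F *\<^sub>v q s" if "s \<ge> 0" for s
  proof (rule AC_eq_of_AE_eq[OF _ _ _ that])
    show "(\<lambda>t. transpose_mat F *\<^sub>v q t) \<in> AC {0..} n"
      using F q by (intro mult_mat_vec_AC) auto
  qed (use ver in \<open>auto simp: is_ac_version_def\<close>)
  define c where "c s = (transpose_mat A *\<^sub>v q s - transpose_mat H *\<^sub>v u s) $ i" for s
  have cc: "continuous_on {0..T} c" for T
  proof -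
    have "continuous_on {0..T} (\<lambda>s. (transpose_mat A *\<^sub>v q s) $ i - (transpose_mat H *\<^sub>v u s) $ i)"
      using AC_halflineD[OF mult_mat_vec_AC[OF _ q, of "transpose_mat A" n]] AC_halflineD[OF mult_mat_vec_AC[OF _ u, of "transpose_mat H" n]] A H i
      by (intro continuous_on_diff abs_continuous_on_imp_continuous) auto
    then show ?thesis
      by (rule continuous_on_eq) (use H i in \<open>simp add: c_def\<close>)
  qed
  have wi: "w s $ i = w 0 $ i + integral {0..s} c" if "s \<ge> 0" for s
  proof -
    have "set_integrable lebesgue {0..s} c" by (rule absolutely_integrable_continuous_real[OF cc])
    then have "vec_integral n s (\<lambda>s. transpose_mat A *\<^sub>v q s - transpose_mat H *\<^sub>v u s) $ i = integral {0..s} c"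
      using vec_integral_index[OF i, of s] by (simp add: c_def[abs_def])
    moreover have "dim_vec (vec_integral n s (\<lambda>s. transpose_mat A *\<^sub>v q s - transpose_mat H *\<^sub>v u s)) = n"
      by (simp add: vec_integral_def)
    ultimately show ?thesis unfolding eq[OF that] using i by simp
  qed
  have Fqi: "w 0 $ i + integral {0..s} c = (transpose_mat F *\<^sub>v q s) $ i" if "s \<ge> 0" for s
    using wi[OF that] Fq[OF that] by simp
  have sub: "{0..t + 1} \<subseteq> {0..}" by auto
  have "((\<lambda>s. integral {0..s} c) has_real_derivative c t) (at t within {0..t + 1})"
    using integral_has_real_derivative[OF cc, of t] t by simp
  from DERIV_add[OF DERIV_const this]
  have "((\<lambda>s. w 0 $ i + integral {0..s} c) has_real_derivative c t) (at t within {0..t + 1})" by simp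
  then have c: "((\<lambda>s. (transpose_mat F *\<^sub>v q s) $ i) has_real_derivative c t) (at t within {0..t + 1})"
    by (rule has_field_derivative_transform_within[where d = 1]) (use t Fqi in auto)
  have at: "at t within {0..t + 1} = at t" "at t within {0..} = at t"
    by (rule at_within_interior, use t in simp)+
  have "d = c t" by (rule DERIV_unique[OF d[unfolded at(2)] c[unfolded at(1)]])
  then show ?thesis by (simp only: c_def)
qed

lemma associated_ltiD:
  assumes assoc: "associated_lti F A H nh k Aa Ba Ca Da"
    and F: "F \<in> carrier_mat m n" and H: "H \<in> carrier_mat p n"
  shows "nh > 0" "k > 0" "Aa \<in> carrier_mat nh nh" "Ba \<in> carrier_mat nh k"
    "Ca \<in> carrier_mat (m + p) nh" "Da \<in> carrier_mat (m + p) k"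
    "transpose_mat F * top_rows m Da = 0\<^sub>m n k"
    "vec_space.rank n (transpose_mat F * top_rows m Ca) = nh"
    "\<And>q u. (\<And>t. t \<ge> 0 \<Longrightarrow> q t \<in> carrier_vec m) \<Longrightarrow> (\<And>t. t \<ge> 0 \<Longrightarrow> u t \<in> carrier_vec p) \<Longrightarrow>
      dual_solution {0..} F A H q u \<longleftrightarrow>
         (\<exists>v g. lti_trajectory {0..} Aa Ba v g \<and>
            (AE t in lebesgue. t \<in> {0..} \<longrightarrow> q t @\<^sub>v u t = Ca *\<^sub>v v t + Da *\<^sub>v g t))"
proof -
  have dims: "dim_row F = m" "dim_col F = n" "dim_row H = p" using F H by auto
  have a: "\<And>I q u. time_interval I \<and> (\<forall>t\<in>I. q t \<in> carrier_vec m \<and> u t \<in> carrier_vec p) \<longrightarrow>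
        (dual_solution I F A H q u \<longleftrightarrow>
         (\<exists>v g. lti_trajectory I Aa Ba v g \<and>
            (AE t in lebesgue. t \<in> I \<longrightarrow> q t @\<^sub>v u t = Ca *\<^sub>v v t + Da *\<^sub>v g t)))"
    using assoc unfolding associated_lti_def Let_def dims by blast
  have ti: "time_interval {0..}" by (simp add: time_interval_def)
  show "dual_solution {0..} F A H q u \<longleftrightarrow>
         (\<exists>v g. lti_trajectory {0..} Aa Ba v g \<and>
            (AE t in lebesgue. t \<in> {0..} \<longrightarrow> q t @\<^sub>v u t = Ca *\<^sub>v v t + Da *\<^sub>v g t))"
    if "\<And>t. t \<ge> 0 \<Longrightarrow> q t \<in> carrier_vec m" "\<And>t. t \<ge> 0 \<Longrightarrow> u t \<in> carrier_vec p" for q u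
    using a[of "{0..}" q u] ti that by auto
  show "nh > 0" "k > 0" "Aa \<in> carrier_mat nh nh" "Ba \<in> carrier_mat nh k"
    "Ca \<in> carrier_mat (m + p) nh" "Da \<in> carrier_mat (m + p) k"
    "transpose_mat F * top_rows m Da = 0\<^sub>m n k"
    "vec_space.rank n (transpose_mat F * top_rows m Ca) = nh"
    using assoc unfolding associated_lti_def Let_def dims by blast+
qed

text \<open>
  Since \<open>F\<^sup>T D\<^sub>s = 0\<close>, the value \<open>F\<^sup>T q\<close> depends on the state of the associated system only.
\<close>

lemma state_output_eq:
  assumes assoc: "associated_lti F A H nh k Aa Ba Ca Da"
    and F: "F \<in> carrier_mat m n" and H: "H \<in> carrier_mat p n"
    and v: "v \<in> carrier_vec nh" and g: "g \<in> carrier_vec k" and q: "q \<in> carrier_vec m"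
    and eq: "q @\<^sub>v u = Ca *\<^sub>v v + Da *\<^sub>v g"
  shows "transpose_mat F *\<^sub>v q = (transpose_mat F * top_rows m Ca) *\<^sub>v v"
proof -
  note a = associated_ltiD[OF assoc F H]
  have c: "top_rows m Ca \<in> carrier_mat m nh" "top_rows m Da \<in> carrier_mat m k"
    using a by (auto intro: top_rows_carrier)
  have "q = vec_first (Ca *\<^sub>v v + Da *\<^sub>v g) m" using vec_first_append[OF q] eq by metis
  also have "\<dots> = vec_first (Ca *\<^sub>v v) m + vec_first (Da *\<^sub>v g) m"
    using a v g by (intro eq_vecI) (auto simp: vec_first_def)
  also have "\<dots> = top_rows m Ca *\<^sub>v v + top_rows m Da *\<^sub>v g"
    using a v g by (simp add: top_rows_mult_vec)
  finally have "transpose_mat F *\<^sub>v q = transpose_mat F *\<^sub>v (top_rows m Ca *\<^sub>v v) + transpose_mat F *\<^sub>v (top_rows m Da *\<^sub>v g)"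
    using c v g F by (simp add: mult_add_distrib_mat_vec[of _ n m])
  also have "transpose_mat F *\<^sub>v (top_rows m Da *\<^sub>v g) = 0\<^sub>v n"
    using assoc_mult_mat_vec[of "transpose_mat F" n m "top_rows m Da" k g] c F g a(7) by (simp add: zero_mat_mult_vec)
  also have "transpose_mat F *\<^sub>v (top_rows m Ca *\<^sub>v v) = (transpose_mat F * top_rows m Ca) *\<^sub>v v"
    using assoc_mult_mat_vec[of "transpose_mat F" n m "top_rows m Ca" nh v] c F v by simp
  moreover have "(transpose_mat F * top_rows m Ca) *\<^sub>v v \<in> carrier_vec n" using c F v by auto
  ultimately show ?thesis by simp
qed

text \<open>
  A dual solution with \<open>F\<^sup>T q \<rightarrow> 0\<close> comes from a trajectory \<open>v\<close> of the associated system with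
  \<open>F\<^sup>T q = M0 v\<close>, where \<open>M0 = F\<^sup>T C\<^sub>s\<close>. As the state map is a left inverse of \<open>M0\<close>, also \<open>v \<rightarrow> 0\<close>, and the
  initial state \<open>v(0)\<close> is stabilizable.
\<close>

lemma detectable_initial_state:
  assumes assoc: "associated_lti F A H nh k Aa Ba Ca Da"
    and F: "F \<in> carrier_mat m n" and H: "H \<in> carrier_mat p n"
    and det: "detectable F A H ell" and ell: "ell \<in> carrier_vec m"
  shows "state_map F Ca *\<^sub>v (transpose_mat F *\<^sub>v ell) \<in> stabilizability_subspace Aa Ba"
    and "(transpose_mat F * top_rows m Ca) *\<^sub>v (state_map F Ca *\<^sub>v (transpose_mat F *\<^sub>v ell)) =
      transpose_mat F *\<^sub>v ell"
proof -
  note a = associated_ltiD[OF assoc F H]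
  have dims: "dim_row F = m" "dim_col F = n" "dim_row H = p" using F H by auto
  define M0 where "M0 = transpose_mat F * top_rows m Ca"
  have M0: "M0 \<in> carrier_mat n nh" using F a(5) by (auto simp: M0_def top_rows_def)
  have sm: "state_map F Ca = pseudoinverse M0" by (simp add: state_map_def M0_def dims)
  have inj: "v = 0\<^sub>v nh" if "v \<in> carrier_vec nh" "M0 *\<^sub>v v = 0\<^sub>v n" for v
    by (rule full_column_rank_injective[OF M0 _ that]) (use a(8) in \<open>simp add: M0_def\<close>)
  define M where "M = state_map F Ca"
  have M: "M \<in> carrier_mat nh n" "M * M0 = 1\<^sub>m nh"
    using pseudoinverse_left_inverse[OF M0 inj] by (auto simp: sm M_def)
  obtain q u where sol: "dual_solution {0..} F A H q u"
    and init: "ac_mult {0..} (transpose_mat F) q 0 = transpose_mat F *\<^sub>v ell"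
    and lim: "\<And>i. i < n \<Longrightarrow> ((\<lambda>t. ac_mult {0..} (transpose_mat F) q t $ i) \<longlongrightarrow> 0) at_top"
    using det unfolding detectable_def dims by blast
  have qu: "q \<in> L2_loc {0..} m" "u \<in> L2_loc {0..} p"
    and ex': "\<exists>z. is_ac_version {0..} n (\<lambda>t. transpose_mat F *\<^sub>v q t) z"
    using sol unfolding dual_solution_def dims by blast+
  have ex: "\<exists>z. is_ac_version {0..} (dim_row (transpose_mat F)) (\<lambda>t. transpose_mat F *\<^sub>v q t) z"
    using ex' F by simp
  define w where "w = ac_mult {0..} (transpose_mat F) q"
  have w: "w \<in> AC {0..} n" "AE t in lebesgue. t \<in> {0..} \<longrightarrow> w t = transpose_mat F *\<^sub>v q t"
    using ac_mult_is_ac_version[OF ex] dims by (auto simp: is_ac_version_def w_def)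
  obtain v g where traj: "lti_trajectory {0..} Aa Ba v g"
    and out: "AE t in lebesgue. t \<in> {0..} \<longrightarrow> q t @\<^sub>v u t = Ca *\<^sub>v v t + Da *\<^sub>v g t"
    using iffD1[OF a(9)[OF L2_loc_halflineD(1)[OF qu(1)] L2_loc_halflineD(1)[OF qu(2)]] sol] by blast
  have v: "v \<in> AC {0..} nh" and g: "g \<in> L2_loc {0..} k"
    using traj a by (auto simp: lti_trajectory_def)
  have wv: "w t = M0 *\<^sub>v v t" if "t \<ge> 0" for t
  proof (rule AC_eq_of_AE_eq[OF w(1) mult_mat_vec_AC[OF M0 v] _ that])
    show "AE t in lebesgue. t \<in> {0..} \<longrightarrow> w t = M0 *\<^sub>v v t"
      using w(2) out
    proof eventually_elim
      case (elim t)
      show ?case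
      proof
        assume t: "t \<in> {0..}"
        then show "w t = M0 *\<^sub>v v t"
          using elim state_output_eq[OF assoc F H, of "v t" "g t" "q t" "u t"]
            AC_halflineD(1)[OF v, of t] L2_loc_halflineD(1)[OF g, of t] L2_loc_halflineD(1)[OF qu(1), of t] by (simp add: M0_def)
      qed
    qed
  qed
  have vw: "v t = M *\<^sub>v w t" if t: "t \<ge> 0" for t
  proof -
    have "M *\<^sub>v w t = (M * M0) *\<^sub>v v t"
      unfolding wv[OF t] using M(1) M0 AC_halflineD(1)[OF v t] by (rule assoc_mult_mat_vec[symmetric])
    then show ?thesis using M(2) AC_halflineD(1)[OF v t] by simp
  qed
  have v0: "v 0 = M *\<^sub>v (transpose_mat F *\<^sub>v ell)" using vw[of 0] init by (simp add: w_def)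
  have "((\<lambda>t. v t $ i) \<longlongrightarrow> 0) at_top" if i: "i < nh" for i
  proof -
    have "((\<lambda>t. \<Sum>j<n. M $$ (i, j) * w t $ j) \<longlongrightarrow> (\<Sum>j<n. M $$ (i, j) * 0)) at_top"
      using lim by (intro tendsto_sum tendsto_mult tendsto_const) (auto simp: w_def)
    then have "((\<lambda>t. \<Sum>j<n. M $$ (i, j) * w t $ j) \<longlongrightarrow> 0) at_top" by simp
    moreover have "\<forall>\<^sub>F t in at_top. (\<Sum>j<n. M $$ (i, j) * w t $ j) = v t $ i"
      using eventually_ge_at_top[of "0 :: real"]
    proof eventually_elim
      case (elim t)
      show ?case using vw[OF elim] index_mult_mat_vec_sum[OF M(1) AC_halflineD(1)[OF w(1) elim] i] by simp
    qed
    ultimately show ?thesis by (rule Lim_transform_eventually)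
  qed
  then have "\<forall>i<dim_row Aa. ((\<lambda>t. v t $ i) \<longlongrightarrow> 0) at_top" using a(3) by simp
  then have "v 0 \<in> stabilizability_subspace Aa Ba"
    unfolding stabilizability_subspace_def using traj AC_halflineD(1)[OF v, of 0] a(3) by blast
  then show "state_map F Ca *\<^sub>v (transpose_mat F *\<^sub>v ell) \<in> stabilizability_subspace Aa Ba"
    by (simp only: v0 M_def)
  show "(transpose_mat F * top_rows m Ca) *\<^sub>v (state_map F Ca *\<^sub>v (transpose_mat F *\<^sub>v ell)) =
      transpose_mat F *\<^sub>v ell"
    using wv[of 0] init v0 by (simp add: w_def M0_def M_def)
qed

section \<open>The closed loop\<close>

lemma linear_ode_solution_AC:
  assumes A: "A \<in> carrier_mat l l" and v: "\<And>t. t \<ge> 0 \<Longrightarrow> v t \<in> carrier_vec l"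
    and v': "\<And>t i. t \<ge> 0 \<Longrightarrow> i < l \<Longrightarrow>
      ((\<lambda>s. v s $ i) has_real_derivative (A *\<^sub>v v t) $ i) (at t within {0..})"
  shows "v \<in> AC {0..} l"
proof (rule AC_halflineI[OF v])
  fix i and b :: real assume i: "i < l"
  have D: "((\<lambda>s. v s $ j) has_real_derivative (A *\<^sub>v v t) $ j) (at t within {0..b})"
    if "t \<in> {0..b}" "j < l" for t j
    by (rule has_field_derivative_subset[OF v']) (use that in auto)
  have "continuous_on {0..b} (\<lambda>t. \<Sum>j<l. A $$ (i, j) * v t $ j)"
    using DERIV_continuous_on[OF D] by (intro continuous_intros) auto
  then have c: "continuous_on {0..b} (\<lambda>t. (A *\<^sub>v v t) $ i)"
    by (rule continuous_on_eq) (use index_mult_mat_vec_sum[OF A v i] in auto)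
  show "abs_continuous_on {0..b} (\<lambda>t. v t $ i)"
    by (rule abs_continuous_on_continuous_derivative[OF D[OF _ i] c])
qed

lemma AC_imp_L2_loc: "g \<in> AC {0..} n \<Longrightarrow> g \<in> L2_loc {0..} n"
  by (rule L2_loc_halflineI)
     (auto simp: AC_def intro!: square_integrable_continuous abs_continuous_on_imp_continuous)

lemma vec_eq_by_scalar_prod:
  fixes x y :: "real vec"
  assumes "x \<in> carrier_vec n" "y \<in> carrier_vec n" "\<And>w. w \<in> carrier_vec n \<Longrightarrow> w \<bullet> x = w \<bullet> y"
  shows "x = y"
proof (rule eq_vecI)
  fix i assume "i < dim_vec y"
  then have "i < n" using assms(2) by auto
  then show "x $ i = y $ i" using assms(3)[of "unit_vec n i"] assms(1,2) by simp
qed (use assms in auto)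

lemma mult_vec_top_bottom:
  assumes "W \<in> carrier_mat (m + p) l" "w \<in> carrier_vec l"
  shows "W *\<^sub>v w = (top_rows m W *\<^sub>v w) @\<^sub>v (bottom_rows p W *\<^sub>v w)"
  using assms by (simp add: top_rows_mult_vec bottom_rows_mult_vec)

lemma transpose_mult_append:
  fixes W :: "real mat"
  assumes W: "W \<in> carrier_mat (m + p) l" and a: "a \<in> carrier_vec m" and c: "c \<in> carrier_vec p"
  shows "transpose_mat W *\<^sub>v (a @\<^sub>v c) =
    transpose_mat (top_rows m W) *\<^sub>v a + transpose_mat (bottom_rows p W) *\<^sub>v c"
proof (rule vec_eq_by_scalar_prod[of _ l])
  have t: "top_rows m W \<in> carrier_mat m l" "bottom_rows p W \<in> carrier_mat p l"
    using W by (auto intro: top_rows_carrier bottom_rows_carrier)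
  show "transpose_mat (top_rows m W) *\<^sub>v a + transpose_mat (bottom_rows p W) *\<^sub>v c \<in> carrier_vec l"
    using t a c by (intro add_carrier_vec) auto
  show "transpose_mat W *\<^sub>v (a @\<^sub>v c) \<in> carrier_vec l" using W a c by simp
  fix w :: "real vec" assume w: "w \<in> carrier_vec l"
  have tw: "top_rows m W *\<^sub>v w \<in> carrier_vec m" "bottom_rows p W *\<^sub>v w \<in> carrier_vec p"
    using t w by auto
  have "w \<bullet> (transpose_mat W *\<^sub>v (a @\<^sub>v c)) = (W *\<^sub>v w) \<bullet> (a @\<^sub>v c)"
    using scalar_prod_transpose(2)[OF W _ w, of "a @\<^sub>v c"] a c by simp
  also have "\<dots> = (top_rows m W *\<^sub>v w) \<bullet> a + (bottom_rows p W *\<^sub>v w) \<bullet> c"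
    unfolding mult_vec_top_bottom[OF W w] by (rule scalar_prod_append[OF tw a c])
  also have "\<dots> = w \<bullet> (transpose_mat (top_rows m W) *\<^sub>v a) + w \<bullet> (transpose_mat (bottom_rows p W) *\<^sub>v c)"
    using scalar_prod_transpose(2)[OF t(1) a w] scalar_prod_transpose(2)[OF t(2) c w] by simp
  also have "\<dots> = w \<bullet> (transpose_mat (top_rows m W) *\<^sub>v a + transpose_mat (bottom_rows p W) *\<^sub>v c)"
    by (rule scalar_prod_add_distrib[symmetric, OF w]) (use t a c in auto)
  finally show "w \<bullet> (transpose_mat W *\<^sub>v (a @\<^sub>v c)) =
      w \<bullet> (transpose_mat (top_rows m W) *\<^sub>v a + transpose_mat (bottom_rows p W) *\<^sub>v c)" .
qed

text \<open>
  The facts about the closed loop on which the analysis of the estimation error rests: positive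
  definiteness of \<open>W\<^sup>T S W\<close>, the Lyapunov identity, the initial value of the dual trajectory, and the
  dual DAE in pointwise form.
\<close>

lemma closed_loop_properties:
  fixes F A H Q R Ag Bg Cg Dg Mg S P K :: "real mat"
  assumes F: "F \<in> carrier_mat m n" and A: "A \<in> carrier_mat m n" and H: "H \<in> carrier_mat p n"
    and S: "pos_def_mat (m + p) S"
    and stab: "stabilizable_associated_lti F A H l k Ag Bg Cg Dg Mg"
    and P: "pos_def_riccati_solution S Ag Bg Cg Dg P"
    and K: "K = riccati_gain S Ag Bg Cg Dg P"
  defines "AK \<equiv> Ag - Bg * K" and "W \<equiv> Cg - Dg * K"
  shows "AK \<in> carrier_mat l l" "W \<in> carrier_mat (m + p) l" "Mg \<in> carrier_mat l n"
    "bottom_rows p Cg - bottom_rows p Dg * K = bottom_rows p W"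
    and "pos_def_mat l (transpose_mat W * S * W)"
    and "w \<in> carrier_vec l \<Longrightarrow> 2 * ((P *\<^sub>v w) \<bullet> (AK *\<^sub>v w)) = - (w \<bullet> ((transpose_mat W * S * W) *\<^sub>v w))"
    and "detectable F A H ell \<Longrightarrow> ell \<in> carrier_vec m \<Longrightarrow>
      transpose_mat F *\<^sub>v (top_rows m W *\<^sub>v (Mg *\<^sub>v (transpose_mat F *\<^sub>v ell))) = transpose_mat F *\<^sub>v ell"
    and "(\<And>t. t \<ge> 0 \<Longrightarrow> v t \<in> carrier_vec l) \<Longrightarrow>
      (\<And>t i. t \<ge> 0 \<Longrightarrow> i < l \<Longrightarrow> ((\<lambda>s. v s $ i) has_real_derivative (AK *\<^sub>v v t) $ i) (at t within {0..})) \<Longrightarrow>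
      t > 0 \<Longrightarrow> transpose_mat F *\<^sub>v (top_rows m W *\<^sub>v (AK *\<^sub>v v t)) =
        transpose_mat A *\<^sub>v (top_rows m W *\<^sub>v v t) - transpose_mat H *\<^sub>v (bottom_rows p W *\<^sub>v v t)"
proof -
  obtain nh Aa Ba Ca J where
    assoc: "associated_lti F A H nh k Aa Ba Ca Dg"
    and c: "Ag \<in> carrier_mat l l" "Bg \<in> carrier_mat l k" "Cg \<in> carrier_mat (m + p) l"
    "Dg \<in> carrier_mat (m + p) k" "Mg \<in> carrier_mat l n" "J \<in> carrier_mat nh l"
    and D: "k = 1 \<and> Dg = 0\<^sub>m (m + p) k \<and> Bg = 0\<^sub>m l k \<or> k > 0 \<and> vec_space.rank (m + p) Dg = k"
    and AJ: "\<And>w. w \<in> carrier_vec l \<Longrightarrow> Aa *\<^sub>v (J *\<^sub>v w) = J *\<^sub>v (Ag *\<^sub>v w)"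
    and BJ: "\<And>g. g \<in> carrier_vec k \<Longrightarrow> Ba *\<^sub>v g = J *\<^sub>v (Bg *\<^sub>v g)"
    and CJ: "\<And>w. w \<in> carrier_vec l \<Longrightarrow> Ca *\<^sub>v (J *\<^sub>v w) = Cg *\<^sub>v w"
    and Jinj: "\<And>w. w \<in> carrier_vec l \<Longrightarrow> J *\<^sub>v w = 0\<^sub>v nh \<Longrightarrow> w = 0\<^sub>v l"
    and JM: "\<And>z. z \<in> carrier_vec n \<Longrightarrow> state_map F Ca *\<^sub>v z \<in> stabilizability_subspace Aa Ba \<Longrightarrow>
      J *\<^sub>v (Mg *\<^sub>v z) = state_map F Ca *\<^sub>v z"
    by (rule stabilizable_associated_ltiE[OF stab F H]) (rule that; assumption)
  note a = associated_ltiD[OF assoc F H]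
  note ric = riccati_lyapunov[OF c(1-4) S D P K]
  have Kc: "K \<in> carrier_mat k l" by (rule ric(1))
  show AK: "AK \<in> carrier_mat l l" using c Kc by (auto simp: AK_def)
  show W: "W \<in> carrier_mat (m + p) l" using c Kc by (auto simp: W_def)
  show "Mg \<in> carrier_mat l n" by (rule c)
  show "bottom_rows p Cg - bottom_rows p Dg * K = bottom_rows p W"
    using c Kc by (intro eq_matI) (auto simp: bottom_rows_def W_def scalar_prod_def)
  have Ww: "W *\<^sub>v w = Ca *\<^sub>v (J *\<^sub>v w) + Dg *\<^sub>v (- (K *\<^sub>v w))" if w: "w \<in> carrier_vec l" for w
  proof -
    have "W *\<^sub>v w = Cg *\<^sub>v w - Dg *\<^sub>v (K *\<^sub>v w)"
      unfolding W_def using c Kc w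
      by (simp add: minus_mult_distrib_mat_vec[of _ "m + p" l] assoc_mult_mat_vec[of _ "m + p" k _ l])
    moreover have "Dg *\<^sub>v (- (K *\<^sub>v w)) = - (Dg *\<^sub>v (K *\<^sub>v w))"
      using c(4) Kc w by (intro eq_vecI) auto
    ultimately show ?thesis unfolding CJ[OF w] using c Kc w by (intro eq_vecI) auto
  qed
  define M0 where "M0 = transpose_mat F * top_rows m Ca"
  have M0: "M0 \<in> carrier_mat n nh" using F a(5) by (auto simp: M0_def top_rows_def)
  have Wc: "top_rows m W \<in> carrier_mat m l" "bottom_rows p W \<in> carrier_mat p l"
    using W by (auto intro: top_rows_carrier bottom_rows_carrier)
  have FW: "transpose_mat F *\<^sub>v (top_rows m W *\<^sub>v w) = M0 *\<^sub>v (J *\<^sub>v w)" if w: "w \<in> carrier_vec l" for w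
    unfolding M0_def
  proof (rule state_output_eq[OF assoc F H, where g = "- (K *\<^sub>v w)" and u = "bottom_rows p W *\<^sub>v w"])
    show "(top_rows m W *\<^sub>v w) @\<^sub>v (bottom_rows p W *\<^sub>v w) = Ca *\<^sub>v (J *\<^sub>v w) + Dg *\<^sub>v (- (K *\<^sub>v w))"
      using Ww[OF w] mult_vec_top_bottom[OF W w] by simp
  qed (use c Kc Wc w in auto)
  \<comment> \<open>already the first \<open>m\<close> rows of \<open>W\<close> determine \<open>w\<close>, through the injective matrix \<open>M0\<close>\<close>
  have Winj: "w = 0\<^sub>v l" if w: "w \<in> carrier_vec l" "W *\<^sub>v w = 0\<^sub>v (m + p)" for w
  proof -
    have "top_rows m W *\<^sub>v w = vec_first (0\<^sub>v (m + p)) m" using top_rows_mult_vec[OF W w(1)] w(2) by simp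
    also have "\<dots> = 0\<^sub>v m" by (intro eq_vecI) (auto simp: vec_first_def)
    finally have "M0 *\<^sub>v (J *\<^sub>v w) = 0\<^sub>v n" using FW[OF w(1)] mat_mult_zero_vec[of "transpose_mat F" n m] F by simp
    then have "J *\<^sub>v w = 0\<^sub>v nh"
      by (rule full_column_rank_injective[OF M0 a(8)[folded M0_def] mult_mat_vec_carrier[OF c(6) w(1)]])
    then show ?thesis by (rule Jinj[OF w(1)])
  qed
  show "pos_def_mat l (transpose_mat W * S * W)"
    by (rule pos_def_gram_mat[OF W S Winj])
  have Sc: "S \<in> carrier_mat (m + p) (m + p)" using S by (simp add: pos_def_mat_def)
  show "2 * ((P *\<^sub>v w) \<bullet> (AK *\<^sub>v w)) = - (w \<bullet> ((transpose_mat W * S * W) *\<^sub>v w))"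
    if w: "w \<in> carrier_vec l"
  proof -
    have "(transpose_mat W * S * W) *\<^sub>v w = transpose_mat W *\<^sub>v (S *\<^sub>v (W *\<^sub>v w))"
      using W Sc w by (simp add: assoc_mult_mat_vec[of _ l "m + p" _ l] assoc_mult_mat_vec[of _ l "m + p" _ "m + p"])
    then have "w \<bullet> ((transpose_mat W * S * W) *\<^sub>v w) = (W *\<^sub>v w) \<bullet> (S *\<^sub>v (W *\<^sub>v w))"
      using scalar_prod_transpose(2)[OF W _ w, of "S *\<^sub>v (W *\<^sub>v w)"] W Sc w by simp
    then show ?thesis using ric(2)[OF w] by (simp add: AK_def W_def)
  qed
  show "transpose_mat F *\<^sub>v (top_rows m W *\<^sub>v (Mg *\<^sub>v (transpose_mat F *\<^sub>v ell))) = transpose_mat F *\<^sub>v ell"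
    if det: "detectable F A H ell" and ell: "ell \<in> carrier_vec m"
  proof -
    note d = detectable_initial_state[OF assoc F H det ell]
    have z: "transpose_mat F *\<^sub>v ell \<in> carrier_vec n" using F ell by simp
    then show ?thesis using FW[of "Mg *\<^sub>v (transpose_mat F *\<^sub>v ell)"] JM[OF z d(1)] d(2) c(5) by (simp add: M0_def)
  qed
  show "transpose_mat F *\<^sub>v (top_rows m W *\<^sub>v (AK *\<^sub>v v t)) =
        transpose_mat A *\<^sub>v (top_rows m W *\<^sub>v v t) - transpose_mat H *\<^sub>v (bottom_rows p W *\<^sub>v v t)"
    if v: "\<And>t. t \<ge> 0 \<Longrightarrow> v t \<in> carrier_vec l" and
      v': "\<And>t i. t \<ge> 0 \<Longrightarrow> i < l \<Longrightarrow> ((\<lambda>s. v s $ i) has_real_derivative (AK *\<^sub>v v t) $ i) (at t within {0..})"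
      and t: "t > 0"
  proof -
    have vac: "v \<in> AC {0..} l" by (rule linear_ode_solution_AC[OF AK v v'])
    define q u where "q t = top_rows m W *\<^sub>v v t" and "u t = bottom_rows p W *\<^sub>v v t" for t
    have q: "q \<in> AC {0..} m" and u: "u \<in> AC {0..} p"
      unfolding q_def u_def using Wc vac by (auto intro: mult_mat_vec_AC)
    \<comment> \<open>the closed loop is a trajectory of the associated system under the feedback \<open>- K v\<close>\<close>
    have traj: "lti_trajectory {0..} Aa Ba (\<lambda>t. J *\<^sub>v v t) (\<lambda>t. - K *\<^sub>v v t)"
      unfolding lti_trajectory_def
    proof (intro conjI AE_I2 impI allI)
      show "(\<lambda>t. J *\<^sub>v v t) \<in> AC {0..} (dim_row Aa)" using mult_mat_vec_AC[OF c(6) vac] a(3) by simp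
      show "(\<lambda>t. - K *\<^sub>v v t) \<in> L2_loc {0..} (dim_col Ba)"
        using AC_imp_L2_loc[OF mult_mat_vec_AC[OF _ vac, of "- K" k]] Kc a(4) by simp
      fix t :: real and i assume t: "t \<in> {0..}" and i: "i < dim_row Aa"
      have vt: "v t \<in> carrier_vec l" using v t by simp
      have KK: "- K *\<^sub>v v t \<in> carrier_vec k" "K *\<^sub>v v t \<in> carrier_vec k" using Kc vt by auto
      have "AK *\<^sub>v v t = Ag *\<^sub>v v t + Bg *\<^sub>v (- K *\<^sub>v v t)"
      proof -
        have "AK *\<^sub>v v t = Ag *\<^sub>v v t - Bg *\<^sub>v (K *\<^sub>v v t)"
          unfolding AK_def using c Kc vt
          by (simp add: minus_mult_distrib_mat_vec[of _ l l] assoc_mult_mat_vec[of _ l k _ l])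
        moreover have "Bg *\<^sub>v (- K *\<^sub>v v t) = - (Bg *\<^sub>v (K *\<^sub>v v t))"
          using c(2) Kc vt by (intro eq_vecI) auto
        ultimately show ?thesis using c Kc vt by (intro eq_vecI) auto
      qed
      then have "J *\<^sub>v (AK *\<^sub>v v t) = J *\<^sub>v (Ag *\<^sub>v v t) + J *\<^sub>v (Bg *\<^sub>v (- K *\<^sub>v v t))"
        using mult_add_distrib_mat_vec[OF c(6) mult_mat_vec_carrier[OF c(1) vt] mult_mat_vec_carrier[OF c(2) KK(1)]]
        by (simp only:)
      then have "J *\<^sub>v (AK *\<^sub>v v t) = Aa *\<^sub>v (J *\<^sub>v v t) + Ba *\<^sub>v (- K *\<^sub>v v t)"
        by (simp only: AJ[OF vt] BJ[OF KK(1)])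
      moreover have "((\<lambda>s. (J *\<^sub>v v s) $ i) has_real_derivative (J *\<^sub>v (AK *\<^sub>v v t)) $ i) (at t within {0..})"
      proof (rule has_real_derivative_mult_mat_vec[OF c(6) _ t])
        show "i < nh" using i a(3) by simp
        show "AK *\<^sub>v v t \<in> carrier_vec l" using AK vt by simp
      qed (use v v' t in auto)
      ultimately show "((\<lambda>s. (J *\<^sub>v v s) $ i) has_real_derivative
          (Aa *\<^sub>v (J *\<^sub>v v t) + Ba *\<^sub>v (- K *\<^sub>v v t)) $ i) (at t within {0..})"
        by (simp only:)
    qed
    have out: "AE t in lebesgue. t \<in> {0..} \<longrightarrow> q t @\<^sub>v u t = Ca *\<^sub>v (J *\<^sub>v v t) + Dg *\<^sub>v (- K *\<^sub>v v t)"
    proof (intro AE_I2 impI)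
      fix t :: real assume "t \<in> {0..}"
      then have vt: "v t \<in> carrier_vec l" using v by simp
      have "- K *\<^sub>v v t = - (K *\<^sub>v v t)" using Kc vt by (intro eq_vecI) auto
      then show "q t @\<^sub>v u t = Ca *\<^sub>v (J *\<^sub>v v t) + Dg *\<^sub>v (- K *\<^sub>v v t)"
        using Ww[OF vt] mult_vec_top_bottom[OF W vt] by (simp add: q_def u_def)
    qed
    have sol: "dual_solution {0..} F A H q u"
    proof (rule iffD2[OF a(9)])
      show "\<exists>v g. lti_trajectory {0..} Aa Ba v g \<and>
          (AE t in lebesgue. t \<in> {0..} \<longrightarrow> q t @\<^sub>v u t = Ca *\<^sub>v v t + Dg *\<^sub>v g t)"
        by (rule exI, rule exI, rule conjI[OF traj out])
    qed (fact AC_halflineD(1)[OF q] AC_halflineD(1)[OF u])+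
    have vt: "v t \<in> carrier_vec l" using v t by simp
    show ?thesis
    proof (rule eq_vecI)
      have qt: "q t \<in> carrier_vec m" "u t \<in> carrier_vec p" using AC_halflineD(1)[OF q] AC_halflineD(1)[OF u] t by auto
      fix i assume "i < dim_vec (transpose_mat A *\<^sub>v (top_rows m W *\<^sub>v v t) - transpose_mat H *\<^sub>v (bottom_rows p W *\<^sub>v v t))"
      then have i: "i < n" using H by simp
      have FWc: "transpose_mat F * top_rows m W \<in> carrier_mat n l" using F Wc by simp
      have "((\<lambda>s. ((transpose_mat F * top_rows m W) *\<^sub>v v s) $ i) has_real_derivative
          ((transpose_mat F * top_rows m W) *\<^sub>v (AK *\<^sub>v v t)) $ i) (at t within {0..})"
        by (rule has_real_derivative_mult_mat_vec[OF FWc i]) (use v v' t AK in auto)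
      then have "((\<lambda>s. (transpose_mat F *\<^sub>v q s) $ i) has_real_derivative
          ((transpose_mat F * top_rows m W) *\<^sub>v (AK *\<^sub>v v t)) $ i) (at t within {0..})"
      proof (rule has_field_derivative_transform_within[where d = 1])
        fix s :: real assume "s \<in> {0..}"
        then show "((transpose_mat F * top_rows m W) *\<^sub>v v s) $ i = (transpose_mat F *\<^sub>v q s) $ i"
          using assoc_mult_mat_vec[of "transpose_mat F" n m "top_rows m W" l "v s"] F Wc v by (simp add: q_def)
      qed (use t in auto)
      from dual_solution_continuous_derivative[OF F A H sol q u t i this]
      show "(transpose_mat F *\<^sub>v (top_rows m W *\<^sub>v (AK *\<^sub>v v t))) $ i =
          (transpose_mat A *\<^sub>v (top_rows m W *\<^sub>v v t) - transpose_mat H *\<^sub>v (bottom_rows p W *\<^sub>v v t)) $ i"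
        using assoc_mult_mat_vec[of "transpose_mat F" n m "top_rows m W" l "AK *\<^sub>v v t"] F Wc AK vt
        by (simp add: q_def u_def)
    qed (use F H in auto)
  qed
qed

lemma append_uminus_L2_loc:
  assumes "f \<in> L2_loc {0..} m" "\<eta> \<in> L2_loc {0..} p"
  shows "(\<lambda>t. f t @\<^sub>v (- \<eta> t)) \<in> L2_loc {0..} (m + p)"
proof (rule L2_loc_halflineI)
  show "f t @\<^sub>v (- \<eta> t) \<in> carrier_vec (m + p)" if "t \<ge> 0" for t
    using L2_loc_halflineD(1)[OF assms(1) that] L2_loc_halflineD(1)[OF assms(2) that] by simp
  fix i and a b :: real assume i: "i < m + p" and ab: "0 \<le> a" "a \<le> b"
  show "square_integrable {a..b} (\<lambda>t. (f t @\<^sub>v (- \<eta> t)) $ i)"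
  proof (cases "i < m")
    case True
    have "square_integrable {a..b} (\<lambda>t. f t $ i)"
      using assms(1) True ab by (auto simp: L2_loc_def L2_def)
    then show ?thesis
    proof (rule square_integrable_cong)
      fix t assume "t \<in> {a..b}"
      then have "f t \<in> carrier_vec m" "\<eta> t \<in> carrier_vec p"
        using L2_loc_halflineD(1)[OF assms(1)] L2_loc_halflineD(1)[OF assms(2)] ab by auto
      then show "f t $ i = (f t @\<^sub>v (- \<eta> t)) $ i" using True i by auto
    qed
  next
    case False
    then have "square_integrable {a..b} (\<lambda>t. - 1 * \<eta> t $ (i - m))"
      using assms(2) i ab by (intro square_integrable_cmult) (auto simp: L2_loc_def L2_def)
    then show ?thesis
    proof (rule square_integrable_cong)
      fix t assume "t \<in> {a..b}"
      then have "f t \<in> carrier_vec m" "\<eta> t \<in> carrier_vec p"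
        using L2_loc_halflineD(1)[OF assms(1)] L2_loc_halflineD(1)[OF assms(2)] ab by auto
      then show "- 1 * \<eta> t $ (i - m) = (f t @\<^sub>v (- \<eta> t)) $ i" using False i by auto
    qed
  qed
qed

lemma lti_trajectory_exists:
  assumes A: "A \<in> carrier_mat l l" and B: "B \<in> carrier_mat l k" and g: "g \<in> L2_loc {0..} k"
    and r0: "r0 \<in> carrier_vec l"
  shows "\<exists>r. lti_trajectory {0..} A B r g \<and> r 0 = r0"
proof -
  have b: "(\<lambda>t. (B *\<^sub>v g t) $ i) absolutely_integrable_on {0..T}" if "i < l" for i T
    using L2_loc_halflineD[OF g] that
    by (intro square_integrable_imp_integrable square_integrable_mult_mat_vec[OF B]) auto
  obtain r :: "nat \<Rightarrow> real \<Rightarrow> real" where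
    r: "\<And>i. i < l \<Longrightarrow> r i 0 = r0 $ i" "\<And>i T. i < l \<Longrightarrow> abs_continuous_on {0..T} (r i)"
    "AE t in lebesgue. t \<in> {0..} \<longrightarrow> (\<forall>i<l. (r i has_real_derivative
        (\<Sum>k<l. A $$ (i, k) * r k t) + (B *\<^sub>v g t) $ i) (at t within {0..}))"
    by (rule linear_ode_solution_exists[where l = l and b = "\<lambda>i t. (B *\<^sub>v g t) $ i"
        and ?r0.0 = "\<lambda>i. r0 $ i" and A = "\<lambda>i k. A $$ (i, k)", OF b], assumption)
      (rule that; assumption)
  define R where "R t = vec l (\<lambda>i. r i t)" for t
  have R: "R t \<in> carrier_vec l" for t by (simp add: R_def)
  have Ri: "(\<lambda>s. R s $ i) = r i" if "i < l" for i using that by (simp add: R_def)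
  have "R 0 = r0" using r(1) r0 by (intro eq_vecI) (auto simp: R_def)
  moreover have "lti_trajectory {0..} A B R g"
    unfolding lti_trajectory_def
  proof (intro conjI)
    show "R \<in> AC {0..} (dim_row A)" by (rule AC_halflineI) (use A r(2) R Ri in auto)
    show "g \<in> L2_loc {0..} (dim_col B)" using g B by simp
    show "AE t in lebesgue. t \<in> {0..} \<longrightarrow> (\<forall>i<dim_row A.
        ((\<lambda>s. R s $ i) has_real_derivative (A *\<^sub>v R t + B *\<^sub>v g t) $ i) (at t within {0..}))"
      using r(3)
    proof eventually_elim
      case (elim t)
      show ?case
      proof (intro impI allI)
        fix i assume t: "t \<in> {0..}" and "i < dim_row A"
        then have i: "i < l" using A by simp
        have "(A *\<^sub>v R t + B *\<^sub>v g t) $ i = (\<Sum>k<l. A $$ (i, k) * r k t) + (B *\<^sub>v g t) $ i"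
          using index_mult_mat_vec_sum[OF A R i] i B by (simp add: R_def)
        then show "((\<lambda>s. R s $ i) has_real_derivative (A *\<^sub>v R t + B *\<^sub>v g t) $ i) (at t within {0..})"
          using elim t i by (simp add: Ri)
      qed
    qed
  qed
  ultimately show ?thesis by blast
qed

section \<open>The estimation error\<close>

theorem lemma1:
  fixes m n p l k :: nat
    and F A H Q0 Q R Ag Bg Cg Dg Mg S P K :: "real mat"
    and ell :: "real vec"
    and v :: "real \<Rightarrow> real vec"
    and U :: "real \<Rightarrow> real \<Rightarrow> real vec"
    and x f y \<eta> :: "real \<Rightarrow> real vec"
    and e :: "real \<Rightarrow> real"
  assumes "F \<in> carrier_mat m n" and "A \<in> carrier_mat m n" and "H \<in> carrier_mat p n"
    and "pos_def_mat m Q0" and "pos_def_mat m Q" and "pos_def_mat p R"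
    and "ell \<in> carrier_vec m"
    and "detectable F A H ell"
    and "stabilizable_associated_lti F A H l k Ag Bg Cg Dg Mg"
    and S: "S = weight_mat Q R"
    and P: "pos_def_riccati_solution S Ag Bg Cg Dg P"
    and P_unique: "\<And>P'. pos_def_riccati_solution S Ag Bg Cg Dg P' \<Longrightarrow> P' = P"
    and K: "K = riccati_gain S Ag Bg Cg Dg P"
    and v_carrier: "\<And>t. t \<ge> 0 \<Longrightarrow> v t \<in> carrier_vec l"
    and v_init: "v 0 = Mg *\<^sub>v (transpose_mat F *\<^sub>v ell)"
    and v_deriv: "\<And>t i. t \<ge> 0 \<Longrightarrow> i < l \<Longrightarrow>
      ((\<lambda>s. v s $ i) has_real_derivative ((Ag - Bg * K) *\<^sub>v v t) $ i) (at t within {0..})"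
    and U: "U = (\<lambda>t s. (bottom_rows p Cg - bottom_rows p Dg * K) *\<^sub>v v (t - s))"
    and "minimax_observer F A H Q0 Q R ell U"
    and "(x, f, y, \<eta>) \<in> admissible_solutions F A H Q0 Q R {0..}"
    and e: "e = estimation_error F ell U x y"
  defines "error_dynamics \<equiv> \<lambda>r.
      lti_trajectory {0..} (transpose_mat (Ag - Bg * K)) (transpose_mat (Cg - Dg * K)) r
        (\<lambda>t. f t @\<^sub>v (- \<eta> t)) \<and>
      r 0 = transpose_mat (Cg - Dg * K) *\<^sub>v (ac_mult {0..} F x 0 @\<^sub>v 0\<^sub>v p)"
  shows "(\<exists>r. error_dynamics r) \<and>
    (\<forall>r. error_dynamics r \<longrightarrow>
      (\<forall>t\<ge>0. e t = ell \<bullet> ((F * transpose_mat Mg) *\<^sub>v r t))) \<and>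
    ((AE t in lebesgue. t \<ge> 0 \<longrightarrow> f t = 0\<^sub>v m \<and> \<eta> t = 0\<^sub>v p) \<longrightarrow> (e \<longlongrightarrow> 0) at_top) \<and>
    ((\<exists>c. AE t in lebesgue. t > 0 \<longrightarrow> f t \<bullet> f t \<le> c \<and> \<eta> t \<bullet> \<eta> t \<le> c) \<longrightarrow>
      bdd_above ((\<lambda>t. (e t)\<^sup>2) ` {0<..})) \<and>
    (f \<in> L2 {0..} m \<and> \<eta> \<in> L2 {0..} p \<longrightarrow> square_integrable {0..} e)"
proof -
  note F = assms(1) and A = assms(2) and H = assms(3)
  note ell = assms(7) and det = assms(8) and stab = assms(9)
  have Spd: "pos_def_mat (m + p) S" unfolding S by (rule pos_def_weight_mat[OF assms(5,6)])
  define AK W where "AK = Ag - Bg * K" and "W = Cg - Dg * K"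
  note cl = closed_loop_properties[OF F A H Spd stab P K, folded AK_def W_def]
  note AK = cl(1) and W = cl(2) and Mg = cl(3)
  define Cq Cu where "Cq = top_rows m W" and "Cu = bottom_rows p W"
  have Cq: "Cq \<in> carrier_mat m l" and Cu: "Cu \<in> carrier_mat p l"
    using W by (auto simp: Cq_def Cu_def intro: top_rows_carrier bottom_rows_carrier)
  have v': "((\<lambda>s. v s $ i) has_real_derivative (AK *\<^sub>v v t) $ i) (at t within {0..})" if "t \<ge> 0" "i < l" for t i
    using v_deriv[OF that] by (simp add: AK_def)
  have sol: "dae_solution {0..} F A H x f y \<eta>"
    using assms(19) by (simp add: admissible_solutions_def)
  have dims: "dim_row F = m" "dim_col F = n" "dim_row H = p" using F H by auto
  have L2: "x \<in> L2_loc {0..} n" "f \<in> L2_loc {0..} m" "y \<in> L2_loc {0..} p" "\<eta> \<in> L2_loc {0..} p"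
    and yH: "AE t in lebesgue. t \<in> {0..} \<longrightarrow> y t = H *\<^sub>v x t + \<eta> t"
    using sol unfolding dae_solution_def dims by blast+
  note xc = L2_loc_halflineD(1)[OF L2(1)] and fc = L2_loc_halflineD(1)[OF L2(2)] and \<eta>c = L2_loc_halflineD(1)[OF L2(4)]
  define z where "z = ac_mult {0..} F x"
  note zz = dae_solution_derivative[OF F A sol, folded z_def]
  note zc = AC_halflineD(1)[OF zz(1)]
  define g where "g t = f t @\<^sub>v (- \<eta> t)" for t
  have g: "g \<in> L2_loc {0..} (m + p)"
    unfolding g_def by (rule append_uminus_L2_loc[OF L2(2,4)])
  have gc: "g t \<in> carrier_vec (m + p)" if "t \<ge> 0" for t by (rule L2_loc_halflineD(1)[OF g that])
  have ed: "error_dynamics r \<longleftrightarrow> lti_trajectory {0..} (transpose_mat AK) (transpose_mat W) r g \<and>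
      r 0 = transpose_mat W *\<^sub>v (z 0 @\<^sub>v 0\<^sub>v p)" for r
    by (simp add: error_dynamics_def AK_def W_def z_def g_def[abs_def])
  define v0 where "v0 = v 0"
  have v0: "v0 \<in> carrier_vec l" using v_carrier by (simp add: v0_def)
  have Fell: "transpose_mat F *\<^sub>v ell \<in> carrier_vec n" using F ell by simp
  have FCq: "transpose_mat F *\<^sub>v (Cq *\<^sub>v v0) = transpose_mat F *\<^sub>v ell"
    using cl(7)[OF det ell] by (simp add: Cq_def v0_def v_init)
  have q0: "Cq *\<^sub>v v0 \<in> carrier_vec m" using Cq v0 by simp
  \<comment> \<open>the two functionals agree on the image of \<open>F\<close>, and \<open>z\<close> is continuous with values \<open>F x\<close> almost everywhere\<close>
  have ellz: "ell \<bullet> z t = (Cq *\<^sub>v v0) \<bullet> z t" if t: "t \<ge> 0" for t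
  proof (rule AE_eq_imp_eq_on_halfline[where a = 0 and f = "\<lambda>t. ell \<bullet> z t" and g = "\<lambda>t. (Cq *\<^sub>v v0) \<bullet> z t"])
    show "continuous_on {0..b} (\<lambda>t. ell \<bullet> z t)" "continuous_on {0..b} (\<lambda>t. (Cq *\<^sub>v v0) \<bullet> z t)" for b
      using ell q0 zc AC_halflineD(2)[OF zz(1)]
      by (auto intro!: abs_continuous_on_imp_continuous abs_continuous_on_scalar_prod[of _ _ _ m] abs_continuous_on_const)
    show "AE t in lebesgue. t \<in> {0..} \<longrightarrow> ell \<bullet> z t = (Cq *\<^sub>v v0) \<bullet> z t"
      using zz(2)
    proof eventually_elim
      case (elim t)
      show ?case
        using elim scalar_prod_transpose(1)[OF F ell xc[of t]] scalar_prod_transpose(1)[OF F q0 xc[of t]] FCq by auto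
    qed
  qed (rule t)
  have WT: "transpose_mat W *\<^sub>v (a @\<^sub>v c) = transpose_mat Cq *\<^sub>v a + transpose_mat Cu *\<^sub>v c"
    if "a \<in> carrier_vec m" "c \<in> carrier_vec p" for a c
    using transpose_mult_append[OF W that] by (simp add: Cq_def Cu_def)
  \<comment> \<open>the error for every solution \<open>r\<close> of the error dynamics\<close>
  have e_v0: "e t = v0 \<bullet> r t" if r: "error_dynamics r" and t: "t \<ge> 0" for r t
  proof -
    have traj: "lti_trajectory {0..} (transpose_mat AK) (transpose_mat W) r g"
      and r0: "r 0 = transpose_mat W *\<^sub>v (z 0 @\<^sub>v 0\<^sub>v p)"
      using r by (auto simp: ed)
    have rac: "r \<in> AC {0..} l" using traj AK by (simp add: lti_trajectory_def)
    have r': "AE t in lebesgue. t \<in> {0..} \<longrightarrow> (\<forall>i<l. ((\<lambda>s. r s $ i) has_real_derivative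
      (transpose_mat AK *\<^sub>v r t + (transpose_mat Cq *\<^sub>v f t - transpose_mat Cu *\<^sub>v \<eta> t)) $ i) (at t within {0..}))"
    proof -
      have "transpose_mat W *\<^sub>v g t = transpose_mat Cq *\<^sub>v f t - transpose_mat Cu *\<^sub>v \<eta> t" if "t \<ge> 0" for t
      proof -
        have "transpose_mat Cu *\<^sub>v (- \<eta> t) = - (transpose_mat Cu *\<^sub>v \<eta> t)"
          using Cu \<eta>c[OF that] by (intro eq_vecI) auto
        then show ?thesis
          unfolding g_def using WT[OF fc[OF that], of "- \<eta> t"] \<eta>c[OF that] fc[OF that] Cq Cu
          by (simp add: minus_add_uminus_vec[of _ l])
      qed
      then show ?thesis using traj AK by (auto simp: lti_trajectory_def)
    qed
    have r0': "r 0 = transpose_mat Cq *\<^sub>v z 0"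
      using r0 WT[of "z 0" "0\<^sub>v p"] zc[of 0] mat_mult_zero_vec[of "transpose_mat Cu" l p] Cu Cq by simp
    have "observer_output U y t = (LINT s:{0..t}|lebesgue. y s \<bullet> (Cu *\<^sub>v v (t - s)))"
      unfolding observer_output_def U cl(4) Cu_def ..
    also have "\<dots> = (Cq *\<^sub>v v 0) \<bullet> z t - v 0 \<bullet> r t"
    proof (rule observer_error_identity[OF F A H AK Cq Cu v_carrier v' _ rac r' zz(1,3,2) xc fc \<eta>c L2(3) yH r0' t])
      show "transpose_mat F *\<^sub>v (Cq *\<^sub>v (AK *\<^sub>v v t)) =
          transpose_mat A *\<^sub>v (Cq *\<^sub>v v t) - transpose_mat H *\<^sub>v (Cu *\<^sub>v v t)" if "t > 0" for t
        unfolding Cq_def Cu_def by (rule cl(8)[OF v_carrier v' that])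
    qed
    finally show ?thesis
      using ellz[OF t] by (simp add: e estimation_error_def z_def[symmetric] v0_def)
  qed
  have ident: "ell \<bullet> ((F * transpose_mat Mg) *\<^sub>v r) = v0 \<bullet> r" if "r \<in> carrier_vec l" for r
  proof -
    have c: "transpose_mat Mg *\<^sub>v r \<in> carrier_vec n" using Mg that by simp
    have "(F * transpose_mat Mg) *\<^sub>v r = F *\<^sub>v (transpose_mat Mg *\<^sub>v r)"
      using F Mg that by (intro assoc_mult_mat_vec) auto
    then have "ell \<bullet> ((F * transpose_mat Mg) *\<^sub>v r) = (transpose_mat F *\<^sub>v ell) \<bullet> (transpose_mat Mg *\<^sub>v r)"
      using scalar_prod_transpose(1)[OF F ell c] by simp
    also have "\<dots> = (Mg *\<^sub>v (transpose_mat F *\<^sub>v ell)) \<bullet> r"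
      using scalar_prod_transpose(2)[OF Mg that Fell] by simp
    finally show ?thesis by (simp add: v0_def v_init)
  qed
  obtain r where r: "error_dynamics r"
    using lti_trajectory_exists[of "transpose_mat AK" l "transpose_mat W" "m + p" g "transpose_mat W *\<^sub>v (z 0 @\<^sub>v 0\<^sub>v p)"]
      AK W g zc[of 0] by (auto simp: ed)
  have rac: "r \<in> AC {0..} l" using r AK by (simp add: ed lti_trajectory_def)
  note rc = AC_halflineD(1)[OF rac]
  have r': "AE t in lebesgue. t \<in> {0..} \<longrightarrow> (\<forall>i<l. ((\<lambda>s. r s $ i) has_real_derivative
      (transpose_mat AK *\<^sub>v r t + transpose_mat W *\<^sub>v g t) $ i) (at t within {0..}))"
    using r AK by (simp add: ed lti_trajectory_def)
  have Ppd: "pos_def_mat l P"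
    using P stab by (auto simp: pos_def_riccati_solution_def stabilizable_associated_lti_def)
  define Pi where "Pi = mat_inv P"
  have Pipd: "pos_def_mat l Pi" unfolding Pi_def by (rule pos_def_mat_inv(4)[OF Ppd])
  then have Pic: "Pi \<in> carrier_mat l l" and Pis: "transpose_mat Pi = Pi" by (auto simp: pos_def_mat_def)
  obtain \<alpha> \<beta> where \<alpha>: "\<alpha> > 0" and \<beta>: "\<beta> > 0"
    and diss': "\<And>r b. r \<in> carrier_vec l \<Longrightarrow> b \<in> carrier_vec l \<Longrightarrow>
      2 * ((mat_inv P *\<^sub>v r) \<bullet> (transpose_mat AK *\<^sub>v r + b)) \<le>
        - \<alpha> * (r \<bullet> (mat_inv P *\<^sub>v r)) + \<beta> * (b \<bullet> b)"
    by (rule lyapunov_dissipation[OF Ppd cl(5) AK cl(6)], assumption) (rule that; assumption)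
  note diss = diss'[folded Pi_def]
  obtain c where c: "c > 0" "\<And>x. x \<in> carrier_vec l \<Longrightarrow> c * (x \<bullet> x) \<le> x \<bullet> (Pi *\<^sub>v x)"
    using pos_def_mat_coercive[OF Pipd] by auto
  have WW: "W * transpose_mat W \<in> carrier_mat (m + p) (m + p)" using W by simp
  obtain C where C: "C > 0" "\<And>x. x \<in> carrier_vec (m + p) \<Longrightarrow> \<bar>x \<bullet> ((W * transpose_mat W) *\<^sub>v x)\<bar> \<le> C * (x \<bullet> x)"
    using quadratic_form_bound[OF WW] by auto
  define G where "G t = f t \<bullet> f t + \<eta> t \<bullet> \<eta> t" for t
  have Wg: "(transpose_mat W *\<^sub>v g t) \<bullet> (transpose_mat W *\<^sub>v g t) \<le> C * G t" if t: "t \<ge> 0" for t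
  proof -
    have wg: "transpose_mat W *\<^sub>v g t \<in> carrier_vec l" using W gc[OF t] by simp
    have "(transpose_mat W *\<^sub>v g t) \<bullet> (transpose_mat W *\<^sub>v g t) = g t \<bullet> (W *\<^sub>v (transpose_mat W *\<^sub>v g t))"
      using scalar_prod_transpose(1)[OF W gc[OF t] wg] by simp
    also have "\<dots> = g t \<bullet> ((W * transpose_mat W) *\<^sub>v g t)"
      using W gc[OF t] by (simp add: assoc_mult_mat_vec[of _ "m + p" l _ "m + p"])
    also have "\<dots> \<le> C * (g t \<bullet> g t)" using C(2)[OF gc[OF t]] by simp
    also have "g t \<bullet> g t = G t"
    proof -
      have "g t \<bullet> g t = f t \<bullet> f t + (- \<eta> t) \<bullet> (- \<eta> t)"
        unfolding g_def by (rule scalar_prod_append) (use fc[OF t] \<eta>c[OF t] in auto)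
      then show ?thesis using \<eta>c[OF t] by (simp add: G_def)
    qed
    finally show ?thesis .
  qed
  \<comment> \<open>the Lyapunov function of the error dynamics\<close>
  define V where "V t = r t \<bullet> (Pi *\<^sub>v r t)" for t
  have Vac: "abs_continuous_on {0..T} V" for T
    unfolding V_def using rc AC_halflineD(2)[OF rac] AC_halflineD[OF mult_mat_vec_AC[OF Pic rac]]
    by (intro abs_continuous_on_scalar_prod[of _ _ _ l]) auto
  have V0: "V t \<ge> 0" if "t \<ge> 0" for t
    unfolding V_def by (rule pos_def_mat_nonneg[OF Pipd rc[OF that]])
  have V': "AE t in lebesgue. t \<in> {0..} \<longrightarrow>
      (\<exists>D \<le> - \<alpha> * V t + (\<beta> * C) * G t. (V has_real_derivative D) (at t within {0..}))"
    using r'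
  proof eventually_elim
    case (elim t)
    show ?case
    proof
      assume t: "t \<in> {0..}"
      define b d where "b = transpose_mat W *\<^sub>v g t" and "d = transpose_mat AK *\<^sub>v r t + b"
      have t0: "t \<ge> 0" using t by simp
      have cs: "b \<in> carrier_vec l" "d \<in> carrier_vec l" "r t \<in> carrier_vec l" "Pi *\<^sub>v r t \<in> carrier_vec l"
        using W gc[OF t0] rc[OF t0] AK Pic by (auto simp: b_def d_def)
      have rd: "((\<lambda>s. r s $ i) has_real_derivative d $ i) (at t within {0..})" if "i < l" for i
        using elim t that by (simp add: b_def d_def)
      have "(V has_real_derivative (d \<bullet> (Pi *\<^sub>v r t) + r t \<bullet> (Pi *\<^sub>v d))) (at t within {0..})"
        unfolding V_def
      proof (rule has_real_derivative_scalar_prod[OF t, of _ l])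
        show "((\<lambda>s. (Pi *\<^sub>v r s) $ i) has_real_derivative (Pi *\<^sub>v d) $ i) (at t within {0..})" if "i < l" for i
          by (rule has_real_derivative_mult_mat_vec[OF Pic that t]) (use rc rd cs in auto)
      qed (use rc rd cs Pic in auto)
      also have "d \<bullet> (Pi *\<^sub>v r t) + r t \<bullet> (Pi *\<^sub>v d) = 2 * ((Pi *\<^sub>v r t) \<bullet> d)"
        using scalar_prod_transpose(1)[OF Pic cs(3,2)] Pis comm_scalar_prod[OF cs(2,4)] by simp
      finally have "(V has_real_derivative 2 * ((Pi *\<^sub>v r t) \<bullet> d)) (at t within {0..})" .
      moreover have "2 * ((Pi *\<^sub>v r t) \<bullet> d) \<le> - \<alpha> * V t + (\<beta> * C) * G t"
      proof -
        have "\<beta> * (b \<bullet> b) \<le> \<beta> * (C * G t)"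
          using Wg[OF t0] \<beta> by (intro mult_left_mono) (auto simp: b_def)
        then show ?thesis using diss[OF cs(3,1)] by (simp add: d_def V_def mult.assoc)
      qed
      ultimately show "\<exists>D \<le> - \<alpha> * V t + (\<beta> * C) * G t. (V has_real_derivative D) (at t within {0..})" by blast
    qed
  qed
  define \<gamma> where "\<gamma> = (v0 \<bullet> v0) / c"
  have \<gamma>: "\<gamma> \<ge> 0" using c scalar_prod_self_nonneg[of v0] by (simp add: \<gamma>_def)
  have eV: "(e t)\<^sup>2 \<le> \<gamma> * V t" if t: "t \<ge> 0" for t
  proof -
    have "(e t)\<^sup>2 \<le> (v0 \<bullet> v0) * (r t \<bullet> r t)"
      using pos_def_mat_cauchy_schwarz[OF pos_def_one_mat v0 rc[OF t]] v0 rc[OF t] by (simp add: e_v0[OF r t])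
    also have "\<dots> \<le> (v0 \<bullet> v0) * (V t / c)"
      using c(1) c(2)[OF rc[OF t]] scalar_prod_self_nonneg[of v0]
      by (intro mult_left_mono) (auto simp: V_def field_simps)
    finally show ?thesis by (simp add: \<gamma>_def)
  qed
  have \<beta>C: "\<beta> * C \<ge> 0" using \<beta> C by simp
  note est = dissipative_estimates[OF \<alpha> \<beta>C \<gamma> Vac V0 V' eV]
  show ?thesis
  proof (intro conjI allI impI)
    show "\<exists>r. error_dynamics r" using r by blast
  next
    fix r t assume r: "error_dynamics r" and t: "(0 :: real) \<le> t"
    have "r t \<in> carrier_vec l" using r AK t by (auto simp: ed lti_trajectory_def AC_def)
    then show "e t = ell \<bullet> ((F * transpose_mat Mg) *\<^sub>v r t)" using ident e_v0[OF r t] by simp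
  next
    assume "AE t in lebesgue. t \<ge> 0 \<longrightarrow> f t = 0\<^sub>v m \<and> \<eta> t = 0\<^sub>v p"
    then have G0: "AE t in lebesgue. t \<in> {0..} \<longrightarrow> G t = 0"
      by eventually_elim (auto simp: G_def)
    show "(e \<longlongrightarrow> 0) at_top" by (rule est(1)) (assumption | rule G0)+
  next
    assume "\<exists>c. AE t in lebesgue. t > 0 \<longrightarrow> f t \<bullet> f t \<le> c \<and> \<eta> t \<bullet> \<eta> t \<le> c"
    then obtain c where c: "AE t in lebesgue. t > 0 \<longrightarrow> f t \<bullet> f t \<le> c \<and> \<eta> t \<bullet> \<eta> t \<le> c" by blast
    have "AE t in lebesgue. t \<noteq> (0 :: real)" by (rule AE_completion[OF AE_lborel_singleton])
    with c have Gc: "AE t in lebesgue. t \<in> {0..} \<longrightarrow> G t \<le> 2 * c"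
      by eventually_elim (auto simp: G_def)
    show "bdd_above ((\<lambda>t. (e t)\<^sup>2) ` {0<..})" by (rule est(2)) (assumption | rule Gc)+
  next
    assume L2': "f \<in> L2 {0..} m \<and> \<eta> \<in> L2 {0..} p"
    show "square_integrable {0..} e"
    proof (rule est(3))
      have "continuous_on {0..T} (\<lambda>t. v0 \<bullet> r t)" for T
        using v0 rc AC_halflineD(2)[OF rac]
        by (intro abs_continuous_on_imp_continuous abs_continuous_on_scalar_prod[of _ _ _ l] abs_continuous_on_const) auto
      then have "continuous_on {0..} (\<lambda>t. v0 \<bullet> r t)" by (rule continuous_on_halflineI)
      then show "continuous_on {0..} e" by (rule continuous_on_eq) (simp add: e_v0[OF r])
      show "set_integrable lebesgue {0..} G"
        unfolding G_def using L2' fc \<eta>c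
        by (intro set_integral_add(1) set_integrable_scalar_prod) (auto simp: L2_def)
      show "G t \<ge> 0" for t by (simp add: G_def scalar_prod_self_nonneg)
    qed
  qed
qed

end
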